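(* Let (A1)--(A3) (stated in the context) hold and let $(p,u)\in C^1([0,T];L^2(0,1)\times L^2(0,1))\cap C([0,T];H^1(0,1)\times H^1(0,1))$ be the unique classical solution of $$\partial_t p+\partial_x u=0,\qquad \partial_t u+\partial_x p+a(u)=0,\qquad x\in(0,1),\ 0<t\le T,$$ $$u(0,t)=g_0(t),\quad u(1,t)=g_1(t),\qquad p(x,0)=p_0(x),\quad u(x,0)=u_0(x).$$ Then $(p,u)\in C^1([0,T];H^1(0,1)\times H^1(0,1))\cap C^2([0,T];L^2(0,1)\times L^2(0,1))$ and $$\|(p,u)\|_{C^1([0,T];H^1\times H^1)\cap C^2([0,T];L^2\times L^2)}\le C''$$ with a constant $C''$ depending only on the bounds for the coefficient and the data and on the time horizon $T$.
   Context: Assumptions, with $T>0$: (A1) $a\in W^{3,\infty}_{loc}(\mathbb R)$ with $a(0)=0$, $a_0\le a'(\cdot)\le a_1$, $|a''(\cdot)|\le a_2$, $|a'''(\cdot)|\le a_3$ for some positive constants $a_0,a_1,a_2,a_3>0$. (A2) $u_0=0$ and $p_0=c$ (constant function) with $c\in\mathbb R$. (A3) $g_0,g_1\in C^4([0,T])$, $g_0(0)=g_1(0)=0$ and $g_0'(0)=g_1'(0)=0$. "Bounds for the coefficient and the data" means $a_0,a_1,a_2,a_3$ and bounds for $|c|$ and $\|g_0\|_{C^4([0,T])},\|g_1\|_{C^4([0,T])}$. Under (A1)--(A3) a unique classical solution exists: a pair in the stated space that satisfies the differential equations in $L^2(0,1)$ for every $t$, the boundary conditions in the sense of traces, and the initial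 conditions. *)

theory Defs
  imports "HOL-Analysis.Analysis"
begin

text \<open>Elements of Lebesgue and Sobolev spaces are represented by functions; every notion below
  is invariant under modification on null sets.\<close>

section \<open>Weak derivatives on open subsets of the real line\<close>

definition test_function :: "real set \<Rightarrow> (real \<Rightarrow> real) \<Rightarrow> bool" where
  "test_function \<Omega> \<phi> \<longleftrightarrow>
     (\<forall>n x. (deriv ^^ n) \<phi> field_differentiable at x) \<and>
     compact (closure {x. \<phi> x \<noteq> 0}) \<and> closure {x. \<phi> x \<noteq> 0} \<subseteq> \<Omega>"

definition locally_integrable :: "real set \<Rightarrow> (real \<Rightarrow> real) \<Rightarrow> bool" where
  "locally_integrable \<Omega> f \<longleftrightarrow>
     (\<forall>K. compact K \<and> K \<subseteq> \<Omega> \<longrightarrow> integrable (lebesgue_on K) f)"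

definition has_weak_deriv ::
    "real set \<Rightarrow> nat \<Rightarrow> (real \<Rightarrow> real) \<Rightarrow> (real \<Rightarrow> real) \<Rightarrow> bool" where
  "has_weak_deriv \<Omega> k f g \<longleftrightarrow>
     locally_integrable \<Omega> f \<and> locally_integrable \<Omega> g \<and>
     (\<forall>\<phi>. test_function \<Omega> \<phi> \<longrightarrow>
        (\<integral>x. f x * (deriv ^^ k) \<phi> x \<partial>lebesgue_on \<Omega>) =
        (- 1) ^ k * (\<integral>x. g x * \<phi> x \<partial>lebesgue_on \<Omega>))"

text \<open>A representative; it is unique only up to null sets.\<close>

definition weak_deriv :: "real set \<Rightarrow> nat \<Rightarrow> (real \<Rightarrow> real) \<Rightarrow> real \<Rightarrow> real" where
  "weak_deriv \<Omega> k f = (SOME g. has_weak_deriv \<Omega> k f g)"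

definition Linf_loc :: "real set \<Rightarrow> (real \<Rightarrow> real) set" where
  "Linf_loc \<Omega> = {f. f \<in> borel_measurable (lebesgue_on \<Omega>) \<and>
     (\<forall>K. compact K \<and> K \<subseteq> \<Omega> \<longrightarrow> (\<exists>M. AE x in lebesgue_on K. \<bar>f x\<bar> \<le> M))}"

definition Winf_loc :: "nat \<Rightarrow> real set \<Rightarrow> (real \<Rightarrow> real) set" where
  "Winf_loc k \<Omega> = {f. \<forall>i\<le>k. \<exists>g. has_weak_deriv \<Omega> i f g \<and> g \<in> Linf_loc \<Omega>}"


section \<open>The spaces $L^2(0,1)$ and $H^1(0,1)$\<close>

record fun_space =
  space_carrier :: "(real \<Rightarrow> real) set"
  space_norm :: "(real \<Rightarrow> real) \<Rightarrow> real"

abbreviation unit_ivl :: "real set" where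
  "unit_ivl \<equiv> {0<..<1}"

definition L2 :: fun_space where
  "L2 = \<lparr>space_carrier = {f. f \<in> borel_measurable (lebesgue_on unit_ivl) \<and>
                             integrable (lebesgue_on unit_ivl) (\<lambda>x. (f x)\<^sup>2)},
         space_norm = (\<lambda>f. sqrt (\<integral>x. (f x)\<^sup>2 \<partial>lebesgue_on unit_ivl))\<rparr>"

definition H1 :: fun_space where
  "H1 = \<lparr>space_carrier = {f \<in> space_carrier L2.
                            \<exists>g \<in> space_carrier L2. has_weak_deriv unit_ivl 1 f g},
         space_norm = (\<lambda>f. sqrt ((space_norm L2 f)\<^sup>2 + (space_norm L2 (weak_deriv unit_ivl 1 f))\<^sup>2))\<rparr>"

text \<open>The boundary trace of an $H^1(0,1)$ function at \<open>b \<in> {0, 1}\<close> is the value at \<open>b\<close> of its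
  representative that is continuous on the closed interval.\<close>

definition has_trace :: "(real \<Rightarrow> real) \<Rightarrow> real \<Rightarrow> real \<Rightarrow> bool" where
  "has_trace f b v \<longleftrightarrow>
     (\<exists>h. continuous_on {0..1} h \<and> (AE x in lebesgue_on unit_ivl. h x = f x) \<and> h b = v)"


section \<open>The spaces $C^k([0,T];X)$\<close>

text \<open>For a curve \<open>f\<close>, the function \<open>f t\<close> is the element of the function space at time \<open>t\<close>.
  At the end points of the time interval, limits and derivatives are one-sided.\<close>

definition continuous_curve :: "fun_space \<Rightarrow> real \<Rightarrow> (real \<Rightarrow> real \<Rightarrow> real) \<Rightarrow> bool" where
  "continuous_curve X T f \<longleftrightarrow>
     (\<forall>t\<in>{0..T}. f t \<in> space_carrier X) \<and>
     (\<forall>t\<in>{0..T}. ((\<lambda>s. space_norm X (\<lambda>x. f s x - f t x)) \<longlongrightarrow> 0) (at t within {0..T}))"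

definition has_time_deriv ::
    "fun_space \<Rightarrow> real \<Rightarrow> (real \<Rightarrow> real \<Rightarrow> real) \<Rightarrow> (real \<Rightarrow> real \<Rightarrow> real) \<Rightarrow> bool" where
  "has_time_deriv X T f f' \<longleftrightarrow>
     (\<forall>t\<in>{0..T}. f t \<in> space_carrier X \<and> f' t \<in> space_carrier X) \<and>
     (\<forall>t\<in>{0..T}. ((\<lambda>s. space_norm X (\<lambda>x. (f s x - f t x) / (s - t) - f' t x)) \<longlongrightarrow> 0)
        (at t within {0..T}))"

text \<open>For each time, again a representative of a class of functions.\<close>

definition time_deriv ::
    "fun_space \<Rightarrow> real \<Rightarrow> (real \<Rightarrow> real \<Rightarrow> real) \<Rightarrow> real \<Rightarrow> real \<Rightarrow> real" where
  "time_deriv X T f = (SOME f'. has_time_deriv X T f f')"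

definition Ck_curves :: "nat \<Rightarrow> real \<Rightarrow> fun_space \<Rightarrow> (real \<Rightarrow> real \<Rightarrow> real) set" where
  "Ck_curves k T X = {f.
     (\<forall>i\<le>k. continuous_curve X T ((time_deriv X T ^^ i) f)) \<and>
     (\<forall>i<k. has_time_deriv X T ((time_deriv X T ^^ i) f) ((time_deriv X T ^^ Suc i) f))}"

text \<open>The norm of the pair \<open>(p, u)\<close> in $C^k([0,T];X\times X)$. It is meaningful only if both
  components belong to \<open>Ck_curves k T X\<close>; the suprema are then finite.\<close>

definition Ck_norm_pair ::
    "nat \<Rightarrow> real \<Rightarrow> fun_space \<Rightarrow> (real \<Rightarrow> real \<Rightarrow> real) \<Rightarrow> (real \<Rightarrow> real \<Rightarrow> real) \<Rightarrow> real" where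
  "Ck_norm_pair k T X p u =
     (\<Sum>i\<le>k. SUP t\<in>{0..T}. sqrt ((space_norm X ((time_deriv X T ^^ i) p t))\<^sup>2 +
                                 (space_norm X ((time_deriv X T ^^ i) u t))\<^sup>2))"


section \<open>The space $C^k([0,T])$\<close>

definition ivl_deriv :: "real \<Rightarrow> (real \<Rightarrow> real) \<Rightarrow> real \<Rightarrow> real" where
  "ivl_deriv T g t = vector_derivative g (at t within {0..T})"

definition Ck_ivl :: "nat \<Rightarrow> real \<Rightarrow> (real \<Rightarrow> real) set" where
  "Ck_ivl k T = {g.
     (\<forall>i\<le>k. continuous_on {0..T} ((ivl_deriv T ^^ i) g)) \<and>
     (\<forall>i<k. \<forall>t\<in>{0..T}. ((ivl_deriv T ^^ i) g has_real_derivative (ivl_deriv T ^^ Suc i) g t)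
                         (at t within {0..T}))}"

definition Ck_ivl_norm :: "nat \<Rightarrow> real \<Rightarrow> (real \<Rightarrow> real) \<Rightarrow> real" where
  "Ck_ivl_norm k T g = (\<Sum>i\<le>k. SUP t\<in>{0..T}. \<bar>(ivl_deriv T ^^ i) g t\<bar>)"


section \<open>Assumptions and classical solutions\<close>

text \<open>Continuity selects the representative of \<open>a\<close> for which the condition at \<open>0\<close> and the
  composition with a function make sense.\<close>

definition assumption_A1 ::
    "real \<Rightarrow> real \<Rightarrow> real \<Rightarrow> real \<Rightarrow> (real \<Rightarrow> real) \<Rightarrow> bool" where
  "assumption_A1 a\<^sub>0 a\<^sub>1 a\<^sub>2 a\<^sub>3 a \<longleftrightarrow>
     0 < a\<^sub>0 \<and> 0 < a\<^sub>1 \<and> 0 < a\<^sub>2 \<and> 0 < a\<^sub>3 \<and>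
     a \<in> Winf_loc 3 UNIV \<and> continuous_on UNIV a \<and> a 0 = 0 \<and>
     (AE y in lebesgue. a\<^sub>0 \<le> weak_deriv UNIV 1 a y \<and> weak_deriv UNIV 1 a y \<le> a\<^sub>1) \<and>
     (AE y in lebesgue. \<bar>weak_deriv UNIV 2 a y\<bar> \<le> a\<^sub>2) \<and>
     (AE y in lebesgue. \<bar>weak_deriv UNIV 3 a y\<bar> \<le> a\<^sub>3)"

definition assumption_A2 :: "real \<Rightarrow> (real \<Rightarrow> real) \<Rightarrow> (real \<Rightarrow> real) \<Rightarrow> bool" where
  "assumption_A2 c p\<^sub>0 u\<^sub>0 \<longleftrightarrow> (\<forall>x\<in>unit_ivl. u\<^sub>0 x = 0) \<and> (\<forall>x\<in>unit_ivl. p\<^sub>0 x = c)"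

definition assumption_A3 :: "real \<Rightarrow> (real \<Rightarrow> real) \<Rightarrow> (real \<Rightarrow> real) \<Rightarrow> bool" where
  "assumption_A3 T g\<^sub>0 g\<^sub>1 \<longleftrightarrow>
     g\<^sub>0 \<in> Ck_ivl 4 T \<and> g\<^sub>1 \<in> Ck_ivl 4 T \<and> g\<^sub>0 0 = 0 \<and> g\<^sub>1 0 = 0 \<and>
     ivl_deriv T g\<^sub>0 0 = 0 \<and> ivl_deriv T g\<^sub>1 0 = 0"

definition classical_solution ::
    "real \<Rightarrow> (real \<Rightarrow> real) \<Rightarrow> (real \<Rightarrow> real) \<Rightarrow> (real \<Rightarrow> real) \<Rightarrow>
     (real \<Rightarrow> real) \<Rightarrow> (real \<Rightarrow> real) \<Rightarrow>
     (real \<Rightarrow> real \<Rightarrow> real) \<Rightarrow> (real \<Rightarrow> real \<Rightarrow> real) \<Rightarrow> bool" where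
  "classical_solution T a g\<^sub>0 g\<^sub>1 p\<^sub>0 u\<^sub>0 p u \<longleftrightarrow>
     p \<in> Ck_curves 1 T L2 \<inter> Ck_curves 0 T H1 \<and>
     u \<in> Ck_curves 1 T L2 \<inter> Ck_curves 0 T H1 \<and>
     (\<forall>t\<in>{0<..T}. AE x in lebesgue_on unit_ivl.
        time_deriv L2 T p t x + weak_deriv unit_ivl 1 (u t) x = 0) \<and>
     (\<forall>t\<in>{0<..T}. AE x in lebesgue_on unit_ivl.
        time_deriv L2 T u t x + weak_deriv unit_ivl 1 (p t) x + a (u t x) = 0) \<and>
     (\<forall>t\<in>{0<..T}. has_trace (u t) 0 (g\<^sub>0 t) \<and> has_trace (u t) 1 (g\<^sub>1 t)) \<and>
     (AE x in lebesgue_on unit_ivl. p 0 x = p\<^sub>0 x) \<and>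
     (AE x in lebesgue_on unit_ivl. u 0 x = u\<^sub>0 x)"

end

theory Submission
  imports Defs
begin

text \<open>
  The regularity is obtained by energy estimates for difference quotients in time, and the time
  derivatives are produced by completeness of $L^2(0,1)$. No representation of the solution is used.

  Write \<open>\<gamma> = (1 - x) g\<^sub>0 + x g\<^sub>1\<close> for the affine lift of the boundary values and \<open>y = (p, u - \<gamma>)\<close>. Then
  \<open>y' + A y = f\<close> with \<open>A (P, U) = (U\<^sub>x, P\<^sub>x)\<close> on \<open>H\<^sup>1 \<times> H\<^sup>1\<^sub>0\<close> and
  \<open>f = (g\<^sub>0 - g\<^sub>1, - a u - \<gamma>')\<close>. Integration by parts makes \<open>A\<close> skew, so the energy identity gives
  \<open>\<parallel>y t\<parallel> \<le> e\<^sup>\<beta>\<^sup>t (\<parallel>y 0\<parallel> + \<alpha> t)\<close> as soon as \<open>\<parallel>f\<parallel> \<le> \<alpha> + \<beta> \<parallel>y\<parallel>\<close>. The domain of \<open>A\<close> is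
  linear and independent of time; hence difference quotients of \<open>y\<close> solve the same equation, and
  the estimate passes to \<open>z = y'\<close> with \<open>f'\<close> in place of \<open>f\<close> although \<open>z\<close> itself need not be in
  \<open>H\<^sup>1 \<times> H\<^sup>1\<^sub>0\<close> (\<open>derivative_estimate\<close>). Three applications carry the proof.

  \<^item> Applied to \<open>y\<close>, it bounds \<open>z\<close>. Since the data are compatible, \<open>z 0 = 0\<close>, and the estimate even
    yields \<open>\<parallel>z t\<parallel> = O(t)\<close>.
  \<^item> Applied to difference quotients \<open>D\<^sub>h y\<close>, it bounds \<open>D\<^sub>h z\<close> uniformly in \<open>h\<close>. The term
    that is quadratic in the first derivatives is harmless: in one dimension the equation
    \<open>u\<^sub>x = - p'\<close> bounds the supremum of \<open>D\<^sub>h u\<close> by \<open>\<parallel>D\<^sub>h z\<parallel>\<close> and the data, and the other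
    factor is already bounded in $L^2$. So the bound stays linear in \<open>\<parallel>D\<^sub>h z\<parallel>\<close>.
  \<^item> Applied to \<open>D\<^sub>h y - D\<^sub>k y\<close>, it shows that \<open>D\<^sub>h z\<close> is uniformly Cauchy
    as \<open>h\<close> tends to 0. The limit is the continuous derivative of \<open>z\<close>
    (\<open>second_order_regularity\<close>).

  The equations then express \<open>p\<^sub>x\<close> and \<open>u\<^sub>x\<close> through \<open>u'\<close>, \<open>u\<close> and \<open>p'\<close>, which turns the second
  time derivative in $L^2$ into a first time derivative in $H^1$, with explicit bounds.

  Two preparations are of a different nature. The weak derivatives are defined by test functions,
  so bump functions and the lemma of du Bois-Reymond are needed to see that a function in $H^1$ is a primitive
  of its weak derivative and that the coefficient is twice continuously differentiable. And the calculus of curves in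
  $L^2(0,1)$ is carried out in a Hilbert space type \<open>l2\<close> of classes of functions, so that
  derivatives, mean value estimates and uniform limits of curves are those of a Banach space.
\<close>

section \<open>Test functions\<close>

text \<open>The functions \<open>P(1/x) e\<^sup>-\<^sup>1\<^sup>/\<^sup>x\<close>, extended by 0 to the left. With the polynomial as a
  parameter the family is closed under differentiation, which makes the smoothness of the
  classical function at 0 a single computation.\<close>

definition flat_exp :: "real poly \<Rightarrow> real \<Rightarrow> real" where
  "flat_exp P x = (if 0 < x then poly P (1 / x) * exp (- (1 / x)) else 0)"

lemma poly_div_exp_tendsto_0:
  fixes P :: "real poly"
  shows "((\<lambda>y. poly P y / exp y) \<longlongrightarrow> 0) at_top"
proof -
  have "((\<lambda>y. \<Sum>i\<le>degree P. coeff P i * (y ^ i / exp y)) \<longlongrightarrow> (\<Sum>i\<le>degree P. coeff P i * 0)) at_top"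
    by (intro tendsto_intros tendsto_power_div_exp_0)
  then show ?thesis
    by (simp add: poly_altdef sum_divide_distrib)
qed

lemma flat_exp_tendsto_0: "((\<lambda>x. flat_exp P x) \<longlongrightarrow> 0) (at_right 0)"
proof -
  have "((\<lambda>x. poly P (inverse x) / exp (inverse x)) \<longlongrightarrow> 0) (at_right 0)"
    by (rule filterlim_compose[OF poly_div_exp_tendsto_0 filterlim_inverse_at_top_right])
  then show ?thesis
    by (rule Lim_transform_eventually)
       (auto simp: flat_exp_def exp_minus divide_inverse eventually_at_right_less
             intro: eventually_mono[OF eventually_at_right_less])
qed

lemma flat_exp_deriv:
  "(flat_exp P has_real_derivative flat_exp (pCons 0 (pCons 0 (P - pderiv P))) x) (at x)"
proof -
  consider "x > 0" | "x < 0" | "x = 0" by linarith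
  then show ?thesis
  proof cases
    case 1
    have "((\<lambda>x. poly P (1 / x) * exp (- (1 / x))) has_real_derivative
        flat_exp (pCons 0 (pCons 0 (P - pderiv P))) x) (at x)"
      using 1 unfolding flat_exp_def
      by (auto intro!: derivative_eq_intros DERIV_chain'[OF _ poly_DERIV] simp: field_simps power2_eq_square)
    then show ?thesis
      by (rule has_field_derivative_transform_within_open[of _ _ _ "{0<..}"])
         (use 1 in \<open>auto simp: flat_exp_def\<close>)
  next
    case 2
    have "((\<lambda>x. 0) has_real_derivative 0) (at x)" by simp
    then have "(flat_exp P has_real_derivative 0) (at x)"
      by (rule has_field_derivative_transform_within_open[of _ _ _ "{..<0}"])
         (use 2 in \<open>auto simp: flat_exp_def\<close>)
    then show ?thesis using 2 by (simp add: flat_exp_def)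
  next
    case 3
    have R: "((\<lambda>h. flat_exp P h / h) \<longlongrightarrow> 0) (at_right 0)"
    proof -
      have "((\<lambda>h. flat_exp (pCons 0 P) h) \<longlongrightarrow> 0) (at_right 0)" by (rule flat_exp_tendsto_0)
      then show ?thesis
        by (rule Lim_transform_eventually)
           (auto simp: flat_exp_def intro!: eventually_mono[OF eventually_at_right_less])
    qed
    have L: "((\<lambda>h. flat_exp P h / h) \<longlongrightarrow> 0) (at_left 0)"
      by (rule Lim_transform_eventually[OF tendsto_const])
         (auto simp: flat_exp_def eventually_at_filter)
    have "((\<lambda>h. flat_exp P h / h) \<longlongrightarrow> 0) (at 0)"
      using filterlim_split_at[OF L R] .
    then have "(flat_exp P has_real_derivative 0) (at 0)"
      unfolding DERIV_def by (simp add: flat_exp_def)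
    then show ?thesis using 3 by (simp add: flat_exp_def)
  qed
qed

definition smooth :: "(real \<Rightarrow> real) \<Rightarrow> bool" where
  "smooth f \<longleftrightarrow> (\<forall>n x. (deriv ^^ n) f field_differentiable at x)"

text \<open>The higher derivatives need not be computed: it suffices that they stay inside
  some set of differentiable functions.\<close>

lemma smoothI_closed:
  assumes "\<And>f. f \<in> S \<Longrightarrow> \<exists>f'\<in>S. \<forall>x. (f has_real_derivative f' x) (at x)" and "f \<in> S"
  shows "smooth f"
proof -
  have "(deriv ^^ n) f \<in> S" for n
  proof (induction n)
    case 0 then show ?case using assms(2) by simp
  next
    case (Suc n)
    then obtain f' where f': "f' \<in> S" "\<And>x. ((deriv ^^ n) f has_real_derivative f' x) (at x)"
      using assms(1) by blast
    have "deriv ((deriv ^^ n) f) = f'" using f'(2) by (auto intro!: DERIV_imp_deriv)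
    then show ?case using f'(1) by simp
  qed
  then show ?thesis unfolding smooth_def field_differentiable_def using assms(1) by blast
qed

lemma smooth_antideriv:
  assumes "smooth g" and "\<And>x. (f has_real_derivative g x) (at x)"
  shows "smooth f"
  unfolding smooth_def
proof (intro allI)
  fix n x
  have "deriv f = g" using assms(2) by (auto intro!: DERIV_imp_deriv)
  then show "(deriv ^^ n) f field_differentiable at x"
    using assms unfolding smooth_def field_differentiable_def
    by (cases n) (auto simp: funpow_Suc_right simp del: funpow.simps)
qed

lemma smooth_deriv: "smooth f \<Longrightarrow> smooth (deriv f)"
  unfolding smooth_def by (metis funpow_Suc_right o_apply)

lemma smooth_DERIV: "smooth f \<Longrightarrow> (f has_real_derivative deriv f x) (at x)"
  unfolding smooth_def by (metis DERIV_deriv_iff_field_differentiable funpow_0)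

text \<open>Bump functions are products of two reparametrized functions \<open>flat_exp P\<close>. Their derivatives
  leave the products but stay in the generated algebra, so \<open>smoothI_closed\<close> applies to it.\<close>

inductive_set flat_algebra :: "(real \<Rightarrow> real) set" where
  gen: "(\<lambda>x. flat_exp P (r * x + s)) \<in> flat_algebra"
| add: "f \<in> flat_algebra \<Longrightarrow> g \<in> flat_algebra \<Longrightarrow> (\<lambda>x. f x + g x) \<in> flat_algebra"
| mul: "f \<in> flat_algebra \<Longrightarrow> g \<in> flat_algebra \<Longrightarrow> (\<lambda>x. f x * g x) \<in> flat_algebra"
| scale: "f \<in> flat_algebra \<Longrightarrow> (\<lambda>x. k * f x) \<in> flat_algebra"

lemma flat_algebra_smooth: 
  assumes "f \<in> flat_algebra" shows "smooth f"
proof (rule smoothI_closed[OF _ assms])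
  fix f assume "f \<in> flat_algebra"
  then show "\<exists>f'\<in>flat_algebra. \<forall>x. (f has_real_derivative f' x) (at x)"
  proof induction
    case (gen P r s)
    have "((\<lambda>x. flat_exp P (r * x + s)) has_real_derivative
        flat_exp (pCons 0 (pCons 0 (P - pderiv P))) (r * x + s) * r) (at x)" for x
      by (rule DERIV_chain2[OF flat_exp_deriv]) (auto intro!: derivative_eq_intros)
    then show ?case
      by (intro bexI[of _ "\<lambda>x. r * flat_exp (pCons 0 (pCons 0 (P - pderiv P))) (r * x + s)"])
         (use flat_algebra.scale[OF flat_algebra.gen] in \<open>auto simp: mult.commute[of _ r]\<close>)
  next
    case (add f g)
    then obtain f' g' where "f' \<in> flat_algebra" "g' \<in> flat_algebra"
      "\<And>x. (f has_real_derivative f' x) (at x)" "\<And>x. (g has_real_derivative g' x) (at x)" by blast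
    then show ?case
      by (intro bexI[of _ "\<lambda>x. f' x + g' x"]) (auto intro!: derivative_eq_intros flat_algebra.intros)
  next
    case (mul f g)
    then obtain f' g' where "f' \<in> flat_algebra" "g' \<in> flat_algebra"
      "\<And>x. (f has_real_derivative f' x) (at x)" "\<And>x. (g has_real_derivative g' x) (at x)" by blast
    then show ?case
      by (intro bexI[of _ "\<lambda>x. f x * g' x + f' x * g x"]) 
         (use mul.hyps in \<open>auto intro!: derivative_eq_intros flat_algebra.intros\<close>)
  next
    case (scale f k)
    then obtain f' where "f' \<in> flat_algebra"
      "\<And>x. (f has_real_derivative f' x) (at x)" by blast
    then show ?case
      by (intro bexI[of _ "\<lambda>x. k * f' x"]) (auto intro!: derivative_eq_intros flat_algebra.intros)
  qed
qed

text \<open>The arguments vanish at \<open>c + 1/n\<close> and \<open>d - 1/n\<close> and tend to infinity inside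
  \<open>(c, d)\<close>: the supports lie in the open interval and exhaust it.\<close>

definition bump :: "nat \<Rightarrow> real \<Rightarrow> real \<Rightarrow> real \<Rightarrow> real" where
  "bump n c d x = flat_exp 1 (real n * x + (- 1 - real n * c)) * flat_exp 1 (- real n * x + (real n * d - 1))"

lemma bump_flat_algebra: "bump n c d \<in> flat_algebra"
  unfolding bump_def[abs_def] by (intro flat_algebra.intros)

lemma bump_bounds: "0 \<le> bump n c d x" "bump n c d x \<le> 1"
proof -
  have *: "0 \<le> flat_exp 1 y" "flat_exp 1 y \<le> 1" for y by (auto simp: flat_exp_def)
  show "0 \<le> bump n c d x" "bump n c d x \<le> 1"
    unfolding bump_def by (auto intro!: mult_nonneg_nonneg mult_le_one *)
qed

lemma bump_eq_0:
  assumes "x \<le> c + 1 / real n \<or> d - 1 / real n \<le> x" "n > 0"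
  shows "bump n c d x = 0"
proof -
  have "real n * x + (- 1 - real n * c) \<le> 0 \<or> - real n * x + (real n * d - 1) \<le> 0"
    using assms by (auto simp: field_simps)
  then show ?thesis by (auto simp: bump_def flat_exp_def)
qed

lemma bump_tendsto:
  "(\<lambda>n. bump n c d x) \<longlonglongrightarrow> indicator {c<..<d} x"
proof (cases "x \<in> {c<..<d}")
  case True
  have "(\<lambda>n. flat_exp 1 (real n * r - 1)) \<longlonglongrightarrow> 1" if "r > 0" for r :: real
  proof -
    have "filterlim (\<lambda>n. -1 + r * real n) at_top sequentially"
      by (intro filterlim_tendsto_add_at_top[OF tendsto_const]
          filterlim_tendsto_pos_mult_at_top[OF tendsto_const that] filterlim_real_sequentially)
    then have lim: "filterlim (\<lambda>n. real n * r + (-1)) at_top sequentially"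
      by (simp add: algebra_simps)
    have "(\<lambda>n. exp (- inverse (real n * r + (-1)))) \<longlonglongrightarrow> exp (- 0)"
      by (intro tendsto_intros tendsto_inverse_0_at_top lim)
    moreover have "eventually (\<lambda>n. 0 < real n * r + (-1)) sequentially"
      using lim unfolding filterlim_at_top_dense by blast
    then have "eventually (\<lambda>n. exp (- inverse (real n * r + (-1))) = flat_exp 1 (real n * r - 1)) sequentially"
      by (rule eventually_mono) (simp add: flat_exp_def divide_inverse)
    ultimately show ?thesis
      using Lim_transform_eventually by fastforce
  qed
  from tendsto_mult[OF this[of "x - c"] this[of "d - x"]] True
  show ?thesis by (simp add: bump_def algebra_simps)
next
  case False
  have "eventually (\<lambda>n. bump n c d x = 0) sequentially"
    using eventually_gt_at_top[of 0]
  proof (rule eventually_mono)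
    fix n :: nat assume n: "0 < n"
    then have "0 < 1 / real n" by simp
    then have "x \<le> c + 1 / real n \<or> d - 1 / real n \<le> x" using False unfolding greaterThanLessThan_iff by linarith
    then show "bump n c d x = 0" using n by (rule bump_eq_0)
  qed
  then show ?thesis using False by (simp add: tendsto_eventually)
qed


text \<open>The support is recorded by a compact interval inside \<open>(c, d)\<close>, so that sums and primitives
  are easily seen to be test functions again; on an interval this is equivalent to \<open>test_function\<close>.\<close>

definition supported_test :: "real \<Rightarrow> real \<Rightarrow> (real \<Rightarrow> real) \<Rightarrow> bool" where
  "supported_test c d \<phi> \<longleftrightarrow> smooth \<phi> \<and> (\<exists>c'>c. \<exists>d'<d. c' \<le> d' \<and> (\<forall>x. x \<notin> {c'..d'} \<longrightarrow> \<phi> x = 0))"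

lemma supported_test_imp_test_function:
  assumes "supported_test c d \<phi>" "{c<..<d} \<subseteq> \<Omega>"
  shows "test_function \<Omega> \<phi>"
proof -
  from assms obtain c' d' where cd: "c' > c" "d' < d" "\<And>x. x \<notin> {c'..d'} \<Longrightarrow> \<phi> x = 0"
    unfolding supported_test_def by blast
  have "{x. \<phi> x \<noteq> 0} \<subseteq> {c'..d'}" using cd(3) by blast
  then have sub: "closure {x. \<phi> x \<noteq> 0} \<subseteq> {c'..d'}" by (rule closure_minimal) simp
  moreover have "compact (closure {x. \<phi> x \<noteq> 0})"
    using compact_Icc[of c' d'] sub
    by (meson bounded_subset bounded_closed_interval closed_closure compact_eq_bounded_closed)
  moreover have "{c'..d'} \<subseteq> \<Omega>" using assms(2) cd by fastforce
  ultimately show ?thesis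
    using assms(1) unfolding test_function_def supported_test_def smooth_def by blast
qed

lemma test_function_Ioo_supported:
  assumes "test_function {c<..<d} \<phi>" "c < d"
  shows "supported_test c d \<phi>"
proof -
  let ?K = "closure {x. \<phi> x \<noteq> 0}"
  have K: "compact ?K" "?K \<subseteq> {c<..<d}" and sm: "smooth \<phi>"
    using assms unfolding test_function_def smooth_def by auto
  show ?thesis
  proof (cases "?K = {}")
    case True
    then have "\<phi> x = 0" for x by auto
    moreover have "c < (c + d) / 2" "(c + d) / 2 < d" using assms(2) by auto
    ultimately show ?thesis unfolding supported_test_def using sm by blast
  next
    case False
    obtain m where m: "m \<in> ?K" "\<And>x. x \<in> ?K \<Longrightarrow> m \<le> x"
      using compact_attains_inf[OF K(1) False] by blast
    obtain M where M: "M \<in> ?K" "\<And>x. x \<in> ?K \<Longrightarrow> x \<le> M"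
      using compact_attains_sup[OF K(1) False] by blast
    have "\<phi> x = 0" if "x \<notin> {m..M}" for x
      using that m(2)[of x] M(2)[of x] closure_subset[of "{x. \<phi> x \<noteq> 0}"] by auto
    moreover have "c < m" "M < d" using K(2) m(1) M(1) by auto
    moreover have "m \<le> M" using m(2)[OF M(1)] .
    ultimately show ?thesis unfolding supported_test_def using sm by blast
  qed
qed

lemma smooth_continuous: "smooth f \<Longrightarrow> continuous_on S f"
  by (meson DERIV_isCont continuous_at_imp_continuous_on smooth_DERIV)

lemma smooth_borel: "smooth f \<Longrightarrow> f \<in> borel_measurable borel"
  by (intro borel_measurable_continuous_onI smooth_continuous)

lemma supported_test_bounded: 
  assumes "supported_test c d \<phi>" shows "\<exists>B. \<forall>x. \<bar>\<phi> x\<bar> \<le> B"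
proof -
  from assms obtain c' d' where cd: "smooth \<phi>" "\<And>x. x \<notin> {c'..d'} \<Longrightarrow> \<phi> x = 0"
    unfolding supported_test_def by blast
  have "compact (\<phi> ` {c'..d'})"
    by (intro compact_continuous_image smooth_continuous[OF cd(1)] compact_Icc)
  then have "bounded (\<phi> ` {c'..d'})" by (rule compact_imp_bounded)
  then obtain B where B: "\<And>x. x \<in> {c'..d'} \<Longrightarrow> \<bar>\<phi> x\<bar> \<le> B"
    unfolding bounded_iff by (metis image_eqI real_norm_def)
  then have "\<bar>\<phi> x\<bar> \<le> max B 0" for x
    using cd(2)[of x] by (cases "x \<in> {c'..d'}") (auto simp: le_max_iff_disj)
  then show ?thesis by blast
qed

lemma supported_test_deriv:
  assumes "supported_test c d \<phi>" shows "supported_test c d (deriv \<phi>)"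
proof -
  from assms obtain c' d' where cd: "smooth \<phi>" "c < c'" "d' < d" "c' \<le> d'" "\<And>x. x \<notin> {c'..d'} \<Longrightarrow> \<phi> x = 0"
    unfolding supported_test_def by blast
  have "deriv \<phi> x = 0" if "x \<notin> {c'..d'}" for x
  proof -
    have "(\<phi> has_real_derivative 0) (at x)"
      by (rule has_field_derivative_transform_within_open[of "\<lambda>_. 0" _ _ "- {c'..d'}"])
         (use that cd(5) in \<open>auto simp: open_Compl\<close>)
    then show ?thesis by (rule DERIV_imp_deriv)
  qed
  then show ?thesis using cd smooth_deriv unfolding supported_test_def by blast
qed

lemma integrable_mult_test:
  assumes "integrable (lebesgue_on {c<..<d}) h" "supported_test c d \<phi>"
  shows "integrable (lebesgue_on {c<..<d}) (\<lambda>x. h x * \<phi> x)"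
proof -
  obtain B where B: "\<And>x. \<bar>\<phi> x\<bar> \<le> B" using supported_test_bounded[OF assms(2)] by blast
  have [measurable]: "\<phi> \<in> borel_measurable (lebesgue_on {c<..<d})"
    using assms(2) unfolding supported_test_def
    by (intro measurable_restrict_space1 measurable_completion) (simp add: smooth_borel)
  have [measurable]: "h \<in> borel_measurable (lebesgue_on {c<..<d})" using assms(1) by auto
  show ?thesis
  proof (rule Bochner_Integration.integrable_bound[of _ "\<lambda>x. B * h x"])
    have "\<bar>h x * \<phi> x\<bar> \<le> \<bar>B * h x\<bar>" for x
    proof -
      have "\<bar>h x\<bar> * \<bar>\<phi> x\<bar> \<le> \<bar>h x\<bar> * \<bar>B\<bar>" using B[of x] by (intro mult_left_mono) auto
      then show ?thesis by (simp add: abs_mult mult.commute)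
    qed
    then show "AE x in lebesgue_on {c<..<d}. norm (h x * \<phi> x) \<le> norm (B * h x)" by simp
  qed (use assms in auto)
qed

section \<open>The fundamental lemma of the calculus of variations\<close>

text \<open>The open intervals are closed under intersection and generate the Borel sets, so the Dynkin
  argument extends the vanishing of the integral from intervals to all Borel sets.\<close>

lemma AE_zero_if_interval_integrals_zero:
  fixes H :: "real \<Rightarrow> real"
  assumes H: "integrable lborel H" and zero: "\<And>a b. (\<integral>x\<in>{a<..<b}. H x \<partial>lborel) = 0"
    and tot: "(\<integral>x. H x \<partial>lborel) = 0"
  shows "AE x in lborel. H x = 0"
proof (rule sigma_finite_measure.density_zero[OF sigma_finite_lborel H])
  fix A :: "real set" assume "A \<in> sets lborel"
  then have A: "A \<in> sigma_sets UNIV (range (\<lambda>(a, b). {a<..<b}))"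
    by (simp add: borel_eq_box box_real)
  have meas: "A \<in> sets lborel" if "A \<in> sigma_sets UNIV (range (\<lambda>(a, b). {a<..<b}))" for A :: "real set"
    using that by (simp add: borel_eq_box box_real)
  have int: "set_integrable lborel A H" if "A \<in> sets lborel" for A
    unfolding set_integrable_def using integrable_mult_indicator[OF that H] .
  have IS: "Int_stable (range (\<lambda>(a, b). {a<..<b::real}))"
    by (auto simp: Int_stable_def)
  show "(\<integral>x\<in>A. H x \<partial>lborel) = 0"
  proof (rule sigma_sets_induct_disjoint[OF IS _ A, where P = "\<lambda>A. (\<integral>x\<in>A. H x \<partial>lborel) = 0"])
    show "(\<integral>x\<in>A. H x \<partial>lborel) = 0" if "A \<in> range (\<lambda>(a, b). {a<..<b})" for A
      using that zero by auto
    show "range (\<lambda>(a, b). {a<..<b::real}) \<subseteq> Pow UNIV" by simp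
    show "(\<integral>x\<in>{}. H x \<partial>lborel) = 0" by (simp add: set_lebesgue_integral_def)
    show "(\<integral>x\<in>UNIV - A. H x \<partial>lborel) = 0"
      if A: "A \<in> sigma_sets UNIV (range (\<lambda>(a, b). {a<..<b}))" and 0: "(\<integral>x\<in>A. H x \<partial>lborel) = 0" for A
    proof -
      have "(\<integral>x\<in>A \<union> (UNIV - A). H x \<partial>lborel) = (\<integral>x\<in>A. H x \<partial>lborel) + (\<integral>x\<in>UNIV - A. H x \<partial>lborel)"
        using meas[OF A] by (intro set_integral_Un int) auto
      then show ?thesis using 0 tot by (simp add: set_lebesgue_integral_def)
    qed
    show "(\<integral>x\<in>(\<Union>i. A i). H x \<partial>lborel) = 0"
      if dis: "disjoint_family A" and A: "range A \<subseteq> sigma_sets UNIV (range (\<lambda>(a, b). {a<..<b}))"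
        and 0: "\<And>i. (\<integral>x\<in>A i. H x \<partial>lborel) = 0" for A :: "nat \<Rightarrow> real set"
    proof -
      have m: "A i \<in> sets lborel" for i using A by (intro meas) auto
      have "(\<integral>x\<in>(\<Union>i. A i). H x \<partial>lborel) = (\<Sum>i. \<integral>x\<in>A i. H x \<partial>lborel)"
        by (rule lebesgue_integral_countable_add)
           (use m dis in \<open>auto simp: disjoint_family_on_def intro!: int\<close>)
      then show ?thesis using 0 by simp
    qed
  qed
qed

text \<open>Bump functions converge boundedly to the indicator of a subinterval; by dominated
  convergence \<open>h\<close> has zero integral over every subinterval.\<close>

lemma fundamental_lemma_Ioo:
  fixes h :: "real \<Rightarrow> real"
  assumes h: "integrable (lebesgue_on {c<..<d}) h"
    and ortho: "\<And>\<phi>. supported_test c d \<phi> \<Longrightarrow> (\<integral>x. h x * \<phi> x \<partial>lebesgue_on {c<..<d}) = 0"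
  shows "AE x in lebesgue_on {c<..<d}. h x = 0"
proof -
  let ?M = "lebesgue_on {c<..<d}"
  have [measurable]: "h \<in> borel_measurable ?M" using h by auto
  have ivl: "(\<integral>t. h t * indicator {x<..<y} t \<partial>?M) = 0" if xy: "c \<le> x" "y \<le> d" for x y
  proof -
    have "(\<lambda>n. \<integral>t. h t * bump n x y t \<partial>?M) \<longlonglongrightarrow> (\<integral>t. h t * indicator {x<..<y} t \<partial>?M)"
    proof (rule integral_dominated_convergence[where w = "\<lambda>t. \<bar>h t\<bar>"])
      show "(\<lambda>t. h t * bump n x y t) \<in> borel_measurable ?M" for n
      proof -
        have [measurable]: "bump n x y \<in> borel_measurable ?M"
          by (intro measurable_restrict_space1 measurable_completion)
             (simp add: smooth_borel flat_algebra_smooth bump_flat_algebra)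
        show ?thesis by measurable
      qed
      show "(\<lambda>t. h t * indicator {x<..<y} t) \<in> borel_measurable ?M"
      proof -
        have "(\<lambda>t. indicator {x<..<y} t :: real) \<in> borel_measurable ?M"
          by (intro measurable_restrict_space1 measurable_completion) simp
        then show ?thesis by measurable
      qed
      show "integrable ?M (\<lambda>t. \<bar>h t\<bar>)" using h by simp
      show "AE t in ?M. (\<lambda>n. h t * bump n x y t) \<longlonglongrightarrow> h t * indicator {x<..<y} t"
        by (intro AE_I2 tendsto_mult tendsto_const bump_tendsto)
      show "AE t in ?M. norm (h t * bump n x y t) \<le> \<bar>h t\<bar>" for n
        using bump_bounds[of n x y] by (intro AE_I2) (simp add: abs_mult mult_left_le)
    qed
    moreover have "eventually (\<lambda>n. (\<integral>t. h t * bump n x y t \<partial>?M) = 0) sequentially"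
      using eventually_gt_at_top[of 0]
    proof (rule eventually_mono)
      fix n :: nat assume n: "0 < n"
      show "(\<integral>t. h t * bump n x y t \<partial>?M) = 0"
      proof (cases "x + 1 / real n \<le> y - 1 / real n")
        case True
        have "\<forall>t. t \<notin> {x + 1 / real n..y - 1 / real n} \<longrightarrow> bump n x y t = 0"
          using n by (auto intro!: bump_eq_0)
        moreover have "x + 1 / real n > c" "y - 1 / real n < d" using xy n zero_less_divide_1_iff[of "real n"] by linarith+
        ultimately have "supported_test c d (bump n x y)"
          using True flat_algebra_smooth[OF bump_flat_algebra] unfolding supported_test_def by blast
        then show ?thesis by (rule ortho)
      next
        case False
        then have "bump n x y t = 0" for t by (intro bump_eq_0 n) linarith
        then show ?thesis by simp
      qed
    qed
    then have "(\<lambda>n. \<integral>t. h t * bump n x y t \<partial>?M) \<longlonglongrightarrow> 0" by (rule tendsto_eventually)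
    ultimately show ?thesis by (rule LIMSEQ_unique)
  qed
  \<comment> \<open>The result for Borel functions is transferred to the Lebesgue measurable \<open>h\<close> by a Borel function that agrees with it almost everywhere.\<close>
  define h1 where "h1 x = (if x \<in> {c<..<d} then h x else 0)" for x
  have h1: "integrable lebesgue h1" unfolding h1_def[abs_def]
    using h by (intro Lebesgue_Measure.integrable_restrict_UNIV[THEN iffD2]) auto
  then obtain H where H[measurable]: "H \<in> borel_measurable lborel" and eq: "AE x in lborel. h1 x = H x"
    using completion_ex_borel_measurable_real[of h1 lborel] by auto
  have eq': "AE x in lebesgue. h1 x = H x" using eq by (rule AE_completion)
  have "integrable lebesgue H"
    using h1 eq' H by (subst integrable_cong_AE[of _ _ h1]) (auto intro: measurable_completion)
  then have Hint: "integrable lborel H" by (simp add: integrable_completion)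
  have Hivl: "(\<integral>x. indicator A x * H x \<partial>lborel) = (\<integral>x. h x * indicator A x \<partial>?M)" if A: "A \<in> sets borel" for A
  proof -
    have "(\<integral>x. indicator A x * H x \<partial>lborel) = (\<integral>x. indicator A x * H x \<partial>lebesgue)"
      using A by (subst integral_completion) auto
    also have "\<dots> = (\<integral>x. indicator A x * h1 x \<partial>lebesgue)"
    proof (rule integral_cong_AE)
      have ind: "(indicator A :: real \<Rightarrow> real) \<in> borel_measurable lebesgue"
        using A by (intro measurable_completion) simp
      show "(\<lambda>x. indicator A x * H x) \<in> borel_measurable lebesgue"
        by (intro borel_measurable_times ind measurable_completion H)
      show "(\<lambda>x. indicator A x * h1 x) \<in> borel_measurable lebesgue"
        by (intro borel_measurable_times ind borel_measurable_integrable h1)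
    qed (use eq' in auto)
    also have "\<dots> = (\<integral>x. (if x \<in> {c<..<d} then h x * indicator A x else 0) \<partial>lebesgue)"
      by (intro Bochner_Integration.integral_cong) (auto simp: h1_def)
    also have "\<dots> = (\<integral>x. h x * indicator A x \<partial>?M)"
      by (rule Lebesgue_Measure.integral_restrict_UNIV) auto
    finally show ?thesis .
  qed
  have "AE x in lborel. H x = 0"
  proof (rule AE_zero_if_interval_integrals_zero[OF Hint])
    show "(\<integral>x\<in>{a<..<b}. H x \<partial>lborel) = 0" for a b
    proof -
      have "(\<integral>x\<in>{a<..<b}. H x \<partial>lborel) = (\<integral>x. h x * indicator {a<..<b} x \<partial>?M)"
        using Hivl[of "{a<..<b}"] by (simp add: set_lebesgue_integral_def)
      also have "\<dots> = (\<integral>x. h x * indicator {max a c<..<min b d} x \<partial>?M)"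
        by (intro Bochner_Integration.integral_cong) (auto simp: indicator_def)
      finally show ?thesis using ivl[of "max a c" "min b d"] by simp
    qed
    show "(\<integral>x. H x \<partial>lborel) = 0"
    proof -
      have "(\<integral>x. H x \<partial>lborel) = (\<integral>x. h x * indicator UNIV x \<partial>?M)"
        using Hivl[of UNIV] by simp
      also have "\<dots> = (\<integral>x. h x * indicator {c<..<d} x \<partial>?M)"
        by (intro Bochner_Integration.integral_cong) (auto simp: indicator_def)
      finally show ?thesis using ivl[of c d] by simp
    qed
  qed
  then have "AE x in lebesgue. H x = 0" by (rule AE_completion)
  with eq' have "AE x in lebesgue. h1 x = 0" by auto
  then show ?thesis
    by (auto simp: AE_restrict_space_iff h1_def elim: eventually_mono)
qed

section \<open>Primitives and weak derivatives on an interval\<close>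

definition prim :: "real \<Rightarrow> (real \<Rightarrow> real) \<Rightarrow> real \<Rightarrow> real" where
  "prim c f x = (\<integral>t. f t \<partial>lebesgue_on {c<..<x})"

lemma integrable_Ioo_subset:
  fixes f :: "real \<Rightarrow> real"
  assumes "integrable (lebesgue_on {c<..<d}) f" "x \<le> d"
  shows "integrable (lebesgue_on {c<..<x}) f"
proof -
  have "integrable lebesgue (\<lambda>t. indicator {c<..<x} t *\<^sub>R (if t \<in> {c<..<d} then f t else 0))"
    by (intro integrable_mult_indicator Lebesgue_Measure.integrable_restrict_UNIV[THEN iffD2] assms) auto
  also have "(\<lambda>t. indicator {c<..<x} t *\<^sub>R (if t \<in> {c<..<d} then f t else 0)) =
     (\<lambda>t. if t \<in> {c<..<x} then f t else 0)"
    using assms(2) by (auto simp: indicator_def fun_eq_iff)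
  finally show ?thesis by (subst (asm) Lebesgue_Measure.integrable_restrict_UNIV) auto
qed

lemma prim_eq_integral:
  assumes "integrable (lebesgue_on {c<..<d}) f" "x \<le> d"
  shows "prim c f x = integral {c..x} f"
  unfolding prim_def using integrable_Ioo_subset[OF assms]
  by (subst lebesgue_integral_eq_integral) (auto simp: integral_open_interval_real)

lemma prim_continuous:
  assumes "integrable (lebesgue_on {c<..<d}) f"
  shows "continuous_on {c..d} (prim c f)"
proof -
  have "f integrable_on {c<..<d}" using integrable_on_lebesgue_on[OF assms] by auto
  then have "f integrable_on {c..d}" by (simp add: integrable_on_Icc_iff_Ioo)
  then have "continuous_on {c..d} (\<lambda>x. integral {c..x} f)" by (rule indefinite_integral_continuous_1)
  then show ?thesis
    by (rule continuous_on_eq) (use assms in \<open>auto simp: prim_eq_integral\<close>)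
qed

lemma prim_left [simp]: "prim c f c = 0"
  by (simp add: prim_def)

lemma Ioo_finite_measure: "finite_measure (lebesgue_on {c<..<d::real})"
  by (rule finite_measure_lebesgue_on) auto

lemma id_meas_Ioo [measurable]: "(\<lambda>x. x) \<in> borel_measurable (lebesgue_on S)" for S :: "real set"
  using id_borel_measurable_lebesgue_on[of S] by (simp add: id_def)

lemma prim_eq_indicator:
  assumes "x \<le> d"
  shows "prim c f x = (\<integral>t. f t * indicator {..<x} t \<partial>lebesgue_on {c<..<d})"
proof -
  have "(\<integral>t. (if t \<in> {..<x} then f t else 0) \<partial>lebesgue_on {c<..<d}) =
      (\<integral>t. f t \<partial>lebesgue_on ({..<x} \<inter> {c<..<d}))"
    by (rule Lebesgue_Measure.integral_restrict_Int) auto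
  moreover have "{..<x} \<inter> {c<..<d} = {c<..<x}" using assms by auto
  ultimately have "prim c f x = (\<integral>t. (if t \<in> {..<x} then f t else 0) \<partial>lebesgue_on {c<..<d})"
    by (simp add: prim_def)
  also have "\<dots> = (\<integral>t. f t * indicator {..<x} t \<partial>lebesgue_on {c<..<d})"
    by (intro Bochner_Integration.integral_cong) auto
  finally show ?thesis .
qed

lemma prim_bound:
  assumes f: "integrable (lebesgue_on {c<..<d}) f" "x \<le> d"
  shows "\<bar>prim c f x\<bar> \<le> (\<integral>t. \<bar>f t\<bar> \<partial>lebesgue_on {c<..<d})"
proof -
  have [measurable]: "(\<lambda>t. indicator {..<x} t :: real) \<in> borel_measurable (lebesgue_on {c<..<d})"
    by (intro measurable_restrict_space1 measurable_completion) simp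
  have [measurable]: "f \<in> borel_measurable (lebesgue_on {c<..<d})" using f by auto
  have i: "integrable (lebesgue_on {c<..<d}) (\<lambda>t. f t * indicator {..<x} t)"
    by (rule Bochner_Integration.integrable_bound[OF f(1)]) (auto simp: indicator_def)
  have "\<bar>prim c f x\<bar> \<le> (\<integral>t. \<bar>f t * indicator {..<x} t\<bar> \<partial>lebesgue_on {c<..<d})"
    unfolding prim_eq_indicator[OF assms(2)] by (rule integral_abs_bound)
  also have "\<dots> \<le> (\<integral>t. \<bar>f t\<bar> \<partial>lebesgue_on {c<..<d})"
    using i f(1) by (intro integral_mono) (auto simp: indicator_def)
  finally show ?thesis .
qed

lemma prim_meas:
  assumes "integrable (lebesgue_on {c<..<d}) f"
  shows "prim c f \<in> borel_measurable (lebesgue_on {c<..<d})"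
proof -
  have "continuous_on {c<..<d} (prim c f)"
    using prim_continuous[OF assms] by (rule continuous_on_subset) auto
  then show ?thesis by (rule continuous_imp_measurable_on_sets_lebesgue) auto
qed

lemma integrable_mult_prim:
  assumes f: "integrable (lebesgue_on {c<..<d}) f" and g: "integrable (lebesgue_on {c<..<d}) g"
  shows "integrable (lebesgue_on {c<..<d}) (\<lambda>x. f x * prim c g x)"
proof -
  let ?B = "\<integral>t. \<bar>g t\<bar> \<partial>lebesgue_on {c<..<d}"
  note [measurable] = prim_meas[OF g] borel_measurable_integrable[OF f]
  show ?thesis
  proof (rule Bochner_Integration.integrable_bound[of _ "\<lambda>x. ?B * f x"])
    show "AE x in lebesgue_on {c<..<d}. norm (f x * prim c g x) \<le> norm (?B * f x)"
    proof (rule AE_I2)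
      fix x assume "x \<in> space (lebesgue_on {c<..<d})"
      then have "\<bar>prim c g x\<bar> \<le> \<bar>?B\<bar>" using prim_bound[OF g, of x] by auto
      then have "\<bar>f x\<bar> * \<bar>prim c g x\<bar> \<le> \<bar>f x\<bar> * \<bar>?B\<bar>" by (intro mult_left_mono) auto
      then show "norm (f x * prim c g x) \<le> norm (?B * f x)" by (simp add: abs_mult mult.commute)
    qed
  qed (use f in auto)
qed

text \<open>Both terms are double integrals of \<open>f(x) g(y)\<close>, over \<open>y < x\<close> and over \<open>x < y\<close>;
  the diagonal is a null set. This is integration by parts for absolutely continuous
  functions, and the source of the skew symmetry behind all energy estimates below.\<close>

lemma integral_by_parts_prim:
  assumes f: "integrable (lebesgue_on {c<..<d}) f" and g: "integrable (lebesgue_on {c<..<d}) g"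
  shows "(\<integral>x. f x * prim c g x \<partial>lebesgue_on {c<..<d}) + (\<integral>x. prim c f x * g x \<partial>lebesgue_on {c<..<d}) =
    (\<integral>x. f x \<partial>lebesgue_on {c<..<d}) * (\<integral>x. g x \<partial>lebesgue_on {c<..<d})"
proof -
  define M where "M = lebesgue_on {c<..<d}"
  interpret finite_measure M unfolding M_def by (rule Ioo_finite_measure)
  interpret pair_sigma_finite M M ..
  note f = f[folded M_def] and g = g[folded M_def]
  note [measurable] = borel_measurable_integrable[OF f] borel_measurable_integrable[OF g]
  have [measurable]: "(\<lambda>x. x) \<in> borel_measurable M" unfolding M_def by (rule id_meas_Ioo)
  have [measurable]: "(\<lambda>(x, y). f x * g y * (if x < y then 1 else 0)) \<in> borel_measurable (M \<Otimes>\<^sub>M M)"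
    by measurable
  have inty: "integrable M (\<lambda>y. f x * g y * (if x < y then 1 else 0))" for x
    by (rule Bochner_Integration.integrable_bound[of _ "\<lambda>y. f x * g y"]) (use g in auto)
  have inty': "integrable M (\<lambda>y. f x * g y * (if y < x then 1 else 0))" for x
    by (rule Bochner_Integration.integrable_bound[of _ "\<lambda>y. f x * g y"]) (use g in auto)
  have int2: "integrable (M \<Otimes>\<^sub>M M) (\<lambda>(x, y). f x * g y * (if x < y then 1 else 0))"
  proof (rule Fubini_integrable)
    let ?I = "\<lambda>x. \<integral>y. norm (case (x, y) of (x, y) \<Rightarrow> f x * g y * (if x < y then 1 else 0)) \<partial>M"
    show "integrable M ?I"
    proof (rule Bochner_Integration.integrable_bound[of _ "\<lambda>x. f x * (\<integral>y. \<bar>g y\<bar> \<partial>M)"])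
      show "AE x in M. norm (?I x) \<le> norm (f x * (\<integral>y. \<bar>g y\<bar> \<partial>M))"
      proof (rule AE_I2)
        fix x
        have "?I x \<le> (\<integral>y. \<bar>f x\<bar> * \<bar>g y\<bar> \<partial>M)"
          using integrable_norm[OF inty[of x]] g by (intro integral_mono) (auto simp: abs_mult)
        moreover have "0 \<le> ?I x" by (rule integral_nonneg_AE) simp
        moreover have "0 \<le> (\<integral>y. \<bar>g y\<bar> \<partial>M)" by (rule integral_nonneg_AE) simp
        ultimately show "norm (?I x) \<le> norm (f x * (\<integral>y. \<bar>g y\<bar> \<partial>M))"
          by (simp add: abs_mult)
      qed
    qed (use f in auto)
    show "AE x in M. integrable M (\<lambda>y. case (x, y) of (x, y) \<Rightarrow> f x * g y * (if x < y then 1 else 0))"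
      using inty by simp
  qed measurable
  have pf: "prim c f x = (\<integral>t. f t * (if t < x then 1 else 0) \<partial>M)" 
    and pg: "prim c g x = (\<integral>t. g t * (if t < x then 1 else 0) \<partial>M)" if "x \<in> space M" for x
  proof -
    have *: "prim c h x = (\<integral>t. h t * (if t < x then 1 else 0) \<partial>M)" for h
    proof -
      have "prim c h x = (\<integral>t. h t * indicator {..<x} t \<partial>M)"
        using that unfolding M_def by (intro prim_eq_indicator) auto
      also have "\<dots> = (\<integral>t. h t * (if t < x then 1 else 0) \<partial>M)"
        by (intro Bochner_Integration.integral_cong) (auto simp: indicator_def)
      finally show ?thesis .
    qed
    show "prim c f x = (\<integral>t. f t * (if t < x then 1 else 0) \<partial>M)" 
      "prim c g x = (\<integral>t. g t * (if t < x then 1 else 0) \<partial>M)" by (rule *)+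
  qed
  have "(\<integral>x. prim c f x * g x \<partial>M) = (\<integral>y. (\<integral>x. f x * g y * (if x < y then 1 else 0) \<partial>M) \<partial>M)"
    by (intro Bochner_Integration.integral_cong refl) 
       (simp add: pf mult_ac flip: integral_mult_right_zero)
  also have "\<dots> = (\<integral>x. (\<integral>y. f x * g y * (if x < y then 1 else 0) \<partial>M) \<partial>M)"
    by (rule Fubini_integral[OF int2])
  finally have 1: "(\<integral>x. prim c f x * g x \<partial>M) = (\<integral>x. (\<integral>y. f x * g y * (if x < y then 1 else 0) \<partial>M) \<partial>M)" .
  have 2: "(\<integral>x. f x * prim c g x \<partial>M) = (\<integral>x. (\<integral>y. f x * g y * (if y < x then 1 else 0) \<partial>M) \<partial>M)"
    by (intro Bochner_Integration.integral_cong refl) 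
       (simp add: pg mult_ac flip: integral_mult_right_zero)
  have 3: "integrable M (\<lambda>x. \<integral>y. f x * g y * (if x < y then 1 else 0) \<partial>M)"
    using integrable_fst[OF int2] by simp
  have 4: "integrable M (\<lambda>x. \<integral>y. f x * g y * (if y < x then 1 else 0) \<partial>M)"
    using integrable_mult_prim[OF f[unfolded M_def] g[unfolded M_def]] unfolding M_def[symmetric]
    by (subst Bochner_Integration.integrable_cong[of M M _ "\<lambda>x. f x * prim c g x"])
       (simp_all add: pg mult_ac flip: integral_mult_right_zero)
  have "(\<integral>x. f x * prim c g x \<partial>M) + (\<integral>x. prim c f x * g x \<partial>M) =
    (\<integral>x. (\<integral>y. f x * g y * (if y < x then 1 else 0) \<partial>M) + (\<integral>y. f x * g y * (if x < y then 1 else 0) \<partial>M) \<partial>M)"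
    unfolding 1 2 using 3 4 by simp
  also have "\<dots> = (\<integral>x. f x * (\<integral>y. g y \<partial>M) \<partial>M)"
  proof (intro Bochner_Integration.integral_cong refl)
    fix x assume x: "x \<in> space M"
    have "(\<integral>y. f x * g y * (if y < x then 1 else 0) \<partial>M) + (\<integral>y. f x * g y * (if x < y then 1 else 0) \<partial>M)
       = (\<integral>y. f x * g y * (if y < x then 1 else 0) + f x * g y * (if x < y then 1 else 0) \<partial>M)"
      using inty inty' by simp
    also have "\<dots> = (\<integral>y. f x * g y \<partial>M)"
    proof (rule integral_cong_AE)
      have "{x} \<in> null_sets lebesgue" by (simp flip: negligible_iff_null_sets)
      then have "AE y in lebesgue. y \<noteq> x" using AE_not_in by fastforce
      then have "AE y in M. y \<noteq> x" unfolding M_def by (auto simp: AE_restrict_space_iff)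
      then show "AE y in M. f x * g y * (if y < x then 1 else 0) + f x * g y * (if x < y then 1 else 0) = f x * g y"
        by (rule eventually_mono) auto
    qed measurable
    finally show "(\<integral>y. f x * g y * (if y < x then 1 else 0) \<partial>M) + (\<integral>y. f x * g y * (if x < y then 1 else 0) \<partial>M)
       = f x * (\<integral>y. g y \<partial>M)" by simp
  qed
  also have "\<dots> = (\<integral>x. f x \<partial>M) * (\<integral>y. g y \<partial>M)" by simp
  finally show ?thesis unfolding M_def .
qed

lemma integrable_supported_test:
  assumes "supported_test c d \<phi>" shows "integrable (lebesgue_on {c<..<d}) \<phi>"
proof -
  interpret finite_measure "lebesgue_on {c<..<d}" by (rule Ioo_finite_measure)
  show ?thesis using integrable_mult_test[OF _ assms, of "\<lambda>_. 1"] by simp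
qed

lemma supported_test_prim_deriv:
  assumes "supported_test c d \<phi>" "x \<in> {c..d}"
  shows "prim c (deriv \<phi>) x = \<phi> x"
proof -
  from assms(1) have sm: "smooth \<phi>" and 0: "\<phi> c = 0" unfolding supported_test_def by auto
  have "((deriv \<phi>) has_integral (\<phi> x - \<phi> c)) {c..x}"
  proof (rule fundamental_theorem_of_calculus)
    show "(\<phi> has_vector_derivative deriv \<phi> t) (at t within {c..x})" for t
      using smooth_DERIV[OF sm, of t] unfolding has_real_derivative_iff_has_vector_derivative
      by (rule has_vector_derivative_at_within)
  qed (use assms in auto)
  then show ?thesis
    using prim_eq_integral[OF integrable_supported_test[OF supported_test_deriv[OF assms(1)]], of x] assms 0
    by (auto simp: integral_unique)
qed

lemma integral_eq_prim: "(\<integral>t. f t \<partial>lebesgue_on {c<..<d}) = prim c f d"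
  by (simp add: prim_def)

lemma weak_deriv_if_primitive:
  assumes g: "integrable (lebesgue_on {c<..<d}) g" and f: "AE x in lebesgue_on {c<..<d}. f x = C + prim c g x"
    and meas: "f \<in> borel_measurable (lebesgue_on {c<..<d})" and cd: "c < d"
    and \<phi>: "supported_test c d \<phi>"
  shows "(\<integral>x. f x * deriv \<phi> x \<partial>lebesgue_on {c<..<d}) = - (\<integral>x. g x * \<phi> x \<partial>lebesgue_on {c<..<d})"
proof -
  let ?M = "lebesgue_on {c<..<d}"
  have \<phi>': "supported_test c d (deriv \<phi>)" by (rule supported_test_deriv[OF \<phi>])
  note i = integrable_supported_test[OF \<phi>']
  note [measurable] = prim_meas[OF g] meas borel_measurable_integrable[OF i]
  have "\<phi> d = 0" using \<phi> unfolding supported_test_def by auto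
  then have 0: "(\<integral>x. deriv \<phi> x \<partial>?M) = 0"
    using supported_test_prim_deriv[OF \<phi>, of d] cd by (simp add: integral_eq_prim)
  have "(\<integral>x. f x * deriv \<phi> x \<partial>?M) = (\<integral>x. C * deriv \<phi> x + deriv \<phi> x * prim c g x \<partial>?M)"
  proof (rule integral_cong_AE)
    show "AE x in ?M. f x * deriv \<phi> x = C * deriv \<phi> x + deriv \<phi> x * prim c g x"
      using f by (rule eventually_mono) (simp add: algebra_simps)
  qed measurable
  also have "\<dots> = (\<integral>x. deriv \<phi> x * prim c g x \<partial>?M)"
    using i integrable_mult_prim[OF i g] 0 by simp
  also have "\<dots> = - (\<integral>x. prim c (deriv \<phi>) x * g x \<partial>?M)"
    using integral_by_parts_prim[OF i g] 0 by simp
  also have "(\<integral>x. prim c (deriv \<phi>) x * g x \<partial>?M) = (\<integral>x. g x * \<phi> x \<partial>?M)"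
    by (intro Bochner_Integration.integral_cong refl) (simp add: supported_test_prim_deriv[OF \<phi>])
  finally show ?thesis .
qed

lemma smooth_lincomb:
  assumes "smooth f" "smooth g"
  shows "smooth (\<lambda>x. f x + k * g x)"
proof -
  define S where "S = (\<lambda>(f, g) x. f x + k * g x) ` (Collect smooth \<times> Collect smooth)"
  have mem: "(\<lambda>x. f x + k * g x) \<in> S" if "smooth f" "smooth g" for f g
    unfolding S_def using that by (intro image_eqI[of _ _ "(f, g)"]) auto
  show ?thesis
  proof (rule smoothI_closed[of S, OF _ mem[OF assms]])
    fix h assume "h \<in> S"
    then obtain f g where fg: "smooth f" "smooth g" and h: "h = (\<lambda>x. f x + k * g x)"
      unfolding S_def by auto
    have "(h has_real_derivative deriv f x + k * deriv g x) (at x)" for x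
      unfolding h using fg[THEN smooth_DERIV] by (auto intro!: derivative_eq_intros)
    then show "\<exists>h'\<in>S. \<forall>x. (h has_real_derivative h' x) (at x)"
      using mem[OF fg[THEN smooth_deriv]] by (intro bexI[of _ "\<lambda>x. deriv f x + k * deriv g x"]) auto
  qed
qed

lemma supported_test_lincomb:
  assumes "supported_test c d f" "supported_test c d g"
  shows "supported_test c d (\<lambda>x. f x + k * g x)"
proof -
  obtain c1 d1 where 1: "c < c1" "d1 < d" "c1 \<le> d1" "\<And>x. x \<notin> {c1..d1} \<Longrightarrow> f x = 0"
    using assms(1) unfolding supported_test_def by blast
  obtain c2 d2 where 2: "c < c2" "d2 < d" "c2 \<le> d2" "\<And>x. x \<notin> {c2..d2} \<Longrightarrow> g x = 0"
    using assms(2) unfolding supported_test_def by blast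
  have "f x + k * g x = 0" if "x \<notin> {min c1 c2..max d1 d2}" for x
  proof -
    have "x \<notin> {c1..d1}" "x \<notin> {c2..d2}" using that by auto
    then show ?thesis using 1(4) 2(4) by simp
  qed
  moreover have "c < min c1 c2" "max d1 d2 < d" "min c1 c2 \<le> max d1 d2" using 1 2 by auto
  moreover have "smooth (\<lambda>x. f x + k * g x)"
    using assms by (intro smooth_lincomb) (auto simp: supported_test_def)
  ultimately show ?thesis unfolding supported_test_def by blast
qed

text \<open>A test function is the derivative of a test function if and only if its integral
  vanishes; the integral condition makes the primitive vanish to the right of the support.\<close>

lemma supported_test_antideriv:
  assumes \<psi>: "supported_test c d \<psi>" and 0: "(\<integral>x. \<psi> x \<partial>lebesgue_on {c<..<d}) = 0"
  obtains \<phi> where "supported_test c d \<phi>" "deriv \<phi> = \<psi>" "\<And>x. x \<in> {c<..<d} \<Longrightarrow> \<phi> x = prim c \<psi> x"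
proof -
  obtain c' d' where cd: "c < c'" "d' < d" "c' \<le> d'" "\<And>x. x \<notin> {c'..d'} \<Longrightarrow> \<psi> x = 0" and sm: "smooth \<psi>"
    using \<psi> unfolding supported_test_def by blast
  define \<phi> where "\<phi> x = integral {c..x} \<psi>" for x
  have low: "\<phi> x = 0" if "x < c'" for x
  proof -
    have "integral {c..x} \<psi> = integral {c..x} (\<lambda>_. 0)"
      by (rule integral_cong) (use that cd(4) in auto)
    then show ?thesis by (simp add: \<phi>_def)
  qed
  have int: "\<psi> integrable_on {a..b}" for a b
    by (intro integrable_continuous_real smooth_continuous sm)
  have "prim c \<psi> d = 0" using 0 by (simp add: integral_eq_prim)
  then have tot: "\<phi> d = 0"
    using prim_eq_integral[OF integrable_supported_test[OF \<psi>], of d] by (simp add: \<phi>_def)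
  have zero: "integral {a..b} \<psi> = 0" if "d' < a" for a b
  proof -
    have "integral {a..b} \<psi> = integral {a..b} (\<lambda>_. 0)"
      by (rule integral_cong) (use that cd(4) in auto)
    then show ?thesis by simp
  qed
  have high: "\<phi> x = 0" if "d' < x" for x
  proof (cases "x \<le> d")
    case True
    have "\<phi> x + integral {x..d} \<psi> = \<phi> d"
      unfolding \<phi>_def by (rule Henstock_Kurzweil_Integration.integral_combine) (use True that cd int in auto)
    then show ?thesis using tot zero[of x d] that by simp
  next
    case False
    have "\<phi> d + integral {d..x} \<psi> = \<phi> x"
      unfolding \<phi>_def by (rule Henstock_Kurzweil_Integration.integral_combine) (use False cd int in auto)
    then show ?thesis using tot zero[of d x] cd by simp
  qed
  have D: "(\<phi> has_real_derivative \<psi> x) (at x)" for x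
  proof (cases "x < c'")
    case True
    have "(\<phi> has_real_derivative 0) (at x)"
      by (rule has_field_derivative_transform_within_open[of "\<lambda>_. 0" _ _ "{..<c'}"])
         (use True low in auto)
    then show ?thesis using True cd(4)[of x] by simp
  next
    case False
    have "(\<phi> has_real_derivative \<psi> x) (at x within {c..x + 1})"
      unfolding \<phi>_def[abs_def]
      by (rule integral_has_real_derivative) (use False cd sm in \<open>auto intro: smooth_continuous\<close>)
    moreover have "at x within {c..x + 1} = at x"
      by (rule at_within_interior) (use False cd in auto)
    ultimately show ?thesis by simp
  qed
  have "smooth \<phi>" using smooth_antideriv[OF sm] D by blast
  moreover have "\<forall>x. x \<notin> {c'..d'} \<longrightarrow> \<phi> x = 0" using low high by auto
  ultimately have "supported_test c d \<phi>" unfolding supported_test_def using cd by blast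
  moreover have "deriv \<phi> = \<psi>" using D by (auto intro!: DERIV_imp_deriv)
  moreover have "\<phi> x = prim c \<psi> x" if "x \<in> {c<..<d}" for x
    using prim_eq_integral[OF integrable_supported_test[OF \<psi>], of x] that by (simp add: \<phi>_def)
  ultimately show ?thesis using that by blast
qed

text \<open>If all test functions had integral 0, the fundamental lemma would give \<open>1 = 0\<close>.\<close>

lemma exists_normalized_test:
  assumes "c < d"
  obtains \<eta> where "supported_test c d \<eta>" "(\<integral>x. \<eta> x \<partial>lebesgue_on {c<..<d}) = 1"
proof -
  let ?M = "lebesgue_on {c<..<d}"
  interpret finite_measure ?M by (rule Ioo_finite_measure)
  have "\<exists>\<eta>. supported_test c d \<eta> \<and> (\<integral>x. \<eta> x \<partial>?M) \<noteq> 0"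
  proof (rule ccontr)
    assume "\<not> ?thesis"
    then have "AE x in ?M. (1::real) = 0"
      by (intro fundamental_lemma_Ioo) auto
    then have "AE x in lebesgue. x \<notin> {c<..<d}" by (simp add: AE_restrict_space_iff)
    then have "negligible {c<..<d}"
      by (auto simp: negligible_iff_null_sets AE_iff_null_sets)
    then show False using assms open_not_negligible[of "{c<..<d}"] by auto
  qed
  then obtain \<eta> where \<eta>: "supported_test c d \<eta>" "(\<integral>x. \<eta> x \<partial>?M) \<noteq> 0" by blast
  define k where "k = 1 / (\<integral>x. \<eta> x \<partial>?M)"
  have "supported_test c d (\<lambda>x. \<eta> x + (k - 1) * \<eta> x)"
    using \<eta>(1) \<eta>(1) by (rule supported_test_lincomb)
  moreover have "(\<integral>x. \<eta> x + (k - 1) * \<eta> x \<partial>?M) = 1"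
    using \<eta>(2) integrable_supported_test[OF \<eta>(1)] by (simp add: k_def algebra_simps)
  ultimately show ?thesis using that by blast
qed

text \<open>Let \<open>h = f - prim c g\<close>. The hypothesis says that \<open>h\<close> is orthogonal to the derivatives of test functions,
  that is, to the test functions with integral 0. Subtracting from an arbitrary test function
  a multiple of a normalized one shows that \<open>h - K\<close> is orthogonal to all test functions, for a suitable constant \<open>K\<close>.\<close>

lemma du_Bois_Reymond:
  assumes f: "integrable (lebesgue_on {c<..<d}) f" and g: "integrable (lebesgue_on {c<..<d}) g"
    and cd: "c < d"
    and weak: "\<And>\<phi>. supported_test c d \<phi> \<Longrightarrow>
      (\<integral>x. f x * deriv \<phi> x \<partial>lebesgue_on {c<..<d}) = - (\<integral>x. g x * \<phi> x \<partial>lebesgue_on {c<..<d})"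
  shows "\<exists>C. AE x in lebesgue_on {c<..<d}. f x = C + prim c g x"
proof -
  let ?M = "lebesgue_on {c<..<d}"
  interpret finite_measure ?M by (rule Ioo_finite_measure)
  have G: "integrable ?M (prim c g)"
    using integrable_mult_prim[OF _ g, of "\<lambda>_. 1"] by simp
  define h where "h x = f x - prim c g x" for x
  have h: "integrable ?M h" unfolding h_def using f G by simp
  obtain \<eta>0 where \<eta>0: "supported_test c d \<eta>0" "(\<integral>x. \<eta>0 x \<partial>?M) = 1"
    using exists_normalized_test[OF cd] by blast
  define K where "K = (\<integral>x. h x * \<eta>0 x \<partial>?M)"
  have "AE x in ?M. h x - K = 0"
  proof (rule fundamental_lemma_Ioo)
    show "integrable ?M (\<lambda>x. h x - K)" using h by simp
    fix \<eta> assume \<eta>: "supported_test c d \<eta>"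
    define m where "m = (\<integral>x. \<eta> x \<partial>?M)"
    note i = integrable_supported_test[OF \<eta>] integrable_supported_test[OF \<eta>0(1)]
    define \<psi> where "\<psi> = (\<lambda>x. \<eta> x + (- m) * \<eta>0 x)"
    have \<psi>: "supported_test c d \<psi>" unfolding \<psi>_def using \<eta> \<eta>0(1) by (rule supported_test_lincomb)
    have 0: "(\<integral>x. \<psi> x \<partial>?M) = 0" unfolding \<psi>_def using i \<eta>0(2) by (simp add: m_def)
    obtain \<phi> where \<phi>: "supported_test c d \<phi>" "deriv \<phi> = \<psi>" "\<And>x. x \<in> {c<..<d} \<Longrightarrow> \<phi> x = prim c \<psi> x"
      using supported_test_antideriv[OF \<psi> 0] by blast
    have "(\<integral>x. f x * \<psi> x \<partial>?M) = - (\<integral>x. g x * \<phi> x \<partial>?M)" using weak[OF \<phi>(1)] \<phi>(2) by simp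
    also have "(\<integral>x. g x * \<phi> x \<partial>?M) = (\<integral>x. g x * prim c \<psi> x \<partial>?M)"
      by (intro Bochner_Integration.integral_cong refl) (simp add: \<phi>(3))
    also have "- \<dots> = (\<integral>x. prim c g x * \<psi> x \<partial>?M)"
      using integral_by_parts_prim[OF g integrable_supported_test[OF \<psi>]] 0 by simp
    finally have "(\<integral>x. h x * \<psi> x \<partial>?M) = 0"
      using integrable_mult_test[OF f \<psi>] integrable_mult_test[OF G \<psi>]
      by (simp add: h_def left_diff_distrib)
    moreover have "(\<integral>x. h x * \<psi> x \<partial>?M) = (\<integral>x. h x * \<eta> x \<partial>?M) - m * K"
      using integrable_mult_test[OF h \<eta>] integrable_mult_test[OF h \<eta>0(1)]
      by (simp add: \<psi>_def K_def distrib_left right_diff_distrib mult.left_commute)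
    moreover have "(\<integral>x. (h x - K) * \<eta> x \<partial>?M) = (\<integral>x. h x * \<eta> x \<partial>?M) - K * m"
      using integrable_mult_test[OF h \<eta>] i by (simp add: left_diff_distrib m_def)
    ultimately show "(\<integral>x. (h x - K) * \<eta> x \<partial>?M) = 0" by simp
  qed
  then show ?thesis by (intro exI[of _ K]) (auto simp: h_def elim!: eventually_mono)
qed

section \<open>Classical regularity of the coefficient\<close>

lemma borel_measurable_lebesgue_on_AE:
  fixes f g :: "real \<Rightarrow> real"
  assumes f: "f \<in> borel_measurable (lebesgue_on S)" and eq: "AE x in lebesgue_on S. f x = g x"
    and S: "S \<in> sets lebesgue"
  shows "g \<in> borel_measurable (lebesgue_on S)"
proof -
  have "(\<lambda>x. if x \<in> S then f x else 0) \<in> borel_measurable lebesgue"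
    using f S by (simp add: borel_measurable_if)
  moreover have "AE x in lebesgue. (if x \<in> S then f x else 0) = (if x \<in> S then g x else 0)"
    using eq S by (auto simp: AE_restrict_space_iff elim: eventually_mono)
  ultimately have "(\<lambda>x. if x \<in> S then g x else 0) \<in> borel_measurable lebesgue"
    by (rule borel_measurable_AE)
  then show ?thesis using S by (simp add: borel_measurable_if)
qed

text \<open>The set where the conclusion fails is open, and nonempty open sets are not null sets.\<close>

lemma AE_closed_imp_all:
  fixes g :: "real \<Rightarrow> 'a::topological_space"
  assumes g: "continuous_on {c<..<d} g" and C: "closed C"
    and ae: "AE x in lebesgue_on {c<..<d}. g x \<in> C" and x: "x \<in> {c<..<d}"
  shows "g x \<in> C"
proof (rule ccontr)
  assume nx: "g x \<notin> C"
  let ?U = "{c<..<d} \<inter> g -` (- C)"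
  have op: "open ?U" by (rule continuous_open_preimage[OF g]) (use C in auto)
  have "AE y in lebesgue. y \<notin> ?U"
    using ae by (auto simp: AE_restrict_space_iff elim: eventually_mono)
  moreover have "?U \<in> sets lebesgue" using op by auto
  ultimately have "negligible ?U" by (auto simp: negligible_iff_null_sets AE_iff_null_sets)
  moreover have "x \<in> ?U" using nx x by auto
  ultimately show False using open_not_negligible[OF op] by blast
qed

lemma integral_supported_subset:
  assumes "supported_test c d \<phi>" "{c<..<d} \<subseteq> \<Omega>" "\<Omega> \<in> sets lebesgue"
  shows "(\<integral>x. h x * \<phi> x \<partial>lebesgue_on \<Omega>) = (\<integral>x. h x * \<phi> x \<partial>lebesgue_on {c<..<d})"
proof -
  have 0: "\<phi> x = 0" if "x \<notin> {c<..<d}" for x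
    using assms(1) that unfolding supported_test_def by force
  have "(\<integral>x. h x * \<phi> x \<partial>lebesgue_on \<Omega>) = (\<integral>x. (if x \<in> {c<..<d} then h x * \<phi> x else 0) \<partial>lebesgue_on \<Omega>)"
    using 0 by (intro Bochner_Integration.integral_cong refl) (simp del: greaterThanLessThan_iff)
  also have "\<dots> = (\<integral>x. h x * \<phi> x \<partial>lebesgue_on {c<..<d})"
    by (rule Lebesgue_Measure.integral_restrict) (use assms in auto)
  finally show ?thesis .
qed

lemma locally_integrable_Ioo:
  assumes "locally_integrable \<Omega> f" "{c..d} \<subseteq> \<Omega>"
  shows "integrable (lebesgue_on {c<..<d}) f"
proof -
  have "integrable (lebesgue_on {c..d}) f" using assms unfolding locally_integrable_def by auto
  then have "integrable lebesgue (\<lambda>x. if x \<in> {c..d} then f x else 0)"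
    by (intro Lebesgue_Measure.integrable_restrict_UNIV[THEN iffD2]) auto
  then have "integrable lebesgue (\<lambda>t. indicator {c<..<d} t *\<^sub>R (if t \<in> {c..d} then f t else 0))"
    by (intro integrable_mult_indicator) auto
  also have "(\<lambda>t. indicator {c<..<d} t *\<^sub>R (if t \<in> {c..d} then f t else 0)) =
     (\<lambda>t. if t \<in> {c<..<d} then f t else 0)"
    by (auto simp: indicator_def fun_eq_iff)
  finally show ?thesis by (subst (asm) Lebesgue_Measure.integrable_restrict_UNIV) auto
qed

lemma prim_cong_AE:
  assumes "AE x in lebesgue_on {c<..<d}. f x = g x" "x \<le> d"
    "f \<in> borel_measurable (lebesgue_on {c<..<d})"
  shows "prim c f x = prim c g x"
  unfolding prim_eq_indicator[OF assms(2)]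
proof (rule integral_cong_AE)
  have [measurable]: "(\<lambda>t. indicator {..<x} t :: real) \<in> borel_measurable (lebesgue_on {c<..<d})"
    by (intro measurable_restrict_space1 measurable_completion) simp
  note [measurable] = assms(3)
  have [measurable]: "g \<in> borel_measurable (lebesgue_on {c<..<d})"
    by (rule borel_measurable_lebesgue_on_AE[OF assms(3,1)]) auto
  show "(\<lambda>t. f t * indicator {..<x} t) \<in> borel_measurable (lebesgue_on {c<..<d})" by measurable
  show "(\<lambda>t. g t * indicator {..<x} t) \<in> borel_measurable (lebesgue_on {c<..<d})" by measurable
  show "AE t in lebesgue_on {c<..<d}. f t * indicator {..<x} t = g t * indicator {..<x} t"
    using assms(1) by (rule eventually_mono) simp
qed

lemma prim_DERIV:
  assumes g: "integrable (lebesgue_on {c<..<d}) g" and c: "continuous_on {c..d} g" and x: "x \<in> {c<..<d}"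
  shows "(prim c g has_real_derivative g x) (at x)"
proof -
  have "((\<lambda>x. integral {c..x} g) has_real_derivative g x) (at x within {c..d})"
    by (rule integral_has_real_derivative[OF c]) (use x in auto)
  then have "((\<lambda>x. integral {c..x} g) has_real_derivative g x) (at x)"
    using x by (simp add: at_within_Icc_at)
  then show ?thesis
    by (rule has_field_derivative_transform_within_open[of _ _ _ "{c<..<d}"])
       (use x prim_eq_integral[OF g] in auto)
qed

text \<open>The almost everywhere bound becomes a bound everywhere after truncation at \<open>\<plusminus> L\<close>, which
  does not change the primitive.\<close>

lemma prim_Lipschitz:
  assumes g: "integrable (lebesgue_on {c<..<d}) g" and b: "AE x in lebesgue_on {c<..<d}. \<bar>g x\<bar> \<le> L"
    and xy: "x \<in> {c..d}" "y \<in> {c..d}" and L: "0 \<le> L"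
  shows "\<bar>prim c g x - prim c g y\<bar> \<le> L * \<bar>x - y\<bar>"
proof -
  define h where "h x = max (- L) (min L (g x))" for x
  note [measurable] = borel_measurable_integrable[OF g]
  have eq: "AE x in lebesgue_on {c<..<d}. g x = h x"
    using b by (rule eventually_mono) (auto simp: h_def)
  have hm: "h \<in> borel_measurable (lebesgue_on {c<..<d})" unfolding h_def by measurable
  have h: "integrable (lebesgue_on {c<..<d}) h"
    using g eq by (subst integrable_cong_AE[of _ _ g]) (auto simp: hm elim: eventually_mono)
  have hb: "\<bar>h x\<bar> \<le> L" for x using L by (auto simp: h_def)
  have "h integrable_on {c<..<d}" using integrable_on_lebesgue_on[OF h] by auto
  then have hi: "h integrable_on {c..d}" by (simp add: integrable_on_Icc_iff_Ioo)
  have main: "\<bar>prim c h x - prim c h y\<bar> \<le> L * \<bar>x - y\<bar>" if "x \<in> {c..d}" "y \<in> {c..d}" "y \<le> x" for x y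
  proof -
    have "prim c h y + integral {y..x} h = prim c h x"
      using that by (simp add: prim_eq_integral[OF h])
        (intro Henstock_Kurzweil_Integration.integral_combine integrable_subinterval_real[OF hi], auto)
    moreover have "\<bar>integral {y..x} h\<bar> \<le> L * (x - y)"
    proof -
      have "h integrable_on {y..x}" by (rule integrable_subinterval_real[OF hi]) (use that in auto)
      then have "(h has_integral integral {y..x} h) {y..x}" by (rule integrable_integral)
      then have "norm (integral {y..x} h) \<le> L * measure lborel {y..x}"
        by (rule has_integral_bound_real[OF L finite.emptyI]) (use hb in auto)
      then show ?thesis using that by simp
    qed
    ultimately show ?thesis using that by auto
  qed
  have "prim c g x = prim c h x" "prim c g y = prim c h y"
    using xy by (auto intro!: prim_cong_AE[OF eq])
  then show ?thesis using main[of x y] main[of y x] xy by (cases "y \<le> x") (auto simp: abs_minus_commute)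
qed

lemma continuous_eq_if_AE:
  fixes f g :: "real \<Rightarrow> real"
  assumes "continuous_on {c<..<d} f" "continuous_on {c<..<d} g"
    "AE x in lebesgue_on {c<..<d}. f x = g x" "x \<in> {c<..<d}"
  shows "f x = g x"
proof -
  have "f x - g x \<in> {0}"
    by (rule AE_closed_imp_all[of c d "\<lambda>x. f x - g x"])
       (use assms in \<open>auto intro: continuous_intros elim: eventually_mono\<close>)
  then show ?thesis by simp
qed

lemma AE_lebesgue_on_subset:
  assumes "AE x in lebesgue. P x" "S \<in> sets lebesgue" shows "AE x in lebesgue_on S. P x"
  using assms by (auto simp: AE_restrict_space_iff elim: eventually_mono)

text \<open>On a bounded window the weak derivatives are integrable, and the lemma of du Bois-Reymond
  applies to each of them in turn. Thus \<open>a\<close>, its first and its second weak derivative have representatives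
  that are primitives of the next one. The windows are needed because the weak
  derivatives are integrable only locally.\<close>

lemma coefficient_regularity_window:
  assumes A1: "assumption_A1 a\<^sub>0 a\<^sub>1 a\<^sub>2 a\<^sub>3 a" and N: "N > 0"
  obtains b1 b2 where 
    "\<And>x. x \<in> {-N<..<N} \<Longrightarrow> (a has_real_derivative b1 x) (at x)"
    "\<And>x. x \<in> {-N<..<N} \<Longrightarrow> (b1 has_real_derivative b2 x) (at x)"
    "\<And>x. x \<in> {-N<..<N} \<Longrightarrow> a\<^sub>0 \<le> b1 x \<and> b1 x \<le> a\<^sub>1 \<and> \<bar>b2 x\<bar> \<le> a\<^sub>2"
    "\<And>x y. x \<in> {-N<..<N} \<Longrightarrow> y \<in> {-N<..<N} \<Longrightarrow> \<bar>b2 x - b2 y\<bar> \<le> a\<^sub>3 * \<bar>x - y\<bar>"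
proof -
  let ?c = "-N" and ?M = "lebesgue_on {-N<..<N}"
  define w where "w i = weak_deriv UNIV i a" for i
  have hw: "has_weak_deriv UNIV i a (w i)" if "i \<le> 3" for i
  proof -
    have "\<exists>g. has_weak_deriv UNIV i a g"
      using A1 that unfolding assumption_A1_def Winf_loc_def by blast
    then show ?thesis unfolding w_def weak_deriv_def by (rule someI_ex)
  qed
  have wint: "integrable ?M (w i)" if "i \<le> 3" for i
    using hw[OF that] unfolding has_weak_deriv_def by (auto intro: locally_integrable_Ioo)
  have aint: "integrable ?M a"
    using hw[of 0] unfolding has_weak_deriv_def by (auto intro: locally_integrable_Ioo)
  have weak: "(\<integral>x. a x * (deriv ^^ i) \<phi> x \<partial>?M) = (- 1) ^ i * (\<integral>x. w i x * \<phi> x \<partial>?M)"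
    if i: "i \<le> 3" and \<phi>: "supported_test ?c N \<phi>" for i \<phi>
  proof -
    have "supported_test ?c N ((deriv ^^ i) \<phi>)" by (induction i) (auto simp: \<phi> supported_test_deriv)
    from integral_supported_subset[OF this subset_UNIV, of a] integral_supported_subset[OF \<phi> subset_UNIV, of "w i"]
    have "(\<integral>x. a x * (deriv ^^ i) \<phi> x \<partial>lebesgue_on UNIV) = (\<integral>x. a x * (deriv ^^ i) \<phi> x \<partial>?M)"
      "(\<integral>x. w i x * \<phi> x \<partial>lebesgue_on UNIV) = (\<integral>x. w i x * \<phi> x \<partial>?M)" by auto
    moreover have "(\<integral>x. a x * (deriv ^^ i) \<phi> x \<partial>lebesgue_on UNIV) = (- 1) ^ i * (\<integral>x. w i x * \<phi> x \<partial>lebesgue_on UNIV)"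
      using hw[OF i] supported_test_imp_test_function[OF \<phi>, of UNIV] unfolding has_weak_deriv_def
      by blast
    ultimately show ?thesis by metis
  qed
  \<comment> \<open>Testing the weak derivative of order \<open>i\<close> with \<open>deriv \<phi>\<close> shows that each weak derivative is the weak derivative of the preceding one.\<close>
  have step: "(\<integral>x. w i x * deriv \<phi> x \<partial>?M) = - (\<integral>x. w (Suc i) x * \<phi> x \<partial>?M)"
    if i: "Suc i \<le> 3" and \<phi>: "supported_test ?c N \<phi>" for i \<phi>
  proof -
    have "(- 1) ^ i * (\<integral>x. w i x * deriv \<phi> x \<partial>?M) = (- 1) ^ Suc i * (\<integral>x. w (Suc i) x * \<phi> x \<partial>?M)"
      using weak[of i "deriv \<phi>"] weak[of "Suc i" \<phi>] i \<phi> supported_test_deriv[OF \<phi>]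
      by (simp add: funpow_Suc_right del: funpow.simps)
    also have "\<dots> = (- 1) ^ i * (- (\<integral>x. w (Suc i) x * \<phi> x \<partial>?M))" by simp
    finally show ?thesis unfolding mult_cancel_left by simp
  qed
  have cN: "?c < N" using N by simp
  obtain C0 where C0: "AE x in ?M. a x = C0 + prim ?c (w 1) x"
    using du_Bois_Reymond[OF aint wint[of 1] cN] weak[of 1] by auto
  obtain C1 where C1: "AE x in ?M. w 1 x = C1 + prim ?c (w 2) x"
    using du_Bois_Reymond[OF wint[of 1] wint[of 2] cN] step[of 1] by (auto simp: numeral_2_eq_2)
  obtain C2 where C2: "AE x in ?M. w 2 x = C2 + prim ?c (w 3) x"
    using du_Bois_Reymond[OF wint[of 2] wint[of 3] cN] step[of 2] by (auto simp: numeral_eq_Suc)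
  define b2 where "b2 x = C2 + prim ?c (w 3) x" for x
  define b1 where "b1 x = C1 + prim ?c (w 2) x" for x
  have c2: "continuous_on {?c..N} b2" unfolding b2_def[abs_def]
    using prim_continuous[OF wint[of 3]] by (intro continuous_intros) auto
  have c1: "continuous_on {?c..N} b1" unfolding b1_def[abs_def]
    using prim_continuous[OF wint[of 2]] by (intro continuous_intros) auto
  have meas: "w i \<in> borel_measurable ?M" if "i \<le> 3" for i using wint[OF that] by auto
  have sub: "{?c<..<N} \<subseteq> {?c..N}" by auto
  have b2i: "integrable ?M b2" and b1i: "integrable ?M b1"
  proof -
    have m: "b2 \<in> borel_measurable ?M" "b1 \<in> borel_measurable ?M"
      using continuous_on_subset[OF c2 sub] continuous_on_subset[OF c1 sub]
      by (auto intro: continuous_imp_measurable_on_sets_lebesgue)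
    show "integrable ?M b2" using C2 wint[of 2] m meas[of 2]
      by (subst integrable_cong_AE[of _ _ "w 2"]) (auto simp: b2_def elim: eventually_mono)
    show "integrable ?M b1" using C1 wint[of 1] m meas[of 1]
      by (subst integrable_cong_AE[of _ _ "w 1"]) (auto simp: b1_def elim: eventually_mono)
  qed
  have C2': "AE x in ?M. w 2 x = b2 x" using C2 by (simp add: b2_def)
  have C1': "AE x in ?M. w 1 x = b1 x" using C1 by (simp add: b1_def)
  have D1: "(b1 has_real_derivative b2 x) (at x)" if x: "x \<in> {-N<..<N}" for x
  proof -
    have "((\<lambda>x. C1 + prim ?c b2 x) has_real_derivative b2 x) (at x)"
      using prim_DERIV[OF b2i c2 x] by (auto intro!: derivative_eq_intros)
    then show ?thesis
      by (rule has_field_derivative_transform_within_open[of _ _ _ "{-N<..<N}"])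
         (use x prim_cong_AE[OF C2' _ meas[of 2]] in \<open>auto simp: b1_def\<close>)
  qed
  have acont: "continuous_on S a" for S
    using A1 continuous_on_subset unfolding assumption_A1_def by blast
  have aeq: "a x = C0 + prim ?c b1 x" if x: "x \<in> {-N<..<N}" for x
  proof (rule continuous_eq_if_AE[OF acont _ _ x])
    show "continuous_on {-N<..<N} (\<lambda>x. C0 + prim (- N) b1 x)"
      using continuous_on_subset[OF prim_continuous[OF b1i] sub] by (intro continuous_intros)
    show "AE x in ?M. a x = C0 + prim (- N) b1 x"
    proof -
      have "AE x in ?M. x \<in> {-N<..<N}" by (rule AE_I2) simp
      with C0 show ?thesis
        by eventually_elim (use prim_cong_AE[OF C1' _ meas[of 1]] in auto)
    qed
  qed
  have D0: "(a has_real_derivative b1 x) (at x)" if x: "x \<in> {-N<..<N}" for x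
  proof -
    have "((\<lambda>x. C0 + prim ?c b1 x) has_real_derivative b1 x) (at x)"
      using prim_DERIV[OF b1i c1 x] by (auto intro!: derivative_eq_intros)
    then show ?thesis
      by (rule has_field_derivative_transform_within_open[of _ _ _ "{-N<..<N}"])
         (use x aeq in auto)
  qed
  have ae: "AE x in ?M. a\<^sub>0 \<le> w 1 x \<and> w 1 x \<le> a\<^sub>1" "AE x in ?M. \<bar>w 2 x\<bar> \<le> a\<^sub>2" "AE x in ?M. \<bar>w 3 x\<bar> \<le> a\<^sub>3"
    using A1 unfolding assumption_A1_def w_def by (auto intro!: AE_lebesgue_on_subset)
  have B1: "b1 x \<in> {a\<^sub>0..a\<^sub>1}" if x: "x \<in> {-N<..<N}" for x
    by (rule AE_closed_imp_all[OF continuous_on_subset[OF c1 sub] _ _ x]) 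
       (use ae(1) C1' in \<open>auto elim: eventually_elim2\<close>)
  have B2: "b2 x \<in> {-a\<^sub>2..a\<^sub>2}" if x: "x \<in> {-N<..<N}" for x
  proof (rule AE_closed_imp_all[OF continuous_on_subset[OF c2 sub] _ _ x]) 
    show "AE x in ?M. b2 x \<in> {-a\<^sub>2..a\<^sub>2}" using ae(2) C2' by eventually_elim auto
  qed simp
  have a3: "0 \<le> a\<^sub>3" using A1 unfolding assumption_A1_def by auto
  have L: "\<bar>b2 x - b2 y\<bar> \<le> a\<^sub>3 * \<bar>x - y\<bar>" if "x \<in> {-N<..<N}" "y \<in> {-N<..<N}" for x y
    using prim_Lipschitz[OF wint[of 3] ae(3) _ _ a3, of x y] that by (auto simp: b2_def)
  have B: "a\<^sub>0 \<le> b1 x \<and> b1 x \<le> a\<^sub>1 \<and> \<bar>b2 x\<bar> \<le> a\<^sub>2" if "x \<in> {-N<..<N}" for x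
    using B1[OF that] B2[OF that] by auto
  show ?thesis by (rule that[of b1 b2, OF D0 D1 B L])
qed

lemma coefficient_regularity:
  assumes A1: "assumption_A1 a\<^sub>0 a\<^sub>1 a\<^sub>2 a\<^sub>3 a"
  shows "(a has_real_derivative deriv a x) (at x)"
    and "(deriv a has_real_derivative deriv (deriv a) x) (at x)"
    and "a\<^sub>0 \<le> deriv a x" "deriv a x \<le> a\<^sub>1" "\<bar>deriv (deriv a) x\<bar> \<le> a\<^sub>2"
    and "\<bar>deriv (deriv a) x - deriv (deriv a) y\<bar> \<le> a\<^sub>3 * \<bar>x - y\<bar>"
proof -
  define N where "N = max \<bar>x\<bar> \<bar>y\<bar> + 1"
  have N: "N > 0" "x \<in> {-N<..<N}" "y \<in> {-N<..<N}" unfolding N_def by auto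
  obtain b1 b2 where b:
    "\<And>x. x \<in> {-N<..<N} \<Longrightarrow> (a has_real_derivative b1 x) (at x)"
    "\<And>x. x \<in> {-N<..<N} \<Longrightarrow> (b1 has_real_derivative b2 x) (at x)"
    "\<And>x. x \<in> {-N<..<N} \<Longrightarrow> a\<^sub>0 \<le> b1 x \<and> b1 x \<le> a\<^sub>1 \<and> \<bar>b2 x\<bar> \<le> a\<^sub>2"
    "\<And>x y. x \<in> {-N<..<N} \<Longrightarrow> y \<in> {-N<..<N} \<Longrightarrow> \<bar>b2 x - b2 y\<bar> \<le> a\<^sub>3 * \<bar>x - y\<bar>"
    using coefficient_regularity_window[OF A1 N(1)] by blast
  have 1: "deriv a z = b1 z" if "z \<in> {-N<..<N}" for z using b(1)[OF that] by (rule DERIV_imp_deriv)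
  have D: "(deriv a has_real_derivative b2 z) (at z)" if "z \<in> {-N<..<N}" for z
    by (rule has_field_derivative_transform_within_open[OF b(2)[OF that], of "{-N<..<N}"])
       (use that 1 in auto)
  have 2: "deriv (deriv a) z = b2 z" if "z \<in> {-N<..<N}" for z using D[OF that] by (rule DERIV_imp_deriv)
  show "(a has_real_derivative deriv a x) (at x)" using b(1) 1 N by auto
  show "(deriv a has_real_derivative deriv (deriv a) x) (at x)" using D 2 N by auto
  show "a\<^sub>0 \<le> deriv a x" "deriv a x \<le> a\<^sub>1" "\<bar>deriv (deriv a) x\<bar> \<le> a\<^sub>2" using b(3) 1 2 N by auto
  show "\<bar>deriv (deriv a) x - deriv (deriv a) y\<bar> \<le> a\<^sub>3 * \<bar>x - y\<bar>" using b(4) 2 N by auto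
qed

section \<open>Weak derivatives on the unit interval\<close>

lemma L2_carrier_iff:
  "f \<in> space_carrier L2 \<longleftrightarrow> f \<in> borel_measurable (lebesgue_on unit_ivl) \<and> integrable (lebesgue_on unit_ivl) (\<lambda>x. (f x)\<^sup>2)"
  by (simp add: L2_def)

lemma L2_integrable:
  assumes "f \<in> space_carrier L2" shows "integrable (lebesgue_on unit_ivl) f"
proof -
  interpret finite_measure "lebesgue_on unit_ivl" by (rule Ioo_finite_measure)
  show ?thesis using assms by (auto simp: L2_carrier_iff intro: square_integrable_imp_integrable)
qed

lemma integrable_imp_locally_integrable:
  assumes "integrable (lebesgue_on \<Omega>) f" "\<Omega> \<in> sets lebesgue"
  shows "locally_integrable \<Omega> f"
  unfolding locally_integrable_def
proof (intro allI impI)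
  fix K assume K: "compact K \<and> K \<subseteq> \<Omega>"
  have Km: "K \<in> sets lebesgue" using K by (simp add: compact_imp_closed borel_closed)
  have "integrable lebesgue (\<lambda>t. indicator K t *\<^sub>R (if t \<in> \<Omega> then f t else 0))"
    by (intro integrable_mult_indicator Lebesgue_Measure.integrable_restrict_UNIV[THEN iffD2] assms Km)
  also have "(\<lambda>t. indicator K t *\<^sub>R (if t \<in> \<Omega> then f t else 0)) = (\<lambda>t. if t \<in> K then f t else 0)"
    using K by (auto simp: indicator_def fun_eq_iff)
  finally show "integrable (lebesgue_on K) f"
    using Km by (subst (asm) Lebesgue_Measure.integrable_restrict_UNIV) auto
qed

lemma has_weak_deriv_unit_iff:
  assumes f: "f \<in> space_carrier L2" and g: "g \<in> space_carrier L2"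
  shows "has_weak_deriv unit_ivl 1 f g \<longleftrightarrow> (\<exists>C. AE x in lebesgue_on unit_ivl. f x = C + prim 0 g x)"
proof
  note i = L2_integrable[OF f] L2_integrable[OF g]
  assume w: "has_weak_deriv unit_ivl 1 f g"
  show "\<exists>C. AE x in lebesgue_on unit_ivl. f x = C + prim 0 g x"
  proof (rule du_Bois_Reymond[OF i])
    fix \<phi> assume "supported_test 0 1 \<phi>"
    then have "test_function unit_ivl \<phi>" by (rule supported_test_imp_test_function) simp
    then show "(\<integral>x. f x * deriv \<phi> x \<partial>lebesgue_on unit_ivl) = - (\<integral>x. g x * \<phi> x \<partial>lebesgue_on unit_ivl)"
      using w unfolding has_weak_deriv_def by auto
  qed simp
next
  note i = L2_integrable[OF f] L2_integrable[OF g]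
  assume "\<exists>C. AE x in lebesgue_on unit_ivl. f x = C + prim 0 g x"
  then obtain C where C: "AE x in lebesgue_on unit_ivl. f x = C + prim 0 g x" by blast
  show "has_weak_deriv unit_ivl 1 f g"
    unfolding has_weak_deriv_def
  proof (intro conjI allI impI)
    fix \<phi> assume "test_function unit_ivl \<phi>"
    then have "supported_test 0 1 \<phi>" by (rule test_function_Ioo_supported) simp
    from weak_deriv_if_primitive[OF i(2) C _ _ this] i(1)
    show "(\<integral>x. f x * (deriv ^^ 1) \<phi> x \<partial>lebesgue_on unit_ivl) = (- 1) ^ 1 * (\<integral>x. g x * \<phi> x \<partial>lebesgue_on unit_ivl)"
      by auto
  qed (use i in \<open>auto intro: integrable_imp_locally_integrable\<close>)
qed

text \<open>The functions are only locally integrable, so the fundamental lemma is used on intervals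
  compactly contained in the unit interval, which exhaust it.\<close>

lemma weak_deriv_unique:
  assumes "has_weak_deriv unit_ivl 1 f g" "has_weak_deriv unit_ivl 1 f h"
  shows "AE x in lebesgue_on unit_ivl. g x = h x"
proof -
  have li: "locally_integrable unit_ivl g" "locally_integrable unit_ivl h"
    using assms unfolding has_weak_deriv_def by auto
  have win: "AE x in lebesgue_on {c<..<d}. g x - h x = 0" if cd: "0 < c" "d < 1" for c d
  proof (rule fundamental_lemma_Ioo)
    have "{c..d} \<subseteq> unit_ivl" using cd by auto
    then have i: "integrable (lebesgue_on {c<..<d}) g" "integrable (lebesgue_on {c<..<d}) h"
      using li by (auto intro: locally_integrable_Ioo)
    then show "integrable (lebesgue_on {c<..<d}) (\<lambda>x. g x - h x)" by simp
    fix \<phi> assume \<phi>: "supported_test c d \<phi>"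
    have sub: "{c<..<d} \<subseteq> unit_ivl" using cd by auto
    have "test_function unit_ivl \<phi>" by (rule supported_test_imp_test_function[OF \<phi> sub])
    then have "- (\<integral>x. g x * \<phi> x \<partial>lebesgue_on unit_ivl) = - (\<integral>x. h x * \<phi> x \<partial>lebesgue_on unit_ivl)"
      using assms unfolding has_weak_deriv_def by auto
    then have "(\<integral>x. g x * \<phi> x \<partial>lebesgue_on {c<..<d}) = (\<integral>x. h x * \<phi> x \<partial>lebesgue_on {c<..<d})"
      using integral_supported_subset[OF \<phi> sub, of g] integral_supported_subset[OF \<phi> sub, of h] by simp
    then show "(\<integral>x. (g x - h x) * \<phi> x \<partial>lebesgue_on {c<..<d}) = 0"
      using integrable_mult_test[OF i(1) \<phi>] integrable_mult_test[OF i(2) \<phi>] by (simp add: left_diff_distrib)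
  qed
  have "AE x in lebesgue. x \<in> {1 / real (Suc n)<..<1 - 1 / real (Suc n)} \<longrightarrow> g x = h x" for n
    using win[of "1 / real (Suc n)" "1 - 1 / real (Suc n)"] by (simp add: AE_restrict_space_iff)
  then have "AE x in lebesgue. \<forall>n. x \<in> {1 / real (Suc n)<..<1 - 1 / real (Suc n)} \<longrightarrow> g x = h x"
    unfolding AE_all_countable ..
  moreover have "\<exists>n. x \<in> {1 / real (Suc n)<..<1 - 1 / real (Suc n)}" if "x \<in> unit_ivl" for x
  proof -
    have "0 < min x (1 - x)" using that by auto
    then obtain n where "1 / real (Suc n) < min x (1 - x)" using nat_approx_posE by blast
    then show ?thesis by (intro exI[of _ n]) auto
  qed
  ultimately have "AE x in lebesgue. x \<in> unit_ivl \<longrightarrow> g x = h x"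
    by (elim eventually_mono) blast
  then show ?thesis by (simp add: AE_restrict_space_iff)
qed

section \<open>The Hilbert space of square integrable functions\<close>

abbreviation I01 :: "real measure" where "I01 \<equiv> lebesgue_on unit_ivl"

interpretation I01: finite_measure I01 by (rule Ioo_finite_measure)

lemma L2_add: 
  assumes "f \<in> space_carrier L2" "g \<in> space_carrier L2"
  shows "(\<lambda>x. f x + g x) \<in> space_carrier L2"
proof -
  have [measurable]: "f \<in> borel_measurable I01" "g \<in> borel_measurable I01" using assms by (auto simp: L2_carrier_iff)
  have "integrable I01 (\<lambda>x. (f x + g x)\<^sup>2)"
  proof (rule Bochner_Integration.integrable_bound[of _ "\<lambda>x. 2 * (f x)\<^sup>2 + 2 * (g x)\<^sup>2"])
    have "norm ((a + b)\<^sup>2) \<le> norm (2 * a\<^sup>2 + 2 * b\<^sup>2)" for a b :: real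
    proof -
      have "(a + b)\<^sup>2 \<le> 2 * a\<^sup>2 + 2 * b\<^sup>2"
        using zero_le_power2[of "a - b"] by (simp add: power2_sum power2_diff)
      then show ?thesis by simp
    qed
    then show "AE x in I01. norm ((f x + g x)\<^sup>2) \<le> norm (2 * (f x)\<^sup>2 + 2 * (g x)\<^sup>2)" by simp
  qed (use assms in \<open>auto simp: L2_carrier_iff\<close>)
  then show ?thesis by (simp add: L2_carrier_iff)
qed

lemma L2_scale: 
  assumes "f \<in> space_carrier L2" shows "(\<lambda>x. c * f x) \<in> space_carrier L2"
  using assms by (auto simp: L2_carrier_iff power_mult_distrib)

lemma L2_diff: 
  assumes "f \<in> space_carrier L2" "g \<in> space_carrier L2"
  shows "(\<lambda>x. f x - g x) \<in> space_carrier L2"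
  using L2_add[OF assms(1) L2_scale[OF assms(2), of "-1"]] by simp

lemma L2_zero: "(\<lambda>x. 0) \<in> space_carrier L2"
  by (simp add: L2_carrier_iff)

lemma L2_mult_integrable:
  assumes "f \<in> space_carrier L2" "g \<in> space_carrier L2"
  shows "integrable I01 (\<lambda>x. f x * g x)"
proof -
  have [measurable]: "f \<in> borel_measurable I01" "g \<in> borel_measurable I01" using assms by (auto simp: L2_carrier_iff)
  show ?thesis
  proof (rule Bochner_Integration.integrable_bound[of _ "\<lambda>x. (f x)\<^sup>2 + (g x)\<^sup>2"])
    have "norm (a * b) \<le> norm (a\<^sup>2 + b\<^sup>2)" for a b :: real
    proof -
      have "2 * (\<bar>a\<bar> * \<bar>b\<bar>) \<le> a\<^sup>2 + b\<^sup>2"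
        using zero_le_power2[of "\<bar>a\<bar> - \<bar>b\<bar>"] by (simp add: power2_diff mult.assoc)
      moreover have "0 \<le> \<bar>a\<bar> * \<bar>b\<bar>" by simp
      ultimately show ?thesis unfolding real_norm_def abs_mult by linarith
    qed
    then show "AE x in I01. norm (f x * g x) \<le> norm ((f x)\<^sup>2 + (g x)\<^sup>2)" by simp
  qed (use assms in \<open>auto simp: L2_carrier_iff\<close>)
qed

text \<open>A partial equivalence relation: functions outside $L^2(0,1)$ are related to nothing.\<close>

definition l2_rel :: "(real \<Rightarrow> real) \<Rightarrow> (real \<Rightarrow> real) \<Rightarrow> bool" where
  "l2_rel f g \<longleftrightarrow> f \<in> space_carrier L2 \<and> g \<in> space_carrier L2 \<and> (AE x in I01. f x = g x)"

lemma part_equivp_l2_rel: "part_equivp l2_rel"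
proof (rule part_equivpI)
  show "\<exists>f. l2_rel f f" using L2_zero by (auto simp: l2_rel_def)
  show "symp l2_rel" by (auto simp: symp_def l2_rel_def elim: eventually_mono)
  show "transp l2_rel" by (auto simp: transp_def l2_rel_def elim: eventually_elim2)
qed

quotient_type l2 = "real \<Rightarrow> real" / partial: l2_rel
  by (rule part_equivp_l2_rel)

instantiation l2 :: real_vector
begin
lift_definition zero_l2 :: l2 is "\<lambda>x. 0" by (simp add: l2_rel_def L2_zero)
lift_definition plus_l2 :: "l2 \<Rightarrow> l2 \<Rightarrow> l2" is "\<lambda>f g x. f x + g x"
  by (auto simp: l2_rel_def L2_add elim: eventually_elim2)
lift_definition minus_l2 :: "l2 \<Rightarrow> l2 \<Rightarrow> l2" is "\<lambda>f g x. f x - g x"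
  by (auto simp: l2_rel_def L2_diff elim: eventually_elim2)
lift_definition uminus_l2 :: "l2 \<Rightarrow> l2" is "\<lambda>f x. (-1) * f x"
  by (auto simp: l2_rel_def L2_scale[of _ "-1", simplified] elim: eventually_mono)
lift_definition scaleR_l2 :: "real \<Rightarrow> l2 \<Rightarrow> l2" is "\<lambda>c f x. c * f x"
  by (auto simp: l2_rel_def L2_scale elim: eventually_mono)
instance
  by standard (transfer, auto simp: l2_rel_def algebra_simps intro!: L2_add L2_diff L2_scale L2_zero L2_scale[of _ "-1", simplified])+
end

instantiation l2 :: real_inner
begin
lift_definition inner_l2 :: "l2 \<Rightarrow> l2 \<Rightarrow> real" is "\<lambda>f g. \<integral>x. f x * g x \<partial>I01"
proof -
  fix f f' g g' assume "l2_rel f f'" "l2_rel g g'"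
  then show "(\<integral>x. f x * g x \<partial>I01) = (\<integral>x. f' x * g' x \<partial>I01)"
    by (intro integral_cong_AE) (auto simp: l2_rel_def L2_carrier_iff elim: eventually_elim2)
qed
definition norm_l2 :: "l2 \<Rightarrow> real" where "norm_l2 x = sqrt (inner x x)"
definition dist_l2 :: "l2 \<Rightarrow> l2 \<Rightarrow> real" where "dist_l2 x y = norm (x - y)"
definition uniformity_l2 :: "(l2 \<times> l2) filter" where "uniformity_l2 = (INF e\<in>{0<..}. principal {(x, y). dist x y < e})"
definition open_l2 :: "l2 set \<Rightarrow> bool" where "open_l2 U = (\<forall>x\<in>U. \<forall>\<^sub>F (x', y) in uniformity. x' = x \<longrightarrow> y \<in> U)"
definition sgn_l2 :: "l2 \<Rightarrow> l2" where "sgn_l2 x = scaleR (inverse (norm x)) x"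
instance
proof
  fix x y z :: l2 and r :: real
  show "dist x y = norm (x - y)" by (rule dist_l2_def)
  show "(uniformity :: (l2 \<times> l2) filter) = (INF e\<in>{0<..}. principal {(x, y). dist x y < e})" by (rule uniformity_l2_def)
  show "open U = (\<forall>x\<in>U. \<forall>\<^sub>F (x', y) in uniformity. x' = x \<longrightarrow> y \<in> U)" for U :: "l2 set" by (rule open_l2_def)
  show "sgn x = scaleR (inverse (norm x)) x" by (rule sgn_l2_def)
  show "inner x y = inner y x" by transfer (simp add: mult.commute)
  show "inner (x + y) z = inner x z + inner y z"
    by transfer (auto simp: l2_rel_def distrib_right L2_mult_integrable)
  show "inner (r *\<^sub>R x) y = r * inner x y"
    by transfer (simp add: mult.assoc)
  show "0 \<le> inner x x" by transfer simp
  show "inner x x = 0 \<longleftrightarrow> x = 0"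
  proof transfer
    fix f assume f: "l2_rel f f"
    then have "integrable I01 (\<lambda>x. f x * f x)" by (auto simp: l2_rel_def L2_mult_integrable)
    then have "(\<integral>x. f x * f x \<partial>I01) = 0 \<longleftrightarrow> (AE x in I01. f x * f x = 0)"
      by (rule integral_nonneg_eq_0_iff_AE) simp
    also have "\<dots> \<longleftrightarrow> l2_rel f (\<lambda>_. 0)" using f by (simp add: l2_rel_def L2_zero)
    finally show "(\<integral>x. f x * f x \<partial>I01) = 0 \<longleftrightarrow> l2_rel f (\<lambda>_. 0)" .
  qed
  show "norm x = sqrt (inner x x)" by (rule norm_l2_def)
qed
end

abbreviation toL2 :: "(real \<Rightarrow> real) \<Rightarrow> l2" where "toL2 \<equiv> abs_l2"

text \<open>A representative, used to state pointwise properties of classes.\<close>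

definition fn :: "l2 \<Rightarrow> real \<Rightarrow> real" where "fn u = rep_l2 u"

lemma fn_carrier [simp]: "fn u \<in> space_carrier L2"
  using Quotient3_rep_reflp[OF Quotient3_l2, of u] by (simp add: fn_def l2_rel_def)

lemma toL2_fn [simp]: "toL2 (fn u) = u"
  using Quotient3_abs_rep[OF Quotient3_l2] by (simp add: fn_def)

lemma toL2_eq_iff:
  assumes "f \<in> space_carrier L2" "g \<in> space_carrier L2"
  shows "toL2 f = toL2 g \<longleftrightarrow> (AE x in I01. f x = g x)"
  using Quotient3_rel[OF Quotient3_l2, of f g] assms by (auto simp: l2_rel_def)

lemma fn_toL2: "f \<in> space_carrier L2 \<Longrightarrow> AE x in I01. fn (toL2 f) x = f x"
  by (subst toL2_eq_iff[symmetric]) auto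

lemma l2_eq_iff: "u = v \<longleftrightarrow> (AE x in I01. fn u x = fn v x)"
  using toL2_eq_iff[of "fn u" "fn v"] by simp

lemma fn_measurable [measurable, simp]: "fn u \<in> borel_measurable I01"
  using fn_carrier[of u] unfolding L2_carrier_iff by blast

lemma fn_square_integrable: "integrable I01 (\<lambda>x. (fn u x)\<^sup>2)"
  using fn_carrier[of u] unfolding L2_carrier_iff by blast

lemma fn_integrable: "integrable I01 (fn u)"
  by (rule L2_integrable) simp

lemma toL2_zero: "toL2 (\<lambda>x. 0) = 0"
  by (simp add: zero_l2.abs_eq zero_l2_def)

lemma toL2_add:
  assumes "f \<in> space_carrier L2" "g \<in> space_carrier L2"
  shows "toL2 (\<lambda>x. f x + g x) = toL2 f + toL2 g"
  using assms by (subst plus_l2.abs_eq) (auto simp: l2_rel_def)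

lemma toL2_diff:
  assumes "f \<in> space_carrier L2" "g \<in> space_carrier L2"
  shows "toL2 (\<lambda>x. f x - g x) = toL2 f - toL2 g"
  using assms by (subst minus_l2.abs_eq) (auto simp: l2_rel_def)

lemma toL2_scale:
  assumes "f \<in> space_carrier L2"
  shows "toL2 (\<lambda>x. c * f x) = c *\<^sub>R toL2 f"
  using assms by (subst scaleR_l2.abs_eq) (auto simp: l2_rel_def)

lemma fn_add: "AE x in I01. fn (u + v) x = fn u x + fn v x"
  using fn_toL2[OF L2_add[of "fn u" "fn v"]] by (simp add: toL2_add)

lemma fn_diff: "AE x in I01. fn (u - v) x = fn u x - fn v x"
  using fn_toL2[OF L2_diff[of "fn u" "fn v"]] by (simp add: toL2_diff)

lemma fn_scale: "AE x in I01. fn (c *\<^sub>R u) x = c * fn u x"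
  using fn_toL2[OF L2_scale[of "fn u" c]] by (simp add: toL2_scale)

lemma fn_zero: "AE x in I01. fn 0 x = 0"
  using fn_toL2[OF L2_zero] by (simp add: toL2_zero)

lemma inner_fn: "inner u v = (\<integral>x. fn u x * fn v x \<partial>I01)"
proof -
  have "inner (toL2 (fn u)) (toL2 (fn v)) = (\<integral>x. fn u x * fn v x \<partial>I01)"
    by (subst inner_l2.abs_eq) (auto simp: l2_rel_def)
  then show ?thesis by simp
qed

lemma norm_fn: "(norm u)\<^sup>2 = (\<integral>x. (fn u x)\<^sup>2 \<partial>I01)"
  by (simp only: power2_norm_eq_inner inner_fn) (simp add: power2_eq_square)

lemma norm_toL2:
  assumes "f \<in> space_carrier L2" shows "norm (toL2 f) = space_norm L2 f"
proof -
  have "inner (toL2 f) (toL2 f) = (\<integral>x. f x * f x \<partial>I01)"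
    using assms by (subst inner_l2.abs_eq) (auto simp: l2_rel_def)
  then show ?thesis by (simp add: norm_eq_sqrt_inner L2_def power2_eq_square)
qed

text \<open>All norm estimates for products and superpositions below reduce to pointwise comparison.\<close>

lemma norm_l2_mono:
  assumes "AE x in I01. \<bar>fn u x\<bar> \<le> k * \<bar>fn v x\<bar>" "0 \<le> k"
  shows "norm u \<le> k * norm v"
proof -
  have "(norm u)\<^sup>2 \<le> (\<integral>x. k\<^sup>2 * (fn v x)\<^sup>2 \<partial>I01)"
    unfolding norm_fn
  proof (rule integral_mono_AE)
    show "AE x in I01. (fn u x)\<^sup>2 \<le> k\<^sup>2 * (fn v x)\<^sup>2"
      using assms(1)
    proof eventually_elim
      case (elim x)
      then have "\<bar>fn u x\<bar>\<^sup>2 \<le> (k * \<bar>fn v x\<bar>)\<^sup>2" by (rule power_mono) simp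
      then show ?case by (simp add: power_mult_distrib)
    qed
  qed (simp_all add: fn_square_integrable)
  also have "\<dots> = (k * norm v)\<^sup>2" by (simp add: norm_fn power_mult_distrib)
  finally show ?thesis using assms(2) by (simp add: power2_le_iff_abs_le)
qed

text \<open>Fatou's lemma for the squares. It both shows that a pointwise limit is square
  integrable and bounds its norm, which is what completeness needs.\<close>

lemma toL2_Fatou:
  assumes h[measurable]: "h \<in> borel_measurable I01" and lim: "AE x in I01. (\<lambda>i. fn (w i) x) \<longlonglongrightarrow> h x"
    and b: "\<And>i. i \<ge> N \<Longrightarrow> norm (w i) \<le> e" and e: "0 \<le> e"
  shows "h \<in> space_carrier L2" "norm (toL2 h) \<le> e"
proof -
  have "(\<integral>\<^sup>+x. ennreal ((h x)\<^sup>2) \<partial>I01) = (\<integral>\<^sup>+x. liminf (\<lambda>i. ennreal ((fn (w i) x)\<^sup>2)) \<partial>I01)"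
  proof (rule nn_integral_cong_AE)
    show "AE x in I01. ennreal ((h x)\<^sup>2) = liminf (\<lambda>i. ennreal ((fn (w i) x)\<^sup>2))"
      using lim
    proof eventually_elim
      case (elim x)
      then have "(\<lambda>i. ennreal ((fn (w i) x)\<^sup>2)) \<longlonglongrightarrow> ennreal ((h x)\<^sup>2)"
        by (intro tendsto_ennrealI tendsto_power)
      then show ?case by (intro lim_imp_Liminf[symmetric]) auto
    qed
  qed
  also have "\<dots> \<le> liminf (\<lambda>i. \<integral>\<^sup>+x. ennreal ((fn (w i) x)\<^sup>2) \<partial>I01)"
    by (rule nn_integral_liminf) measurable
  also have "\<dots> \<le> ennreal (e\<^sup>2)"
  proof -
    have "(\<integral>\<^sup>+x. ennreal ((fn (w i) x)\<^sup>2) \<partial>I01) \<le> ennreal (e\<^sup>2)" if "i \<ge> N" for i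
    proof -
      have "(\<integral>\<^sup>+x. ennreal ((fn (w i) x)\<^sup>2) \<partial>I01) = ennreal (\<integral>x. (fn (w i) x)\<^sup>2 \<partial>I01)"
        by (rule nn_integral_eq_integral) (auto simp: fn_square_integrable)
      also have "\<dots> \<le> ennreal (e\<^sup>2)"
        unfolding norm_fn[symmetric] using b[OF that] by (intro ennreal_leI power_mono) auto
      finally show ?thesis .
    qed
    then have "eventually (\<lambda>i. (\<integral>\<^sup>+x. ennreal ((fn (w i) x)\<^sup>2) \<partial>I01) \<le> ennreal (e\<^sup>2)) sequentially"
      by (auto simp: eventually_sequentially)
    then have "liminf (\<lambda>i. \<integral>\<^sup>+x. ennreal ((fn (w i) x)\<^sup>2) \<partial>I01) \<le> liminf (\<lambda>i. ennreal (e\<^sup>2))"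
      by (rule Liminf_mono)
    then show ?thesis by (simp add: Liminf_const)
  qed
  finally have le: "(\<integral>\<^sup>+x. ennreal ((h x)\<^sup>2) \<partial>I01) \<le> ennreal (e\<^sup>2)" .
  have int: "integrable I01 (\<lambda>x. (h x)\<^sup>2)"
    by (rule integrableI_bounded) (use le in \<open>auto simp: order_le_less_trans\<close>)
  then show c: "h \<in> space_carrier L2" by (simp add: L2_carrier_iff)
  have "ennreal (\<integral>x. (h x)\<^sup>2 \<partial>I01) \<le> ennreal (e\<^sup>2)"
    using le int by (subst (asm) nn_integral_eq_integral) auto
  then have "(\<integral>x. (h x)\<^sup>2 \<partial>I01) \<le> e\<^sup>2" by (simp add: ennreal_le_iff)
  then show "norm (toL2 h) \<le> e"
    using e by (simp add: norm_toL2[OF c] L2_def real_le_lsqrt)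
qed

definition one_l2 :: l2 where "one_l2 = toL2 (\<lambda>x. 1)"

lemma L2_bounded:
  assumes [measurable]: "f \<in> borel_measurable I01" and b: "\<And>x. x \<in> unit_ivl \<Longrightarrow> \<bar>f x\<bar> \<le> B"
  shows "f \<in> space_carrier L2"
  unfolding L2_carrier_iff
proof
  show "integrable I01 (\<lambda>x. (f x)\<^sup>2)"
  proof (rule I01.integrable_const_bound[of _ "B\<^sup>2"])
    show "AE x in I01. norm ((f x)\<^sup>2) \<le> B\<^sup>2"
      by (rule AE_I2) (use b in \<open>auto intro!: power2_le_iff_abs_le[THEN iffD2] dest: order_trans[OF abs_ge_zero]\<close>)
  qed measurable
qed measurable

lemma L2_const [simp]: "(\<lambda>x. c) \<in> space_carrier L2"
  by (rule L2_bounded[of _ "\<bar>c\<bar>"]) auto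

lemma measure_I01: "measure I01 unit_ivl = 1"
  by (subst measure_restrict_space) auto

lemma norm_toL2_bounded:
  assumes [measurable]: "f \<in> borel_measurable I01" and b: "\<And>x. x \<in> unit_ivl \<Longrightarrow> \<bar>f x\<bar> \<le> B" and B: "0 \<le> B"
  shows "norm (toL2 f) \<le> B"
proof -
  have c: "f \<in> space_carrier L2" by (rule L2_bounded[of f B]) (use b in auto)
  have "(\<integral>x. (f x)\<^sup>2 \<partial>I01) \<le> (\<integral>x. B\<^sup>2 \<partial>I01)"
    using c b by (intro integral_mono) 
      (auto simp: L2_carrier_iff intro!: power2_le_iff_abs_le[THEN iffD2] B)
  also have "\<dots> = B\<^sup>2" using measure_I01 by simp
  finally show ?thesis using B by (simp add: norm_toL2[OF c] L2_def real_le_lsqrt)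
qed

lemma norm_one_l2: "norm one_l2 \<le> 1"
  unfolding one_l2_def by (rule norm_toL2_bounded) auto

lemma fn_one: "AE x in I01. fn one_l2 x = 1"
  unfolding one_l2_def by (rule fn_toL2) simp

lemma inner_one: "inner u one_l2 = (\<integral>x. fn u x \<partial>I01)"
  unfolding inner_fn by (rule integral_cong_AE) (use fn_one in \<open>auto elim: eventually_mono\<close>)

lemma integral_abs_fn_le: "(\<integral>x. \<bar>fn u x\<bar> \<partial>I01) \<le> norm u"
proof -
  have c: "(\<lambda>x. \<bar>fn u x\<bar>) \<in> space_carrier L2"
    using fn_carrier[of u] by (auto simp: L2_carrier_iff)
  define w where "w = toL2 (\<lambda>x. \<bar>fn u x\<bar>)"
  have w: "AE x in I01. fn w x = \<bar>fn u x\<bar>" unfolding w_def by (rule fn_toL2[OF c])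
  have "(\<integral>x. \<bar>fn u x\<bar> \<partial>I01) = inner w one_l2"
    unfolding inner_one by (rule integral_cong_AE) (use w in \<open>auto elim: eventually_mono\<close>)
  also have "\<dots> \<le> norm w * norm one_l2" by (rule norm_cauchy_schwarz)
  also have "\<dots> \<le> norm w * 1" by (intro mult_left_mono norm_one_l2) simp
  also have "norm w \<le> 1 * norm u"
    by (rule norm_l2_mono) (use w in \<open>auto elim: eventually_mono\<close>)
  finally show ?thesis by simp
qed

text \<open>The Riesz-Fischer theorem. A Cauchy sequence is Cauchy in $L^1$, so a
  subsequence converges almost everywhere; by Fatou's lemma its limit is the limit in $L^2$.\<close>

instance l2 :: complete_space
proof
  fix X :: "nat \<Rightarrow> l2" assume X: "Cauchy X"
  have "\<exists>N. \<forall>i\<ge>N. \<forall>j\<ge>N. (\<integral>x. norm (fn (X i) x - fn (X j) x) \<partial>I01) < e" if e: "e > 0" for e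
  proof -
    obtain N where N: "\<And>i j. i \<ge> N \<Longrightarrow> j \<ge> N \<Longrightarrow> norm (X i - X j) < e"
      using X e unfolding Cauchy_def dist_norm by metis
    have "(\<integral>x. norm (fn (X i) x - fn (X j) x) \<partial>I01) \<le> norm (X i - X j)" for i j
    proof -
      have "(\<integral>x. norm (fn (X i) x - fn (X j) x) \<partial>I01) = (\<integral>x. \<bar>fn (X i - X j) x\<bar> \<partial>I01)"
        by (rule integral_cong_AE) (use fn_diff[of "X i" "X j"] in \<open>auto elim: eventually_mono\<close>)
      then show ?thesis using integral_abs_fn_le[of "X i - X j"] by simp
    qed
    then show ?thesis using N by (meson le_less_trans)
  qed
  with cauchy_L1_AE_cauchy_subseq[of I01 "\<lambda>n. fn (X n)"] fn_integrable
  obtain r where r: "strict_mono r" and ae: "AE x in I01. Cauchy (\<lambda>i. fn (X (r i)) x)" by blast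
  define h where "h x = lim (\<lambda>i. fn (X (r i)) x)" for x
  have hm[measurable]: "h \<in> borel_measurable I01"
    unfolding h_def by (rule borel_measurable_lim_metric) measurable
  have lim: "AE x in I01. (\<lambda>i. fn (X (r i)) x) \<longlonglongrightarrow> h x"
    using ae by eventually_elim (simp add: h_def Cauchy_convergent_iff convergent_LIMSEQ_iff)
  obtain B where B: "\<And>n. norm (X n) \<le> B" "B > 0"
    using X by (metis Cauchy_Bseq BseqE)
  have hL: "h \<in> space_carrier L2"
    by (rule toL2_Fatou[OF hm lim, of 0 B]) (use B in auto)
  have "X \<longlonglongrightarrow> toL2 h"
  proof (rule LIMSEQ_I)
    fix e :: real assume e: "e > 0"
    then obtain N where N: "\<And>i j. i \<ge> N \<Longrightarrow> j \<ge> N \<Longrightarrow> norm (X i - X j) < e / 2"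
      using X half_gt_zero[OF e] unfolding Cauchy_def dist_norm by metis
    have "norm (X n - toL2 h) < e" if n: "n \<ge> N" for n
    proof -
      have "norm (toL2 (\<lambda>x. h x - fn (X n) x)) \<le> e / 2"
      proof (rule toL2_Fatou[where w = "\<lambda>i. X (r i) - X n" and N = N])
        show "AE x in I01. (\<lambda>i. fn (X (r i) - X n) x) \<longlonglongrightarrow> h x - fn (X n) x"
        proof -
          have "AE x in I01. \<forall>i. fn (X (r i) - X n) x = fn (X (r i)) x - fn (X n) x"
            unfolding AE_all_countable using fn_diff by blast
          with lim show ?thesis by eventually_elim (auto intro!: tendsto_intros)
        qed
        show "norm (X (r i) - X n) \<le> e / 2" if "i \<ge> N" for i
          using N[of "r i" n] n that seq_suble[OF r, of i] by simp
      qed (use e in auto)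
      then have "norm (toL2 h - X n) \<le> e / 2"
        using toL2_diff[OF hL fn_carrier, of "X n"] by simp
      then show ?thesis using e by (simp add: norm_minus_commute)
    qed
    then show "\<exists>N. \<forall>n\<ge>N. norm (X n - toL2 h) < e" by blast
  qed
  then show "convergent X" by (rule convergentI)
qed

section \<open>Essential bounds and multiplication operators\<close>

text \<open>Used where a remainder splits pointwise into three parts that are not
  conveniently written as elements of the space.\<close>

lemma norm_l2_mono3:
  assumes "AE x in I01. \<bar>fn u x\<bar> \<le> k1 * \<bar>fn v1 x\<bar> + k2 * \<bar>fn v2 x\<bar> + k3 * \<bar>fn v3 x\<bar>"
    "0 \<le> k1" "0 \<le> k2" "0 \<le> k3"
  shows "norm u \<le> k1 * norm v1 + k2 * norm v2 + k3 * norm v3"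
proof -
  define ab where "ab v = toL2 (\<lambda>x. \<bar>fn v x\<bar>)" for v
  have ab: "AE x in I01. fn (ab v) x = \<bar>fn v x\<bar>" for v
    unfolding ab_def by (rule fn_toL2) (use fn_carrier[of v] in \<open>auto simp: L2_carrier_iff\<close>)
  have nab: "norm (ab v) \<le> norm v" for v
  proof -
    have "AE x in I01. \<bar>fn (ab v) x\<bar> \<le> 1 * \<bar>fn v x\<bar>" using ab[of v] by (rule eventually_mono) simp
    then show ?thesis using norm_l2_mono[of "ab v" 1 v] by simp
  qed
  let ?w = "k1 *\<^sub>R ab v1 + k2 *\<^sub>R ab v2 + k3 *\<^sub>R ab v3"
  have "AE x in I01. fn ?w x = k1 * \<bar>fn v1 x\<bar> + k2 * \<bar>fn v2 x\<bar> + k3 * \<bar>fn v3 x\<bar>"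
    using fn_add[of "k1 *\<^sub>R ab v1 + k2 *\<^sub>R ab v2" "k3 *\<^sub>R ab v3"] fn_add[of "k1 *\<^sub>R ab v1" "k2 *\<^sub>R ab v2"]
      fn_scale[of k1 "ab v1"] fn_scale[of k2 "ab v2"] fn_scale[of k3 "ab v3"] ab[of v1] ab[of v2] ab[of v3]
    by eventually_elim simp
  with assms(1) have "AE x in I01. \<bar>fn u x\<bar> \<le> 1 * \<bar>fn ?w x\<bar>"
    by eventually_elim linarith
  then have "norm u \<le> norm ?w" using norm_l2_mono[of u 1 ?w] by simp
  also have "\<dots> \<le> norm (k1 *\<^sub>R ab v1) + norm (k2 *\<^sub>R ab v2) + norm (k3 *\<^sub>R ab v3)"
    by (rule norm_triangle_le[OF add_right_mono[OF norm_triangle_ineq]])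
  also have "\<dots> \<le> k1 * norm v1 + k2 * norm v2 + k3 * norm v3"
    using assms nab by (auto intro!: add_mono mult_left_mono)
  finally show ?thesis .
qed

text \<open>Supremum bounds on some factors keep products of two square integrable functions in the space.\<close>

definition ess_bounded :: "real \<Rightarrow> l2 \<Rightarrow> bool" where
  "ess_bounded k u \<longleftrightarrow> 0 \<le> k \<and> (AE x in I01. \<bar>fn u x\<bar> \<le> k)"

lemma ess_bounded_add:
  assumes "ess_bounded k u" "ess_bounded l v" shows "ess_bounded (k + l) (u + v)"
proof -
  have "AE x in I01. \<bar>fn (u + v) x\<bar> \<le> k + l"
    using assms[unfolded ess_bounded_def, THEN conjunct2] fn_add[of u v] by eventually_elim simp
  then show ?thesis using assms by (simp add: ess_bounded_def)
qed

lemma ess_bounded_scale: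
  assumes "ess_bounded k u" shows "ess_bounded (\<bar>c\<bar> * k) (c *\<^sub>R u)"
proof -
  have "AE x in I01. \<bar>fn (c *\<^sub>R u) x\<bar> \<le> \<bar>c\<bar> * k"
    using assms[unfolded ess_bounded_def, THEN conjunct2] fn_scale[of c u] 
    by eventually_elim (simp add: abs_mult mult_left_mono)
  then show ?thesis using assms by (simp add: ess_bounded_def)
qed

lemma ess_bounded_mono: "ess_bounded k u \<Longrightarrow> k \<le> l \<Longrightarrow> ess_bounded l u"
  by (auto simp: ess_bounded_def elim: eventually_mono)

lemma ess_bounded_one: "ess_bounded 1 one_l2"
  using fn_one by (auto simp: ess_bounded_def elim: eventually_mono)

text \<open>The excess \<open>(\<bar>v\<bar> - k)\<^sup>+\<close> is dominated by \<open>\<bar>v - w n\<bar>\<close>, so its norm is 0.\<close>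

lemma ess_bounded_limit:
  assumes b: "\<forall>\<^sub>F n in F. ess_bounded k (w n)" and lim: "(w \<longlongrightarrow> v) F" and F: "F \<noteq> bot"
  shows "ess_bounded k v"
proof -
  have k: "0 \<le> k" using eventually_happens[OF b] F unfolding ess_bounded_def by blast
  have c: "(\<lambda>x. max 0 (\<bar>fn v x\<bar> - k)) \<in> space_carrier L2"
    unfolding L2_carrier_iff
  proof
    show "integrable I01 (\<lambda>x. (max 0 (\<bar>fn v x\<bar> - k))\<^sup>2)"
    proof (rule Bochner_Integration.integrable_bound[OF fn_square_integrable[of v]])
      have "(max 0 (\<bar>y\<bar> - k))\<^sup>2 \<le> y\<^sup>2" for y :: real
        using k by (subst abs_le_square_iff[symmetric]) (auto simp: max_def)
      then show "AE x in I01. norm ((max 0 (\<bar>fn v x\<bar> - k))\<^sup>2) \<le> norm ((fn v x)\<^sup>2)" by simp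
    qed measurable
  qed measurable
  define e where "e = toL2 (\<lambda>x. max 0 (\<bar>fn v x\<bar> - k))"
  have e: "AE x in I01. fn e x = max 0 (\<bar>fn v x\<bar> - k)" unfolding e_def by (rule fn_toL2[OF c])
  have "\<forall>\<^sub>F n in F. norm e \<le> norm (v - w n)"
    using b
  proof (rule eventually_mono)
    fix n assume "ess_bounded k (w n)"
    then have "AE x in I01. \<bar>fn (w n) x\<bar> \<le> k" by (simp add: ess_bounded_def)
    with e fn_diff[of v "w n"] have "AE x in I01. \<bar>fn e x\<bar> \<le> 1 * \<bar>fn (v - w n) x\<bar>"
      by eventually_elim auto
    then show "norm e \<le> norm (v - w n)" using norm_l2_mono[of e 1 "v - w n"] by simp
  qed
  moreover have "((\<lambda>n. norm (v - w n)) \<longlongrightarrow> norm (v - v)) F"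
    by (intro tendsto_intros lim)
  ultimately have "norm e \<le> norm (v - v)"
    by (intro tendsto_lowerbound[OF _ _ F])
  then have "e = 0" by simp
  then have "AE x in I01. max 0 (\<bar>fn v x\<bar> - k) = 0" using e fn_zero
    by (auto elim: eventually_elim2)
  then show ?thesis using k by (auto simp: ess_bounded_def elim!: eventually_mono)
qed

definition mul :: "(real \<Rightarrow> real) \<Rightarrow> l2 \<Rightarrow> l2" where
  "mul m u = toL2 (\<lambda>x. m x * fn u x)"

lemma mul_carrier:
  assumes [measurable]: "m \<in> borel_measurable I01" and b: "AE x in I01. \<bar>m x\<bar> \<le> k"
  shows "(\<lambda>x. m x * fn u x) \<in> space_carrier L2"
  unfolding L2_carrier_iff
proof
  show "integrable I01 (\<lambda>x. (m x * fn u x)\<^sup>2)"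
  proof (rule Bochner_Integration.integrable_bound[of _ "\<lambda>x. k\<^sup>2 * (fn u x)\<^sup>2"])
    show "AE x in I01. norm ((m x * fn u x)\<^sup>2) \<le> norm (k\<^sup>2 * (fn u x)\<^sup>2)"
      using b
    proof eventually_elim
      case (elim x)
      then have "\<bar>m x\<bar>\<^sup>2 \<le> k\<^sup>2" by (rule power_mono) simp
      then show ?case by (simp add: power_mult_distrib mult_right_mono)
    qed
  qed (simp_all add: fn_square_integrable)
qed measurable

lemma fn_mul:
  assumes "m \<in> borel_measurable I01" "AE x in I01. \<bar>m x\<bar> \<le> k"
  shows "AE x in I01. fn (mul m u) x = m x * fn u x"
  unfolding mul_def by (rule fn_toL2[OF mul_carrier[OF assms]])

lemma norm_mul:
  assumes "m \<in> borel_measurable I01" "AE x in I01. \<bar>m x\<bar> \<le> k" "0 \<le> k"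
  shows "norm (mul m u) \<le> k * norm u"
proof (rule norm_l2_mono[OF _ assms(3)])
  show "AE x in I01. \<bar>fn (mul m u) x\<bar> \<le> k * \<bar>fn u x\<bar>"
    using fn_mul[OF assms(1,2), of u] assms(2) 
    by eventually_elim (simp add: abs_mult mult_right_mono)
qed

lemma bounded_linear_mul:
  assumes m: "m \<in> borel_measurable I01" "AE x in I01. \<bar>m x\<bar> \<le> k" and k: "0 \<le> k"
  shows "bounded_linear (mul m)"
proof (rule bounded_linear_intro)
  fix u v :: l2 and r :: real
  show "mul m (u + v) = mul m u + mul m v"
    unfolding l2_eq_iff
    using fn_mul[OF m, of "u + v"] fn_mul[OF m, of u] fn_mul[OF m, of v] fn_add[of "mul m u" "mul m v"] fn_add[of u v]
    by eventually_elim (simp add: algebra_simps)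
  show "mul m (r *\<^sub>R u) = r *\<^sub>R mul m u"
    unfolding l2_eq_iff
    using fn_mul[OF m, of "r *\<^sub>R u"] fn_mul[OF m, of u] fn_scale[of r "mul m u"] fn_scale[of r u]
    by eventually_elim (simp add: algebra_simps)
  show "norm (mul m u) \<le> norm u * k" using norm_mul[OF m k] by (simp add: mult.commute)
qed

section \<open>The Volterra operator and H1 functions\<close>

text \<open>Integration from the left end point. Describing $H^1$ through this bounded operator
  replaces the unbounded derivative in all limit arguments.\<close>

definition J :: "l2 \<Rightarrow> l2" where "J u = toL2 (prim 0 (fn u))"

lemma prim_fn_bound: "x \<le> 1 \<Longrightarrow> \<bar>prim 0 (fn u) x\<bar> \<le> norm u"
  using prim_bound[OF fn_integrable, of x u] integral_abs_fn_le[of u] by simp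

lemma prim_carrier: 
  assumes "g \<in> space_carrier L2" shows "prim 0 g \<in> space_carrier L2"
  by (rule L2_bounded[OF prim_meas[OF L2_integrable[OF assms]], of "\<integral>t. \<bar>g t\<bar> \<partial>I01"])
     (use prim_bound[OF L2_integrable[OF assms]] in auto)

lemma fn_J: "AE x in I01. fn (J u) x = prim 0 (fn u) x"
  unfolding J_def by (rule fn_toL2) (simp add: prim_carrier)

lemma prim_toL2: "g \<in> space_carrier L2 \<Longrightarrow> x \<le> 1 \<Longrightarrow> prim 0 (fn (toL2 g)) x = prim 0 g x"
  by (rule prim_cong_AE[OF fn_toL2]) auto

text \<open>The one-dimensional Sobolev inequality for functions that vanish at the left end point.\<close>

lemma ess_bounded_J: "ess_bounded (norm u) (J u)"
proof -
  have "AE x in I01. x \<in> unit_ivl" by (rule AE_I2) simp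
  then have "AE x in I01. \<bar>fn (J u) x\<bar> \<le> norm u"
    using fn_J[of u] by eventually_elim (simp add: prim_fn_bound)
  then show ?thesis by (simp add: ess_bounded_def)
qed

lemma norm_ess_bounded: 
  assumes "ess_bounded k u" shows "norm u \<le> k"
proof -
  have "AE x in I01. \<bar>fn u x\<bar> \<le> k * \<bar>fn one_l2 x\<bar>"
    using assms[unfolded ess_bounded_def, THEN conjunct2] fn_one by eventually_elim simp
  then have "norm u \<le> k * norm one_l2" using assms by (intro norm_l2_mono) (auto simp: ess_bounded_def)
  also have "\<dots> \<le> k * 1" using assms norm_one_l2 by (intro mult_left_mono) (auto simp: ess_bounded_def)
  finally show ?thesis by simp
qed

lemma prim_add:
  assumes "integrable I01 f" "integrable I01 g" "x \<le> 1"
  shows "prim 0 (\<lambda>x. f x + g x) x = prim 0 f x + prim 0 g x"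
  unfolding prim_def using integrable_Ioo_subset[OF assms(1,3)] integrable_Ioo_subset[OF assms(2,3)] by simp

lemma prim_scale: "prim 0 (\<lambda>x. c * f x) x = c * prim 0 f x"
  unfolding prim_def by simp

lemma bounded_linear_J: "bounded_linear J"
proof (rule bounded_linear_intro)
  fix u v :: l2 and r :: real
  have I: "AE x in I01. x \<in> unit_ivl" by (rule AE_I2) simp
  show "J (u + v) = J u + J v"
    unfolding l2_eq_iff
    using I fn_J[of "u + v"] fn_J[of u] fn_J[of v] fn_add[of "J u" "J v"]
  proof eventually_elim
    case (elim x)
    have "prim 0 (fn (u + v)) x = prim 0 (\<lambda>x. fn u x + fn v x) x"
      by (rule prim_cong_AE[OF fn_add]) (use elim in auto)
    with elim show ?case by (simp add: prim_add fn_integrable)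
  qed
  show "J (r *\<^sub>R u) = r *\<^sub>R J u"
    unfolding l2_eq_iff
    using I fn_J[of "r *\<^sub>R u"] fn_J[of u] fn_scale[of r "J u"]
  proof eventually_elim
    case (elim x)
    have "prim 0 (fn (r *\<^sub>R u)) x = prim 0 (\<lambda>x. r * fn u x) x"
      by (rule prim_cong_AE[OF fn_scale]) (use elim in auto)
    with elim show ?case by (simp add: prim_scale)
  qed
  show "norm (J u) \<le> norm u * 1" using norm_ess_bounded[OF ess_bounded_J] by simp
qed

lemma prim_fn_measurable [measurable]: "prim 0 (fn u) \<in> borel_measurable I01"
  by (rule prim_meas[OF fn_integrable])

text \<open>\<open>J\<close> is skew up to a rank one term, which vanishes when one of the primitives is
  also zero at the right end point.\<close>

lemma J_skew: "inner (J u) v + inner u (J v) = inner u one_l2 * inner v one_l2"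
proof -
  have "inner u (J v) = (\<integral>x. fn u x * prim 0 (fn v) x \<partial>I01)"
    unfolding inner_fn by (rule integral_cong_AE) 
      (use fn_J[of v] in \<open>auto elim: eventually_mono\<close>)
  moreover have "inner (J u) v = (\<integral>x. prim 0 (fn u) x * fn v x \<partial>I01)"
    unfolding inner_fn by (rule integral_cong_AE) 
      (use fn_J[of u] in \<open>auto elim: eventually_mono\<close>)
  ultimately show ?thesis
    using integral_by_parts_prim[OF fn_integrable[of u] fn_integrable[of v]]
    by (simp add: inner_one add.commute)
qed

lemma inner_one_one: "inner one_l2 one_l2 = 1"
proof -
  have "inner one_l2 one_l2 = (\<integral>x. 1 \<partial>I01)"
    unfolding inner_one by (rule integral_cong_AE) (use fn_one in auto)
  then show ?thesis using measure_I01 by simp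
qed

text \<open>\<open>H1rel u q\<close>: the class \<open>u\<close> is in $H^1(0,1)$ with weak derivative \<open>q\<close>. \<open>H10rel u q\<close>: in addition
  the boundary values of \<open>u\<close> are zero; here the free constant disappears and the integral of \<open>q\<close> is
  the value at the right end point.\<close>

definition H1rel :: "l2 \<Rightarrow> l2 \<Rightarrow> bool" where
  "H1rel u q \<longleftrightarrow> (\<exists>C. u = C *\<^sub>R one_l2 + J q)"

definition H10rel :: "l2 \<Rightarrow> l2 \<Rightarrow> bool" where
  "H10rel u q \<longleftrightarrow> u = J q \<and> inner q one_l2 = 0"

lemma H1rel_H10rel_skew:
  assumes "H1rel p q" "H10rel u r"
  shows "inner p r + inner u q = 0"
proof -
  obtain C where p: "p = C *\<^sub>R one_l2 + J q" using assms(1) unfolding H1rel_def by blast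
  have u: "u = J r" "inner r one_l2 = 0" using assms(2) unfolding H10rel_def by auto
  have "inner p r + inner u q = C * inner r one_l2 + (inner (J q) r + inner q (J r))"
    by (simp add: p u(1) inner_add_left inner_commute[of "J r" q]) (simp add: inner_commute inner_add_right)
  then show ?thesis using u(2) J_skew[of q r] by simp
qed

lemma H1rel_diff: "H1rel u q \<Longrightarrow> H1rel u' q' \<Longrightarrow> H1rel (u - u') (q - q')"
  unfolding H1rel_def
proof (elim exE)
  fix C C' assume "u = C *\<^sub>R one_l2 + J q" "u' = C' *\<^sub>R one_l2 + J q'"
  then have "u - u' = (C - C') *\<^sub>R one_l2 + J (q - q')"
    using linear_diff[OF bounded_linear.linear[OF bounded_linear_J]] by (simp add: algebra_simps)
  then show "\<exists>C. u - u' = C *\<^sub>R one_l2 + J (q - q')" by blast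
qed

lemma H1rel_scale: "H1rel u q \<Longrightarrow> H1rel (c *\<^sub>R u) (c *\<^sub>R q)"
  unfolding H1rel_def
proof (elim exE)
  fix C assume "u = C *\<^sub>R one_l2 + J q"
  then have "c *\<^sub>R u = (c * C) *\<^sub>R one_l2 + J (c *\<^sub>R q)"
    using linear_scale[OF bounded_linear.linear[OF bounded_linear_J]] by (simp add: algebra_simps)
  then show "\<exists>C. c *\<^sub>R u = C *\<^sub>R one_l2 + J (c *\<^sub>R q)" by blast
qed

lemma H10rel_diff: "H10rel u q \<Longrightarrow> H10rel u' q' \<Longrightarrow> H10rel (u - u') (q - q')"
  using linear_diff[OF bounded_linear.linear[OF bounded_linear_J]] by (simp add: H10rel_def inner_diff_left)

lemma H10rel_scale: "H10rel u q \<Longrightarrow> H10rel (c *\<^sub>R u) (c *\<^sub>R q)"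
  using linear_scale[OF bounded_linear.linear[OF bounded_linear_J]] by (simp add: H10rel_def)

lemma toL2_eq_primitive_iff:
  assumes f: "f \<in> space_carrier L2" and g: "g \<in> space_carrier L2"
  shows "toL2 f = C *\<^sub>R one_l2 + J (toL2 g) \<longleftrightarrow> (AE x in I01. f x = C + prim 0 g x)"
proof -
  have I: "AE x in I01. x \<in> unit_ivl" by (rule AE_I2) simp
  have R: "AE x in I01. fn (C *\<^sub>R one_l2 + J (toL2 g)) x = C + prim 0 g x"
    using I fn_add[of "C *\<^sub>R one_l2" "J (toL2 g)"] fn_scale[of C one_l2] fn_one fn_J[of "toL2 g"]
    by eventually_elim (simp add: prim_toL2[OF g])
  show ?thesis
  proof
    assume "toL2 f = C *\<^sub>R one_l2 + J (toL2 g)"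
    with R have "AE x in I01. fn (toL2 f) x = C + prim 0 g x" by simp
    with fn_toL2[OF f] show "AE x in I01. f x = C + prim 0 g x" by eventually_elim simp
  next
    assume "AE x in I01. f x = C + prim 0 g x"
    with R fn_toL2[OF f] show "toL2 f = C *\<^sub>R one_l2 + J (toL2 g)"
      unfolding l2_eq_iff by eventually_elim simp
  qed
qed

lemma H1rel_toL2_iff:
  assumes "f \<in> space_carrier L2" "g \<in> space_carrier L2"
  shows "H1rel (toL2 f) (toL2 g) \<longleftrightarrow> has_weak_deriv unit_ivl 1 f g"
  unfolding H1rel_def toL2_eq_primitive_iff[OF assms] has_weak_deriv_unit_iff[OF assms] ..

text \<open>Two continuous representatives agree on the open interval and hence on its closure.\<close>

lemma trace_unique:
  assumes c: "continuous_on {0..1} k" and ae: "AE x in I01. f x = k x" and b: "b \<in> {0, 1}"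
    and t: "has_trace f b v"
  shows "v = k b"
proof -
  obtain h where h: "continuous_on {0..1} h" "AE x in I01. h x = f x" "h b = v"
    using t unfolding has_trace_def by blast
  have eq: "h x = k x" if "x \<in> unit_ivl" for x
  proof (rule continuous_eq_if_AE[OF _ _ _ that])
    show "continuous_on unit_ivl h" "continuous_on unit_ivl k"
      using h(1) c by (auto intro: continuous_on_subset)
    show "AE x in I01. h x = k x" using ae h(2) by eventually_elim simp
  qed
  have "h b - k b = 0"
  proof (rule continuous_constant_on_closure[where S = unit_ivl and f = "\<lambda>x. h x - k x"])
    show "continuous_on (closure unit_ivl) (\<lambda>x. h x - k x)" using h(1) c by (auto intro: continuous_intros)
    show "b \<in> closure unit_ivl" using b by auto
    show "h x - k x = 0" if "x \<in> unit_ivl" for x using eq[OF that] by simp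
  qed
  then show ?thesis using h(3) by simp
qed

lemma H1rel_trace:
  assumes f: "f \<in> space_carrier L2" and g: "g \<in> space_carrier L2"
    and H: "H1rel (toL2 f) (toL2 g)" and t: "has_trace f 0 v0" "has_trace f 1 v1"
  shows "toL2 f = v0 *\<^sub>R one_l2 + J (toL2 g)" "inner (toL2 g) one_l2 = v1 - v0"
proof -
  obtain C where C: "toL2 f = C *\<^sub>R one_l2 + J (toL2 g)" using H unfolding H1rel_def by blast
  then have ae: "AE x in I01. f x = C + prim 0 g x" using toL2_eq_primitive_iff[OF f g] by simp
  have c: "continuous_on {0..1} (\<lambda>x. C + prim 0 g x)"
    using prim_continuous[OF L2_integrable[OF g]] by (intro continuous_intros)
  have v0: "v0 = C" using trace_unique[OF c ae _ t(1)] by simp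
  have v1: "v1 = C + prim 0 g 1" using trace_unique[OF c ae _ t(2)] by simp
  show "toL2 f = v0 *\<^sub>R one_l2 + J (toL2 g)" using C v0 by simp
  have "inner (toL2 g) one_l2 = prim 0 (fn (toL2 g)) 1" unfolding inner_one integral_eq_prim ..
  then show "inner (toL2 g) one_l2 = v1 - v0" using v0 v1 prim_toL2[OF g] by simp
qed

text \<open>The function subtracted from \<open>u\<close> is the affine function with boundary values \<open>v0\<close> and \<open>v1\<close>, since
  \<open>J one_l2\<close> is the identity function.\<close>

lemma H10rel_lift:
  assumes "u = v0 *\<^sub>R one_l2 + J q" "inner q one_l2 = v1 - v0"
  shows "H10rel (u - (v0 *\<^sub>R one_l2 + (v1 - v0) *\<^sub>R J one_l2)) (q - (v1 - v0) *\<^sub>R one_l2)"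
  using assms linear_diff[OF bounded_linear.linear[OF bounded_linear_J]] 
    linear_scale[OF bounded_linear.linear[OF bounded_linear_J]]
  by (simp add: H10rel_def inner_diff_left inner_one_one)

lemma J_FTC:
  assumes D: "\<And>x. (f has_real_derivative f' x) (at x)" and c: "continuous_on UNIV f'"
  shows "f' \<in> space_carrier L2" "J (toL2 f') = toL2 (\<lambda>x. f x - f 0)" "(\<lambda>x. f x - f 0) \<in> space_carrier L2"
    "inner (toL2 f') one_l2 = f 1 - f 0"
proof -
  have bd: "h \<in> space_carrier L2" if "continuous_on UNIV h" for h :: "real \<Rightarrow> real"
  proof -
    have "compact (h ` {0..1})" by (intro compact_continuous_image continuous_on_subset[OF that]) auto
    then obtain B where "\<And>x. x \<in> {0..1} \<Longrightarrow> \<bar>h x\<bar> \<le> B"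
      using compact_imp_bounded[of "h ` {0..1}"] unfolding bounded_iff real_norm_def by blast
    then show ?thesis
      by (intro L2_bounded[of h B] measurable_restrict_space1 measurable_completion)
         (auto simp: that borel_measurable_continuous_onI)
  qed
  show f': "f' \<in> space_carrier L2" by (rule bd[OF c])
  have "continuous_on UNIV f" using D by (auto intro!: continuous_at_imp_continuous_on DERIV_isCont)
  then show f: "(\<lambda>x. f x - f 0) \<in> space_carrier L2" by (intro bd continuous_intros)
  have pr: "prim 0 f' x = f x - f 0" if "x \<in> {0..1}" for x
  proof -
    have "(f' has_integral (f x - f 0)) {0..x}"
    proof (rule fundamental_theorem_of_calculus)
      show "(f has_vector_derivative f' t) (at t within {0..x})" for t
        using D[of t] unfolding has_real_derivative_iff_has_vector_derivative
        by (rule has_vector_derivative_at_within)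
    qed (use that in auto)
    then show ?thesis using prim_eq_integral[OF L2_integrable[OF f'], of x] that by (simp add: integral_unique)
  qed
  have I: "AE x in I01. x \<in> unit_ivl" by (rule AE_I2) simp
  have "AE x in I01. f x - f 0 = 0 + prim 0 f' x"
    using I by eventually_elim (simp add: pr)
  then show "J (toL2 f') = toL2 (\<lambda>x. f x - f 0)"
    using toL2_eq_primitive_iff[OF f f', of 0] by simp
  have "inner (toL2 f') one_l2 = prim 0 (fn (toL2 f')) 1" unfolding inner_one integral_eq_prim ..
  then show "inner (toL2 f') one_l2 = f 1 - f 0" using prim_toL2[OF f'] pr by simp
qed

lemma J_one: "J one_l2 = toL2 (\<lambda>x. x)"
  unfolding one_l2_def by (rule J_FTC(2)[of "\<lambda>x. x" "\<lambda>_. 1", simplified])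

lemma norm_toL2_tendsto_0:
  assumes m[measurable]: "\<And>n. h n \<in> borel_measurable I01" and b: "\<And>n x. x \<in> unit_ivl \<Longrightarrow> \<bar>h n x\<bar> \<le> B"
    and lim: "\<And>x. x \<in> unit_ivl \<Longrightarrow> (\<lambda>n. h n x) \<longlonglongrightarrow> 0"
  shows "(\<lambda>n. norm (toL2 (h n))) \<longlonglongrightarrow> 0"
proof -
  have c: "h n \<in> space_carrier L2" for n by (rule L2_bounded[OF m b])
  have "(\<lambda>n. \<integral>x. (h n x)\<^sup>2 \<partial>I01) \<longlonglongrightarrow> (\<integral>x. 0 \<partial>I01)"
  proof (rule integral_dominated_convergence[where w = "\<lambda>_. B\<^sup>2"])
    show "AE x in I01. (\<lambda>n. (h n x)\<^sup>2) \<longlonglongrightarrow> 0"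
      by (rule AE_I2) (use lim in \<open>auto intro!: tendsto_eq_intros\<close>)
    show "AE x in I01. norm ((h n x)\<^sup>2) \<le> B\<^sup>2" for n
    proof (rule AE_I2)
      fix x assume "x \<in> space I01"
      then have "\<bar>h n x\<bar>\<^sup>2 \<le> B\<^sup>2" using b[of x n] by (intro power_mono) auto
      then show "norm ((h n x)\<^sup>2) \<le> B\<^sup>2" by simp
    qed
  qed auto
  then have "(\<lambda>n. sqrt (\<integral>x. (h n x)\<^sup>2 \<partial>I01)) \<longlonglongrightarrow> sqrt 0"
    by (intro tendsto_real_sqrt) simp
  then show ?thesis by (simp add: norm_toL2[OF c] L2_def)
qed

text \<open>Affine functions do not vanish at the end points, but they are limits in $L^2$ of
  functions that do: the factor \<open>1 - (2 x - 1)\<^sup>2\<^sup>n\<close> is a polynomial that vanishes at 0 and 1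
  and tends to 1 inside. This is needed at the initial time, where the second time derivative
  of the lifted unknown is affine in \<open>x\<close>.\<close>

lemma affine_approx_H10:
  assumes e: "e > 0"
  obtains \<phi> q where "H10rel \<phi> q" "norm (\<phi> - (\<alpha> *\<^sub>R one_l2 + \<beta> *\<^sub>R J one_l2)) < e"
proof -
  define w where "w n x = (\<alpha> + \<beta> * x) * (2 * x - 1) ^ (2 * n)" for n and x :: real
  define f where "f n x = (\<alpha> + \<beta> * x) - w n x" for n x
  define f' where "f' n x = \<beta> - (\<beta> * (2 * x - 1) ^ (2 * n) + (\<alpha> + \<beta> * x) * (real (2 * n) * (2 * x - 1) ^ (2 * n - 1) * 2))" for n and x :: real
  have D: "(f n has_real_derivative f' n x) (at x)" for n x
    unfolding f_def[abs_def] w_def f'_def by (auto intro!: derivative_eq_intros simp: field_simps)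
  have c: "continuous_on UNIV (f' n)" for n unfolding f'_def by (intro continuous_intros)
  have f0: "f n 0 = 0" "f n 1 = 0" for n by (simp_all add: f_def w_def)
  have wm: "w n \<in> borel_measurable I01" for n
    by (intro measurable_restrict_space1 measurable_completion) (simp add: w_def[abs_def])
  have pb: "\<bar>(2 * x - 1) ^ (2 * n)\<bar> \<le> 1" if "x \<in> unit_ivl" for x :: real and n
    using that by (simp only: power_abs) (intro power_le_one; auto)
  have wb: "\<bar>w n x\<bar> \<le> \<bar>\<alpha>\<bar> + \<bar>\<beta>\<bar>" if x: "x \<in> unit_ivl" for n x
  proof -
    have "\<bar>\<beta> * x\<bar> \<le> \<bar>\<beta>\<bar> * 1" unfolding abs_mult using x by (intro mult_left_mono) auto
    then have "\<bar>\<alpha> + \<beta> * x\<bar> \<le> \<bar>\<alpha>\<bar> + \<bar>\<beta>\<bar>" by linarith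
    then have "\<bar>\<alpha> + \<beta> * x\<bar> * \<bar>(2 * x - 1) ^ (2 * n)\<bar> \<le> (\<bar>\<alpha>\<bar> + \<bar>\<beta>\<bar>) * 1"
      using pb[OF x, of n] by (intro mult_mono) auto
    then show ?thesis by (simp add: w_def abs_mult)
  qed
  have wl: "(\<lambda>n. w n x) \<longlonglongrightarrow> 0" if x: "x \<in> unit_ivl" for x
  proof -
    have "\<bar>2 * x - 1\<bar> < 1" using x by (auto simp: abs_if)
    then have "(2 * x - 1)\<^sup>2 < 1" by (simp add: abs_square_less_1)
    then have "norm ((2 * x - 1)\<^sup>2) < 1" by (simp only: real_norm_def abs_power2)
    then have "(\<lambda>n. ((2 * x - 1)\<^sup>2) ^ n) \<longlonglongrightarrow> 0" by (rule LIMSEQ_power_zero)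
    then have "(\<lambda>n. (\<alpha> + \<beta> * x) * ((2 * x - 1)\<^sup>2) ^ n) \<longlonglongrightarrow> (\<alpha> + \<beta> * x) * 0" by (intro tendsto_mult tendsto_const)
    then show ?thesis by (simp add: w_def power_mult)
  qed
  have "(\<lambda>n. norm (toL2 (w n))) \<longlonglongrightarrow> 0" by (rule norm_toL2_tendsto_0[OF wm wb wl])
  then obtain n where n: "norm (toL2 (w n)) < e" 
    using e by (metis LIMSEQ_iff abs_norm_cancel diff_zero le_refl real_norm_def)
  have wc: "w n \<in> space_carrier L2" by (rule L2_bounded[OF wm wb])
  have idc: "(\<lambda>x. x) \<in> space_carrier L2" by (rule L2_bounded[of _ 1]) auto
  have aff: "(\<lambda>x. \<alpha> + \<beta> * x) \<in> space_carrier L2" by (intro L2_add L2_scale L2_const idc)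
  have "toL2 (f n) = toL2 (\<lambda>x. \<alpha> + \<beta> * x) - toL2 (w n)"
    unfolding f_def[abs_def] by (rule toL2_diff[OF aff wc])
  also have "toL2 (\<lambda>x. \<alpha> + \<beta> * x) = toL2 (\<lambda>x. \<alpha> * 1) + toL2 (\<lambda>x. \<beta> * x)"
    using toL2_add[of "\<lambda>x. \<alpha> * 1" "\<lambda>x. \<beta> * x"] L2_scale[OF idc] L2_const[of \<alpha>] by simp
  also have "\<dots> = \<alpha> *\<^sub>R one_l2 + \<beta> *\<^sub>R J one_l2"
    unfolding one_l2_def J_one[unfolded one_l2_def]
    by (subst (1 2) toL2_scale) (auto simp: idc)
  finally have "toL2 (f n) - (\<alpha> *\<^sub>R one_l2 + \<beta> *\<^sub>R J one_l2) = - toL2 (w n)" by simp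
  moreover have "H10rel (toL2 (f n)) (toL2 (f' n))"
    unfolding H10rel_def using J_FTC(2,4)[OF D c, of n] f0 by simp
  ultimately show ?thesis using that[of "toL2 (f n)" "toL2 (f' n)"] n by simp
qed

section \<open>Evolution equations with a skew operator\<close>

lemma le_if_eps: 
  fixes a b K :: real
  assumes "\<And>\<epsilon>. \<epsilon> > 0 \<Longrightarrow> a \<le> b + \<epsilon> * K" and K: "0 \<le> K" shows "a \<le> b"
proof (rule field_le_epsilon)
  fix e :: real assume e: "e > 0"
  have "a \<le> b + e / (K + 1) * K" using assms(1)[of "e / (K + 1)"] e K by simp
  also have "e / (K + 1) * K \<le> e" using e K by (simp add: field_simps)
  finally show "a \<le> b + e" by simp
qed

text \<open>The derivative of \<open>\<parallel>y\<parallel>\<^sup>2\<close> is \<open>2 \<langle>y, f\<rangle>\<close>. Dividing by \<open>2 \<parallel>y\<parallel>\<close> gives a linear differential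
  inequality for the norm itself, which is essential: it bounds a solution that starts
  at 0 by a multiple of \<open>t\<close>, not of \<open>\<surd>t\<close>.\<close>

lemma energy_estimate:
  fixes y y' f :: "real \<Rightarrow> 'a::real_inner"
  assumes st: "s \<le> t" 
    and D: "\<And>\<tau>. \<tau> \<in> {s..t} \<Longrightarrow> (y has_vector_derivative y' \<tau>) (at \<tau> within {s..t})"
    and E: "\<And>\<tau>. \<tau> \<in> {s<..<t} \<Longrightarrow> inner (y \<tau>) (f \<tau> - y' \<tau>) = 0"
    and B: "\<And>\<tau>. \<tau> \<in> {s<..<t} \<Longrightarrow> norm (f \<tau>) \<le> \<alpha> + \<beta> * norm (y \<tau>)" 
    and nn: "0 \<le> \<alpha>" "0 \<le> \<beta>"
  shows "norm (y t) \<le> exp (\<beta> * (t - s)) * (norm (y s) + \<alpha> * (t - s))"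
proof (rule le_if_eps)
  fix \<epsilon> :: real assume \<epsilon>: "\<epsilon> > 0"
  \<comment> \<open>The shift by \<open>\<epsilon>\<^sup>2\<close> keeps the square root differentiable where \<open>y\<close> vanishes.\<close>
  define X where "X \<tau> = inner (y \<tau>) (y \<tau>) + \<epsilon>\<^sup>2" for \<tau>
  define N where "N \<tau> = sqrt (X \<tau>)" for \<tau>
  define M where "M \<tau> = N \<tau> * exp (- \<beta> * (\<tau> - s)) - \<alpha> * (\<tau> - s)" for \<tau>
  have pos: "0 < X \<tau>" for \<tau>
    unfolding X_def using \<epsilon> inner_ge_zero[of "y \<tau>"] zero_less_power[OF \<epsilon>, of 2] by linarith
  have Npos: "N \<tau> > 0" for \<tau> using pos by (simp add: N_def)
  have yN: "norm (y \<tau>) \<le> N \<tau>" for \<tau>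
    unfolding norm_eq_sqrt_inner N_def X_def by (intro real_sqrt_le_mono) simp
  have cont: "continuous_on {s..t} y"
    using D has_vector_derivative_continuous unfolding continuous_on_eq_continuous_within by blast
  have "M t \<le> M s"
  proof (rule DERIV_nonpos_imp_decreasing_open[OF st])
    show "continuous_on {s..t} M"
      unfolding M_def[abs_def] N_def X_def by (intro continuous_intros cont)
    fix \<tau> assume \<tau>: "s < \<tau>" "\<tau> < t"
    have "at \<tau> within {s..t} = at \<tau>" using \<tau> by (simp add: at_within_Icc_at)
    then have Dy: "(y has_derivative (\<lambda>h. h *\<^sub>R y' \<tau>)) (at \<tau>)"
      using D[of \<tau>] \<tau> by (simp add: has_vector_derivative_def)
    have "((\<lambda>\<tau>. inner (y \<tau>) (y \<tau>)) has_derivative (\<lambda>h. inner (y \<tau>) (h *\<^sub>R y' \<tau>) + inner (h *\<^sub>R y' \<tau>) (y \<tau>))) (at \<tau>)"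
      by (rule has_derivative_inner[OF Dy Dy])
    then have "((\<lambda>\<tau>. inner (y \<tau>) (y \<tau>)) has_real_derivative 2 * inner (y \<tau>) (y' \<tau>)) (at \<tau>)"
      unfolding has_field_derivative_def
      by (rule has_derivative_eq_rhs) (auto simp: inner_commute)
    then have DX: "(X has_real_derivative 2 * inner (y \<tau>) (y' \<tau>)) (at \<tau>)"
      unfolding X_def[abs_def] by (rule DERIV_cong[OF DERIV_add[OF _ DERIV_const]]) simp
    have half: "inverse r / 2 * (2 * i) = i / r" for r i :: real by (simp add: inverse_eq_divide)
    have DN: "(N has_real_derivative inner (y \<tau>) (y' \<tau>) / N \<tau>) (at \<tau>)"
      using DERIV_chain2[OF DERIV_real_sqrt[OF pos] DX, unfolded half] unfolding N_def[abs_def] .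
    have DE: "((\<lambda>\<tau>. exp (- \<beta> * (\<tau> - s))) has_real_derivative exp (- \<beta> * (\<tau> - s)) * - \<beta>) (at \<tau>)"
      by (auto intro!: derivative_eq_intros)
    have DL: "((\<lambda>\<tau>. \<alpha> * (\<tau> - s)) has_real_derivative \<alpha>) (at \<tau>)"
      by (auto intro!: derivative_eq_intros)
    have DM: "(M has_real_derivative 
        inner (y \<tau>) (y' \<tau>) / N \<tau> * exp (- \<beta> * (\<tau> - s)) - \<beta> * N \<tau> * exp (- \<beta> * (\<tau> - s)) - \<alpha>) (at \<tau>)"
      unfolding M_def[abs_def] using DERIV_diff[OF DERIV_mult[OF DN DE] DL]
      by (rule DERIV_cong) simp
    have "inner (y \<tau>) (y' \<tau>) = inner (y \<tau>) (f \<tau>)"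
      using E[of \<tau>] \<tau> by (simp add: inner_diff_right)
    also have "\<dots> \<le> norm (y \<tau>) * norm (f \<tau>)" by (rule norm_cauchy_schwarz)
    also have "\<dots> \<le> N \<tau> * (\<alpha> + \<beta> * N \<tau>)"
    proof (rule mult_mono)
      have "norm (f \<tau>) \<le> \<alpha> + \<beta> * norm (y \<tau>)" using B \<tau> by simp
      also have "\<dots> \<le> \<alpha> + \<beta> * N \<tau>" using yN nn by (intro add_left_mono mult_left_mono)
      finally show "norm (f \<tau>) \<le> \<alpha> + \<beta> * N \<tau>" .
    qed (use yN Npos less_imp_le in auto)
    finally have "inner (y \<tau>) (y' \<tau>) / N \<tau> \<le> \<alpha> + \<beta> * N \<tau>"
      using Npos[of \<tau>] by (simp add: field_simps)
    then have "(inner (y \<tau>) (y' \<tau>) / N \<tau> - \<beta> * N \<tau>) * exp (- \<beta> * (\<tau> - s)) \<le> \<alpha> * exp (- \<beta> * (\<tau> - s))"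
      by (intro mult_right_mono) auto
    also have "\<dots> \<le> \<alpha> * 1" using nn \<tau> by (intro mult_left_mono) auto
    finally show "\<exists>d. (M has_real_derivative d) (at \<tau>) \<and> d \<le> 0"
      by (intro exI[of _ "inner (y \<tau>) (y' \<tau>) / N \<tau> * exp (- \<beta> * (\<tau> - s)) - \<beta> * N \<tau> * exp (- \<beta> * (\<tau> - s)) - \<alpha>"] conjI DM)
        (simp add: left_diff_distrib)
  qed
  then have "N t * exp (- \<beta> * (t - s)) \<le> N s + \<alpha> * (t - s)" by (simp add: M_def)
  also have "N s \<le> norm (y s) + \<epsilon>"
    unfolding N_def X_def dot_square_norm
    by (rule real_le_lsqrt) (use \<epsilon> in \<open>auto simp: power2_sum\<close>)
  finally have "N t * exp (- \<beta> * (t - s)) * exp (\<beta> * (t - s)) \<le> (norm (y s) + \<epsilon> + \<alpha> * (t - s)) * exp (\<beta> * (t - s))"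
    by (intro mult_right_mono) auto
  also have "N t * exp (- \<beta> * (t - s)) * exp (\<beta> * (t - s)) = N t"
    by (simp add: mult.assoc flip: exp_add)
  finally show "norm (y t) \<le> exp (\<beta> * (t - s)) * (norm (y s) + \<alpha> * (t - s)) + \<epsilon> * exp (\<beta> * (t - s))"
    using yN[of t] by (simp add: algebra_simps)
qed simp

text \<open>The step may be negative; backward quotients reach the right end of the time interval.\<close>

definition dq :: "real \<Rightarrow> (real \<Rightarrow> 'a::real_vector) \<Rightarrow> real \<Rightarrow> 'a" where
  "dq h y s = (1 / h) *\<^sub>R (y (s + h) - y s)"

lemma dq_uniform:
  fixes y z :: "real \<Rightarrow> 'a::real_normed_vector"
  assumes D: "\<And>\<tau>. \<tau> \<in> {a..b} \<Longrightarrow> (y has_vector_derivative z \<tau>) (at \<tau> within {a..b})"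
    and c: "continuous_on {a..b} z" and \<epsilon>: "\<epsilon> > 0"
  obtains \<delta> where "\<delta> > 0" "\<And>s h. s \<in> {a..b} \<Longrightarrow> s + h \<in> {a..b} \<Longrightarrow> h \<noteq> 0 \<Longrightarrow> \<bar>h\<bar> < \<delta> \<Longrightarrow> norm (dq h y s - z s) \<le> \<epsilon>"
proof -
  have "uniformly_continuous_on {a..b} z" using c by (intro compact_uniformly_continuous) auto
  then obtain \<delta> where \<delta>: "\<delta> > 0" "\<And>x x'. x \<in> {a..b} \<Longrightarrow> x' \<in> {a..b} \<Longrightarrow> dist x' x < \<delta> \<Longrightarrow> dist (z x') (z x) < \<epsilon>"
    using \<epsilon> unfolding uniformly_continuous_on_def by meson
  have "norm (dq h y s - z s) \<le> \<epsilon>" if sh: "s \<in> {a..b}" "s + h \<in> {a..b}" "h \<noteq> 0" "\<bar>h\<bar> < \<delta>" for s h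
  proof -
    let ?S = "closed_segment s (s + h)"
    have sub: "?S \<subseteq> {a..b}" using sh by (auto simp: closed_segment_eq_real_ivl split: if_splits)
    have "norm (y (s + h) - y s - ((s + h) - s) *\<^sub>R z s) \<le> norm ((s + h) - s) * \<epsilon>"
    proof (rule vector_differentiable_bound_linearization[where S = ?S])
      show "(y has_vector_derivative z x) (at x within ?S)" if "x \<in> ?S" for x
        using has_vector_derivative_within_subset[OF D sub] sub that by blast
      show "norm (z x - z s) \<le> \<epsilon>" if "x \<in> ?S" for x
      proof -
        have "dist x s < \<delta>" using that sh by (auto simp: closed_segment_eq_real_ivl dist_real_def split: if_splits)
        then show ?thesis using \<delta>(2)[of s x] sub that sh by (auto simp: dist_norm less_imp_le)
      qed
    qed auto
    then have "norm (h *\<^sub>R (dq h y s - z s)) \<le> \<bar>h\<bar> * \<epsilon>"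
      using sh by (simp add: dq_def scaleR_diff_right)
    then show ?thesis using sh by simp
  qed
  then show ?thesis using that \<delta>(1) by blast
qed

text \<open>\<open>G u w\<close> stands for \<open>w = A u\<close> with \<open>u\<close> in the domain of a linear skew operator \<open>A\<close>. A relation is used because
  the operator is unbounded. Differences and multiples are the linear operations that build
  difference quotients.\<close>

locale skew_evolution =
  fixes G :: "'a::{real_inner,complete_space} \<Rightarrow> 'a \<Rightarrow> bool"
  assumes skew: "G u w \<Longrightarrow> inner u w = 0"
    and G_diff: "G u w \<Longrightarrow> G u' w' \<Longrightarrow> G (u - u') (w - w')"
    and G_scale: "G u w \<Longrightarrow> G (c *\<^sub>R u) (c *\<^sub>R w)"
begin

text \<open>The equation \<open>z + A y = f\<close> together with the derivatives \<open>z\<close> of \<open>y\<close> and \<open>f'\<close> of \<open>f\<close>. The derivative \<open>z\<close>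
  may lie outside the domain of \<open>A\<close>.\<close>

definition solution_on :: "real \<Rightarrow> real \<Rightarrow> (real \<Rightarrow> 'a) \<Rightarrow> (real \<Rightarrow> 'a) \<Rightarrow> (real \<Rightarrow> 'a) \<Rightarrow> (real \<Rightarrow> 'a) \<Rightarrow> bool" where
  "solution_on a b y z f f' \<longleftrightarrow>
    (\<forall>\<tau>\<in>{a..b}. (y has_vector_derivative z \<tau>) (at \<tau> within {a..b})) \<and> continuous_on {a..b} z \<and>
    (\<forall>\<tau>\<in>{a..b}. (f has_vector_derivative f' \<tau>) (at \<tau> within {a..b})) \<and> continuous_on {a..b} f' \<and>
    (\<forall>\<tau>\<in>{a..b}. G (y \<tau>) (f \<tau> - z \<tau>))"

lemma solution_on_subset:
  assumes "solution_on a b y z f f'" "{c..d} \<subseteq> {a..b}"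
  shows "solution_on c d y z f f'"
  using assms(1) subsetD[OF assms(2)] unfolding solution_on_def
  by (auto intro: has_vector_derivative_within_subset[OF _ assms(2)] continuous_on_subset[OF _ assms(2)])

lemma shift_vector_derivative:
  assumes "(y has_vector_derivative z (\<tau> + h)) (at (\<tau> + h) within {c + h..d + h})"
  shows "((\<lambda>\<tau>. y (\<tau> + h)) has_vector_derivative z (\<tau> + h)) (at \<tau> within {c..d})"
proof -
  have 1: "((\<lambda>\<tau>. \<tau> + h) has_vector_derivative 1) (at \<tau> within {c..d})"
    by (auto intro!: derivative_eq_intros)
  have "(y has_vector_derivative z (\<tau> + h)) (at (\<tau> + h) within (\<lambda>\<tau>. \<tau> + h) ` {c..d})"
    using assms by (simp add: image_add_atLeastAtMost')
  from vector_diff_chain_within[OF 1 this] show ?thesis by (simp add: o_def)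
qed

lemma solution_on_shift:
  assumes "solution_on a b y z f f'" "a \<le> c + h" "d + h \<le> b"
  shows "solution_on c d (\<lambda>\<tau>. y (\<tau> + h)) (\<lambda>\<tau>. z (\<tau> + h)) (\<lambda>\<tau>. f (\<tau> + h)) (\<lambda>\<tau>. f' (\<tau> + h))"
proof -
  have "solution_on (c + h) (d + h) y z f f'" by (rule solution_on_subset[OF assms(1)]) (use assms in auto)
  then show ?thesis unfolding solution_on_def
    by (auto intro!: shift_vector_derivative continuous_on_compose2[of "{c + h..d + h}" _ _ "\<lambda>\<tau>. \<tau> + h"] continuous_intros)
qed

lemma solution_on_diff:
  assumes "solution_on a b y z f f'" "solution_on a b y2 z2 f2 f2'"
  shows "solution_on a b (\<lambda>\<tau>. y \<tau> - y2 \<tau>) (\<lambda>\<tau>. z \<tau> - z2 \<tau>) (\<lambda>\<tau>. f \<tau> - f2 \<tau>) (\<lambda>\<tau>. f' \<tau> - f2' \<tau>)"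
proof -
  have "G (y \<tau> - y2 \<tau>) ((f \<tau> - f2 \<tau>) - (z \<tau> - z2 \<tau>))" if "\<tau> \<in> {a..b}" for \<tau>
  proof -
    have "G (y \<tau> - y2 \<tau>) ((f \<tau> - z \<tau>) - (f2 \<tau> - z2 \<tau>))"
      using assms that unfolding solution_on_def by (intro G_diff) auto
    then show ?thesis by (simp add: algebra_simps)
  qed
  then show ?thesis using assms unfolding solution_on_def
    by (auto intro!: has_vector_derivative_diff continuous_intros)
qed

lemma solution_on_scale:
  assumes "solution_on a b y z f f'"
  shows "solution_on a b (\<lambda>\<tau>. c *\<^sub>R y \<tau>) (\<lambda>\<tau>. c *\<^sub>R z \<tau>) (\<lambda>\<tau>. c *\<^sub>R f \<tau>) (\<lambda>\<tau>. c *\<^sub>R f' \<tau>)"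
proof -
  have "G (c *\<^sub>R y \<tau>) (c *\<^sub>R f \<tau> - c *\<^sub>R z \<tau>)" if "\<tau> \<in> {a..b}" for \<tau>
    using assms that unfolding solution_on_def by (auto simp flip: scaleR_diff_right intro: G_scale)
  then show ?thesis using assms unfolding solution_on_def
    by (auto intro!: derivative_eq_intros continuous_intros)
qed

lemma solution_on_dq:
  assumes "solution_on a b y z f f'" "{c..d} \<subseteq> {a..b}" "a \<le> c + h" "d + h \<le> b"
  shows "solution_on c d (dq h y) (dq h z) (dq h f) (dq h f')"
  unfolding dq_def[abs_def]
  by (intro solution_on_scale solution_on_diff solution_on_shift[OF assms(1,3,4)] solution_on_subset[OF assms(1,2)])

text \<open>The energy estimate cannot be applied to \<open>z\<close>, which need not lie in the domain. It is
  applied to the difference quotients of \<open>y\<close>, which do, and the step is sent to 0; the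
  quotients converge uniformly because \<open>z\<close> and \<open>f'\<close> are continuous.\<close>

lemma derivative_estimate:
  assumes sol: "solution_on s t y z f f'" and st: "s \<le> t"
    and B: "\<And>\<tau>. \<tau> \<in> {s..t} \<Longrightarrow> norm (f' \<tau>) \<le> \<alpha> + \<beta> * norm (z \<tau>)" 
    and nn: "0 \<le> \<alpha>" "0 \<le> \<beta>"
  shows "norm (z t) \<le> exp (\<beta> * (t - s)) * (norm (z s) + \<alpha> * (t - s))"
proof (cases "s = t")
  case True then show ?thesis by simp
next
  case False
  then have lt: "s < t" using st by simp
  define E where "E = exp (\<beta> * (t - s))"
  have E1: "E \<ge> 1" using nn st by (simp add: E_def)
  show ?thesis unfolding E_def[symmetric]
  proof (rule le_if_eps)
    show "0 \<le> 1 + E * (1 + (1 + \<beta>) * (t - s))" using E1 nn lt by (intro add_nonneg_nonneg mult_nonneg_nonneg) auto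
    fix \<epsilon> :: real assume \<epsilon>: "\<epsilon> > 0"
    obtain d1 where d1: "d1 > 0" "\<And>\<tau> h. \<tau> \<in> {s..t} \<Longrightarrow> \<tau> + h \<in> {s..t} \<Longrightarrow> h \<noteq> 0 \<Longrightarrow> \<bar>h\<bar> < d1 \<Longrightarrow> norm (dq h y \<tau> - z \<tau>) \<le> \<epsilon>"
      using dq_uniform[of s t y z \<epsilon>] sol \<epsilon> unfolding solution_on_def by blast
    obtain d2 where d2: "d2 > 0" "\<And>\<tau> h. \<tau> \<in> {s..t} \<Longrightarrow> \<tau> + h \<in> {s..t} \<Longrightarrow> h \<noteq> 0 \<Longrightarrow> \<bar>h\<bar> < d2 \<Longrightarrow> norm (dq h f \<tau> - f' \<tau>) \<le> \<epsilon>"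
      using dq_uniform[of s t f f' \<epsilon>] sol \<epsilon> unfolding solution_on_def by blast
    define h where "h = min (min d1 d2) (t - s) / 2"
    have h: "h > 0" "h < d1" "h < d2" "h < t - s" using d1(1) d2(1) lt by (auto simp: h_def min_def)
    have sold: "solution_on s (t - h) (dq h y) (dq h z) (dq h f) (dq h f')"
      by (rule solution_on_dq[OF sol]) (use h in auto)
    have *: "norm (dq h y (t - h)) \<le> exp (\<beta> * ((t - h) - s)) * (norm (dq h y s) + (\<alpha> + (1 + \<beta>) * \<epsilon>) * ((t - h) - s))"
    proof (rule energy_estimate)
      show "s \<le> t - h" using h by simp
      show "(dq h y has_vector_derivative dq h z \<tau>) (at \<tau> within {s..t - h})" if "\<tau> \<in> {s..t - h}" for \<tau>
        using sold that unfolding solution_on_def by blast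
      show "inner (dq h y \<tau>) (dq h f \<tau> - dq h z \<tau>) = 0" if "\<tau> \<in> {s<..<t - h}" for \<tau>
        using sold that unfolding solution_on_def by (intro skew) auto
      show "norm (dq h f \<tau>) \<le> \<alpha> + (1 + \<beta>) * \<epsilon> + \<beta> * norm (dq h y \<tau>)" if "\<tau> \<in> {s<..<t - h}" for \<tau>
      proof -
        have r: "\<tau> \<in> {s..t}" "\<tau> + h \<in> {s..t}" "h \<noteq> 0" "\<bar>h\<bar> < d1" "\<bar>h\<bar> < d2" using that h by auto
        have "norm (dq h f \<tau>) \<le> norm (f' \<tau>) + \<epsilon>"
          using d2(2)[OF r(1-3,5)] norm_triangle_ineq2[of "dq h f \<tau>" "f' \<tau>"] by linarith
        also have "norm (f' \<tau>) \<le> \<alpha> + \<beta> * norm (z \<tau>)" using B r by blast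
        also have "\<beta> * norm (z \<tau>) \<le> \<beta> * (norm (dq h y \<tau>) + \<epsilon>)"
        proof (rule mult_left_mono[OF _ nn(2)])
          show "norm (z \<tau>) \<le> norm (dq h y \<tau>) + \<epsilon>"
            using d1(2)[OF r(1-4)] norm_triangle_ineq2[of "z \<tau>" "dq h y \<tau>"] by (simp add: norm_minus_commute)
        qed
        finally have "norm (dq h f \<tau>) \<le> \<alpha> + \<beta> * (norm (dq h y \<tau>) + \<epsilon>) + \<epsilon>" by simp
        then show ?thesis by (simp add: algebra_simps)
      qed
    qed (use nn \<epsilon> in auto)
    have "norm (z t) \<le> norm (dq (- h) y t) + \<epsilon>"
      using d1(2)[of t "- h"] h lt norm_triangle_ineq2[of "z t" "dq (- h) y t"] by (simp add: norm_minus_commute)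
    also have "dq (- h) y t = dq h y (t - h)" by (simp add: dq_def algebra_simps)
    also have "norm (dq h y (t - h)) \<le> E * (norm (dq h y s) + (\<alpha> + (1 + \<beta>) * \<epsilon>) * (t - s))"
    proof (rule order_trans[OF *], rule mult_mono)
      show "exp (\<beta> * ((t - h) - s)) \<le> E" using h nn by (simp add: E_def mult_left_mono)
      show "norm (dq h y s) + (\<alpha> + (1 + \<beta>) * \<epsilon>) * ((t - h) - s) \<le> norm (dq h y s) + (\<alpha> + (1 + \<beta>) * \<epsilon>) * (t - s)"
        using h nn \<epsilon> by (intro add_left_mono mult_left_mono add_nonneg_nonneg mult_nonneg_nonneg) auto
      show "0 \<le> norm (dq h y s) + (\<alpha> + (1 + \<beta>) * \<epsilon>) * ((t - h) - s)"
        using h nn \<epsilon> by (intro add_nonneg_nonneg mult_nonneg_nonneg) auto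
    qed (use E1 in simp)
    also have "norm (dq h y s) \<le> norm (z s) + \<epsilon>"
      using d1(2)[of s h] h norm_triangle_ineq2[of "dq h y s" "z s"] by simp
    finally have "norm (z t) \<le> E * (norm (z s) + \<epsilon> + (\<alpha> + (1 + \<beta>) * \<epsilon>) * (t - s)) + \<epsilon>"
      using E1 by (simp add: mult_left_mono)
    then show "norm (z t) \<le> E * (norm (z s) + \<alpha> * (t - s)) + \<epsilon> * (1 + E * (1 + (1 + \<beta>) * (t - s)))"
      by (simp add: algebra_simps)
  qed
qed

text \<open>If \<open>z 0 = 0\<close>, then \<open>z\<close> has the right derivative \<open>f' 0\<close> at 0. For \<open>f' 0\<close> in the domain one would
  compare \<open>y\<close> with \<open>(t\<^sup>2 / 2) f' 0\<close>. In general an element \<open>\<phi>\<close> of the domain close to \<open>f' 0\<close> is used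
  instead: the difference solves the equation with a source whose derivative is small for small times, and
  starts at 0, so that its derivative is a small multiple of \<open>t\<close>.\<close>

lemma initial_second_derivative:
  assumes sol: "solution_on 0 T y z f f'" and T: "T > 0" and z0: "z 0 = 0"
    and dense: "\<And>e. e > 0 \<Longrightarrow> \<exists>\<phi> \<psi>. G \<phi> \<psi> \<and> norm (\<phi> - f' 0) < e" and \<epsilon>: "\<epsilon> > 0"
  obtains \<delta> where "\<delta> > 0" "\<And>h. 0 < h \<Longrightarrow> h < \<delta> \<Longrightarrow> h \<le> T \<Longrightarrow> norm (dq h z 0 - f' 0) \<le> \<epsilon>"
proof -
  define e where "e = \<epsilon> / 4"
  have e: "e > 0" using \<epsilon> by (simp add: e_def)
  obtain \<phi> \<psi> where \<phi>: "G \<phi> \<psi>" "norm (\<phi> - f' 0) < e" using dense[OF e] by blast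
  have "continuous_on {0..T} f'" using sol unfolding solution_on_def by blast
  then have "\<forall>e>0. \<exists>d>0. \<forall>t\<in>{0..T}. dist t 0 < d \<longrightarrow> dist (f' t) (f' 0) < e"
    unfolding continuous_on_iff by (rule bspec[where x = 0]) (use T in simp)
  then obtain d where d: "d > 0" "\<And>t. t \<in> {0..T} \<Longrightarrow> dist t 0 < d \<Longrightarrow> dist (f' t) (f' 0) < e"
    using e by blast
  define \<delta> where "\<delta> = min d (e / (norm \<psi> + 1))"
  have \<delta>: "\<delta> > 0" unfolding \<delta>_def using d e by (simp add: add_nonneg_pos)
  have aux: "solution_on 0 T (\<lambda>t. (t\<^sup>2 / 2) *\<^sub>R \<phi>) (\<lambda>t. t *\<^sub>R \<phi>) (\<lambda>t. t *\<^sub>R \<phi> + (t\<^sup>2 / 2) *\<^sub>R \<psi>) (\<lambda>t. \<phi> + t *\<^sub>R \<psi>)"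
    unfolding solution_on_def
  proof (intro conjI ballI)
    fix t
    have 1: "((\<lambda>t. t\<^sup>2 / 2) has_real_derivative t) (at t within {0..T})" for t :: real
      by (auto intro!: derivative_eq_intros)
    show "((\<lambda>t. (t\<^sup>2 / 2) *\<^sub>R \<phi>) has_vector_derivative t *\<^sub>R \<phi>) (at t within {0..T})"
      using has_vector_derivative_scaleR[OF 1 has_vector_derivative_const] by simp
    show "((\<lambda>t. t *\<^sub>R \<phi> + (t\<^sup>2 / 2) *\<^sub>R \<psi>) has_vector_derivative \<phi> + t *\<^sub>R \<psi>) (at t within {0..T})"
    proof -
      have "((\<lambda>t. t *\<^sub>R \<phi>) has_vector_derivative \<phi>) (at t within {0..T})"
        using has_vector_derivative_scaleR[OF DERIV_ident has_vector_derivative_const] by simp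
      moreover have "((\<lambda>t. (t\<^sup>2 / 2) *\<^sub>R \<psi>) has_vector_derivative t *\<^sub>R \<psi>) (at t within {0..T})"
        using has_vector_derivative_scaleR[OF 1 has_vector_derivative_const] by simp
      ultimately show ?thesis by (rule has_vector_derivative_add)
    qed
    show "G ((t\<^sup>2 / 2) *\<^sub>R \<phi>) (t *\<^sub>R \<phi> + (t\<^sup>2 / 2) *\<^sub>R \<psi> - t *\<^sub>R \<phi>)" using G_scale[OF \<phi>(1)] by simp
  qed (auto intro!: continuous_intros)
  have "norm (dq h z 0 - f' 0) \<le> \<epsilon>" if h: "0 < h" "h < \<delta>" "h \<le> T" for h
  proof -
    have "solution_on 0 h (\<lambda>t. y t - (t\<^sup>2 / 2) *\<^sub>R \<phi>) (\<lambda>t. z t - t *\<^sub>R \<phi>) 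
      (\<lambda>t. f t - (t *\<^sub>R \<phi> + (t\<^sup>2 / 2) *\<^sub>R \<psi>)) (\<lambda>t. f' t - (\<phi> + t *\<^sub>R \<psi>))"
      by (rule solution_on_subset[OF solution_on_diff[OF sol aux]]) (use h in auto)
    then have "norm (z h - h *\<^sub>R \<phi>) \<le> exp (0 * (h - 0)) * (norm (z 0 - 0 *\<^sub>R \<phi>) + 3 * e * (h - 0))"
    proof (rule derivative_estimate)
      fix \<tau> assume \<tau>: "\<tau> \<in> {0..h}"
      have "norm (f' \<tau> - f' 0) < e" using d(2)[of \<tau>] \<tau> h by (simp add: dist_norm \<delta>_def)
      moreover have "norm (\<tau> *\<^sub>R \<psi>) \<le> e"
      proof -
        have "norm (\<tau> *\<^sub>R \<psi>) \<le> \<delta> * (norm \<psi> + 1)" using \<tau> h \<delta> by (simp add: mult_mono)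
        also have "\<dots> \<le> e / (norm \<psi> + 1) * (norm \<psi> + 1)" unfolding \<delta>_def by (intro mult_right_mono) auto
        also have "\<dots> = e" by (simp add: add_nonneg_eq_0_iff)
        finally show ?thesis .
      qed
      moreover have eq: "f' \<tau> - (\<phi> + \<tau> *\<^sub>R \<psi>) = (f' \<tau> - f' 0) - (\<phi> - f' 0) - \<tau> *\<^sub>R \<psi>" by simp
      moreover have "norm (f' \<tau> - (\<phi> + \<tau> *\<^sub>R \<psi>)) \<le> norm (f' \<tau> - f' 0) + norm (\<phi> - f' 0) + norm (\<tau> *\<^sub>R \<psi>)"
        unfolding eq by (meson add_right_mono norm_triangle_ineq4 order_trans)
      ultimately show "norm (f' \<tau> - (\<phi> + \<tau> *\<^sub>R \<psi>)) \<le> 3 * e + 0 * norm (z \<tau> - \<tau> *\<^sub>R \<phi>)" using \<phi>(2) by simp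
    qed (use h e in auto)
    then have "norm (z h - h *\<^sub>R \<phi>) \<le> 3 * e * h" using z0 by simp
    moreover have "z h - h *\<^sub>R \<phi> = h *\<^sub>R (dq h z 0 - \<phi>)" using h z0 by (simp add: dq_def scaleR_diff_right)
    ultimately have "norm (dq h z 0 - \<phi>) \<le> 3 * e" using h by (simp add: mult.commute)
    moreover have "norm (dq h z 0 - f' 0) \<le> norm (dq h z 0 - \<phi>) + norm (\<phi> - f' 0)"
      using norm_triangle_ineq[of "dq h z 0 - \<phi>" "\<phi> - f' 0"] by simp
    ultimately show ?thesis using \<phi>(2) by (simp add: e_def)
  qed
  then show ?thesis using that \<delta> by blast
qed

text \<open>The differences \<open>dq h y - dq k y\<close> solve the equation; the assumption on \<open>f'\<close> closes the
  estimate for their derivatives up to \<open>O(\<bar>h\<bar> + \<bar>k\<bar>)\<close>, and the quotients converge at the initial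
  time \<open>s\<close>. The set \<open>H\<close> selects forward or backward quotients; \<open>\<delta>\<^sub>0\<close> is the room that they need beyond
  the window.\<close>

lemma dq_uniformly_convergent:
  assumes sol: "solution_on 0 T y z f f'" and st: "0 \<le> s" "s \<le> t" "t \<le> T"
    and H: "(H = {0<..} \<and> t + \<delta>\<^sub>0 \<le> T) \<or> (H = {..<0} \<and> \<delta>\<^sub>0 \<le> s)" and \<delta>\<^sub>0: "\<delta>\<^sub>0 > 0"
    and C: "\<And>\<tau> h k. \<tau> \<in> {s..t} \<Longrightarrow> h \<in> H \<Longrightarrow> k \<in> H \<Longrightarrow> \<bar>h\<bar> \<le> \<delta>\<^sub>0 \<Longrightarrow> \<bar>k\<bar> \<le> \<delta>\<^sub>0 \<Longrightarrow>
      norm (dq h f' \<tau> - dq k f' \<tau>) \<le> C * (\<bar>h\<bar> + \<bar>k\<bar>) + \<beta> * norm (dq h z \<tau> - dq k z \<tau>)"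
    and nn: "0 \<le> C" "0 \<le> \<beta>"
    and init: "\<And>\<epsilon>. \<epsilon> > 0 \<Longrightarrow> \<exists>\<delta>>0. \<forall>h\<in>H. \<bar>h\<bar> < \<delta> \<longrightarrow> norm (dq h z s - r0) \<le> \<epsilon>"
  obtains r where "\<And>\<epsilon>. \<epsilon> > 0 \<Longrightarrow> \<exists>\<delta>>0. \<forall>h\<in>H. \<bar>h\<bar> < \<delta> \<longrightarrow> (\<forall>\<tau>\<in>{s..t}. norm (dq h z \<tau> - r \<tau>) \<le> \<epsilon>)"
proof -
  define E where "E = exp (\<beta> * (t - s))"
  have E: "E > 0" by (simp add: E_def)
  have est: "norm (dq h z \<tau> - dq k z \<tau>) \<le> E * (norm (dq h z s - dq k z s) + C * (\<bar>h\<bar> + \<bar>k\<bar>) * (t - s))"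
    if hk: "h \<in> H" "k \<in> H" "\<bar>h\<bar> \<le> \<delta>\<^sub>0" "\<bar>k\<bar> \<le> \<delta>\<^sub>0" and \<tau>: "\<tau> \<in> {s..t}" for h k \<tau>
  proof -
    have sub: "{s..\<tau>} \<subseteq> {0..T}" using st \<tau> by auto
    have "solution_on s \<tau> (\<lambda>x. dq h y x - dq k y x) (\<lambda>x. dq h z x - dq k z x) (\<lambda>x. dq h f x - dq k f x) (\<lambda>x. dq h f' x - dq k f' x)"
      by (intro solution_on_diff solution_on_dq[OF sol sub]) (use H hk \<tau> st in auto)
    from derivative_estimate[OF this, of "C * (\<bar>h\<bar> + \<bar>k\<bar>)" \<beta>]
    have "norm (dq h z \<tau> - dq k z \<tau>) \<le> exp (\<beta> * (\<tau> - s)) * (norm (dq h z s - dq k z s) + C * (\<bar>h\<bar> + \<bar>k\<bar>) * (\<tau> - s))"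
      using C hk \<tau> nn by auto
    also have "\<dots> \<le> E * (norm (dq h z s - dq k z s) + C * (\<bar>h\<bar> + \<bar>k\<bar>) * (t - s))"
    proof (rule mult_mono)
      show "exp (\<beta> * (\<tau> - s)) \<le> E" using \<tau> nn by (simp add: E_def mult_left_mono)
      show "norm (dq h z s - dq k z s) + C * (\<bar>h\<bar> + \<bar>k\<bar>) * (\<tau> - s) \<le> norm (dq h z s - dq k z s) + C * (\<bar>h\<bar> + \<bar>k\<bar>) * (t - s)"
        using \<tau> nn by (intro add_left_mono mult_left_mono mult_nonneg_nonneg) auto
    qed (use E \<tau> nn in auto)
    finally show ?thesis .
  qed
  have unif: "\<exists>\<delta>>0. \<forall>h\<in>H. \<forall>k\<in>H. \<bar>h\<bar> < \<delta> \<longrightarrow> \<bar>k\<bar> < \<delta> \<longrightarrow> (\<forall>\<tau>\<in>{s..t}. norm (dq h z \<tau> - dq k z \<tau>) \<le> \<epsilon>)"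
    if \<epsilon>: "\<epsilon> > 0" for \<epsilon>
  proof -
    define e where "e = \<epsilon> / (4 * E)"
    have e: "e > 0" using \<epsilon> E by (simp add: e_def)
    obtain d where d: "d > 0" "\<And>h. h \<in> H \<Longrightarrow> \<bar>h\<bar> < d \<Longrightarrow> norm (dq h z s - r0) \<le> e" using init[OF e] by blast
    define \<delta> where "\<delta> = min (min d \<delta>\<^sub>0) (e / (C * (t - s) + 1))"
    have Cp: "0 \<le> C * (t - s)" using nn st by simp
    have \<delta>: "\<delta> > 0" using d \<delta>\<^sub>0 e Cp by (auto simp: \<delta>_def add_nonneg_pos)
    have "norm (dq h z \<tau> - dq k z \<tau>) \<le> \<epsilon>" if hk: "h \<in> H" "k \<in> H" "\<bar>h\<bar> < \<delta>" "\<bar>k\<bar> < \<delta>" and \<tau>: "\<tau> \<in> {s..t}" for h k \<tau>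
    proof -
      have hd: "\<bar>h\<bar> < d" "\<bar>k\<bar> < d" "\<bar>h\<bar> \<le> \<delta>\<^sub>0" "\<bar>k\<bar> \<le> \<delta>\<^sub>0" using hk by (auto simp: \<delta>_def)
      have i: "norm (dq h z s - dq k z s) \<le> 2 * e"
        using norm_triangle_ineq4[of "dq h z s - r0" "dq k z s - r0"] d(2)[OF hk(1) hd(1)] d(2)[OF hk(2) hd(2)] by simp
      have "C * (\<bar>h\<bar> + \<bar>k\<bar>) * (t - s) = (C * (t - s)) * (\<bar>h\<bar> + \<bar>k\<bar>)" by simp
      also have "\<dots> \<le> (C * (t - s) + 1) * (\<delta> + \<delta>)" using hk Cp by (intro mult_mono) auto
      also have "\<dots> \<le> (C * (t - s) + 1) * (2 * (e / (C * (t - s) + 1)))"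
        using Cp by (intro mult_left_mono) (auto simp: \<delta>_def)
      also have "\<dots> = 2 * e" using Cp by (simp add: add_nonneg_eq_0_iff)
      finally have "norm (dq h z s - dq k z s) + C * (\<bar>h\<bar> + \<bar>k\<bar>) * (t - s) \<le> 4 * e" using i by simp
      then have "E * (norm (dq h z s - dq k z s) + C * (\<bar>h\<bar> + \<bar>k\<bar>) * (t - s)) \<le> E * (4 * e)"
        using E by (intro mult_left_mono) auto
      also have "\<dots> = \<epsilon>" using E by (simp add: e_def)
      finally show ?thesis using est[OF hk(1,2) hd(3,4) \<tau>] by linarith
    qed
    then show ?thesis using \<delta> by blast
  qed
  define \<sigma> :: real where "\<sigma> = (if H = {0<..} then 1 else -1)"
  define hn where "hn n = \<sigma> / real (Suc n)" for n
  have hnH: "hn n \<in> H" for n using H by (auto simp: hn_def \<sigma>_def divide_neg_pos)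
  have hna: "\<bar>hn n\<bar> = 1 / real (Suc n)" for n by (simp add: hn_def \<sigma>_def)
  have small: "\<exists>N. \<forall>n\<ge>N. \<bar>hn n\<bar> < \<delta>" if \<delta>: "\<delta> > 0" for \<delta>
  proof -
    obtain N where N: "1 / real (Suc N) < \<delta>" using nat_approx_posE[OF \<delta>] by blast
    have "\<bar>hn n\<bar> < \<delta>" if "n \<ge> N" for n
    proof -
      have "1 / real (Suc n) \<le> 1 / real (Suc N)" using that by (intro divide_left_mono) auto
      then show ?thesis using N hna[of n] by simp
    qed
    then show ?thesis by blast
  qed
  have "uniformly_Cauchy_on {s..t} (\<lambda>n. dq (hn n) z)"
  proof (rule uniformly_Cauchy_onI)
    fix e :: real assume "e > 0"
    then have e2: "e / 2 > 0" by simp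
    obtain \<delta> where \<delta>: "\<delta> > 0" "\<And>h k \<tau>. h \<in> H \<Longrightarrow> k \<in> H \<Longrightarrow> \<bar>h\<bar> < \<delta> \<Longrightarrow> \<bar>k\<bar> < \<delta> \<Longrightarrow> \<tau> \<in> {s..t} \<Longrightarrow> norm (dq h z \<tau> - dq k z \<tau>) \<le> e / 2"
      using unif[OF e2] by blast
    obtain N where N: "\<And>n. n \<ge> N \<Longrightarrow> \<bar>hn n\<bar> < \<delta>" using small[OF \<delta>(1)] by blast
    have "dist (dq (hn m) z x) (dq (hn n) z x) < e" if "x \<in> {s..t}" "m \<ge> N" "n \<ge> N" for x m n
      using \<delta>(2)[OF hnH hnH N N that(1), OF that(2,3)] e2 by (simp add: dist_norm)
    then show "\<exists>M. \<forall>x\<in>{s..t}. \<forall>m\<ge>M. \<forall>n\<ge>M. dist (dq (hn m) z x) (dq (hn n) z x) < e" by blast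
  qed
  then obtain r where r: "uniform_limit {s..t} (\<lambda>n. dq (hn n) z) r sequentially"
    using Cauchy_uniformly_convergent unfolding uniformly_convergent_on_def by blast
  have "\<exists>\<delta>>0. \<forall>h\<in>H. \<bar>h\<bar> < \<delta> \<longrightarrow> (\<forall>\<tau>\<in>{s..t}. norm (dq h z \<tau> - r \<tau>) \<le> \<epsilon>)" if \<epsilon>: "\<epsilon> > 0" for \<epsilon>
  proof -
    have e2: "\<epsilon> / 2 > 0" using \<epsilon> by simp
    obtain \<delta> where \<delta>: "\<delta> > 0" "\<And>h k \<tau>. h \<in> H \<Longrightarrow> k \<in> H \<Longrightarrow> \<bar>h\<bar> < \<delta> \<Longrightarrow> \<bar>k\<bar> < \<delta> \<Longrightarrow> \<tau> \<in> {s..t} \<Longrightarrow> norm (dq h z \<tau> - dq k z \<tau>) \<le> \<epsilon> / 2"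
      using unif[OF e2] by blast
    obtain N where N: "\<And>n. n \<ge> N \<Longrightarrow> \<bar>hn n\<bar> < \<delta>" using small[OF \<delta>(1)] by blast
    obtain N' where N': "\<And>n \<tau>. n \<ge> N' \<Longrightarrow> \<tau> \<in> {s..t} \<Longrightarrow> dist (dq (hn n) z \<tau>) (r \<tau>) < \<epsilon> / 2"
      using r e2 unfolding uniform_limit_iff eventually_sequentially by blast
    define n where "n = max N N'"
    have "norm (dq h z \<tau> - r \<tau>) \<le> \<epsilon>" if h: "h \<in> H" "\<bar>h\<bar> < \<delta>" and \<tau>: "\<tau> \<in> {s..t}" for h \<tau>
    proof -
      have "norm (dq h z \<tau> - dq (hn n) z \<tau>) \<le> \<epsilon> / 2" using \<delta>(2)[OF h(1) hnH h(2) N \<tau>] by (simp add: n_def)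
      moreover have "norm (dq (hn n) z \<tau> - r \<tau>) < \<epsilon> / 2" using N'[of n, OF _ \<tau>] by (simp add: n_def dist_norm)
      moreover have "norm (dq h z \<tau> - r \<tau>) \<le> norm (dq h z \<tau> - dq (hn n) z \<tau>) + norm (dq (hn n) z \<tau> - r \<tau>)"
        using norm_triangle_ineq[of "dq h z \<tau> - dq (hn n) z \<tau>" "dq (hn n) z \<tau> - r \<tau>"] by simp
      ultimately show ?thesis by simp
    qed
    then show ?thesis using \<delta>(1) by blast
  qed
  then show ?thesis using that by blast
qed

end

text \<open>The form in which derivatives of curves in the spaces $L^2$ and $H^1$ are defined.\<close>

lemma has_vector_derivative_iff_quotient:
  fixes f :: "real \<Rightarrow> 'a::real_normed_vector"
  shows "(f has_vector_derivative D) (at x within S) \<longleftrightarrow>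
    ((\<lambda>y. norm ((1 / (y - x)) *\<^sub>R (f y - f x) - D)) \<longlongrightarrow> 0) (at x within S)"
proof -
  have "norm ((1 / (y - x)) *\<^sub>R (f y - f x) - D) = norm ((f y - f x) - (y - x) *\<^sub>R D) / norm (y - x)"
    if "y \<noteq> x" for y
  proof -
    have "(1 / (y - x)) *\<^sub>R (f y - f x) - D = (1 / (y - x)) *\<^sub>R ((f y - f x) - (y - x) *\<^sub>R D)"
      using that by (simp add: scaleR_diff_right)
    then show ?thesis by simp
  qed
  then have ev: "\<forall>\<^sub>F y in at x within S. norm ((1 / (y - x)) *\<^sub>R (f y - f x) - D) = norm ((f y - f x) - (y - x) *\<^sub>R D) / norm (y - x)"
    by (simp add: eventually_at_filter)
  show ?thesis
    unfolding has_vector_derivative_def has_derivative_iff_norm tendsto_cong[OF ev]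
    using bounded_linear_scaleR_left[of D] by simp
qed

text \<open>For two points of the window one of the two is the base point of an admissible
  quotient. By continuity of the limit \<open>r\<close> it does not matter which one.\<close>

lemma one_sided_uniform_imp_derivative:
  fixes z :: "real \<Rightarrow> 'a::real_normed_vector"
  assumes c: "continuous_on {0..T} z" and st: "0 \<le> s" "t \<le> T"
    and H: "(H = {0<..} \<and> t + \<delta>\<^sub>0 \<le> T) \<or> (H = {..<0} \<and> \<delta>\<^sub>0 \<le> s)" and \<delta>\<^sub>0: "\<delta>\<^sub>0 > 0"
    and conv: "\<And>\<epsilon>. \<epsilon> > 0 \<Longrightarrow> \<exists>\<delta>>0. \<forall>h\<in>H. \<bar>h\<bar> < \<delta> \<longrightarrow> (\<forall>\<tau>\<in>{s..t}. norm (dq h z \<tau> - r \<tau>) \<le> \<epsilon>)"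
  shows "continuous_on {s..t} r" "\<tau> \<in> {s..t} \<Longrightarrow> (z has_vector_derivative r \<tau>) (at \<tau> within {s..t})"
proof -
  show cr: "continuous_on {s..t} r"
    unfolding continuous_on_iff
  proof (intro ballI allI impI)
    fix x and \<epsilon> :: real assume x: "x \<in> {s..t}" and \<epsilon>: "\<epsilon> > 0"
    have e3: "\<epsilon> / 4 > 0" using \<epsilon> by simp
    obtain \<delta> where \<delta>: "\<delta> > 0" "\<And>h \<tau>. h \<in> H \<Longrightarrow> \<bar>h\<bar> < \<delta> \<Longrightarrow> \<tau> \<in> {s..t} \<Longrightarrow> norm (dq h z \<tau> - r \<tau>) \<le> \<epsilon> / 4"
      using conv[OF e3] by blast
    define h where "h = (if H = {0<..} then 1 else -1) * (min \<delta> \<delta>\<^sub>0 / 2)"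
    have ha: "\<bar>h\<bar> = min \<delta> \<delta>\<^sub>0 / 2" using \<delta>(1) \<delta>\<^sub>0 by (simp add: h_def abs_mult)
    have h: "h \<in> H" "\<bar>h\<bar> < \<delta>" "\<bar>h\<bar> \<le> \<delta>\<^sub>0" using H ha \<delta>(1) \<delta>\<^sub>0 by (auto simp: h_def)
    have rng: "s + h \<ge> 0" "t + h \<le> T" using H h st by auto
    have "continuous_on {s..t} (dq h z)"
      unfolding dq_def[abs_def]
      by (intro continuous_intros continuous_on_subset[OF c] continuous_on_compose2[OF c]) (use st rng in auto)
    then obtain d where d: "d > 0" "\<And>x'. x' \<in> {s..t} \<Longrightarrow> dist x' x < d \<Longrightarrow> dist (dq h z x') (dq h z x) < \<epsilon> / 4"
      using x e3 unfolding continuous_on_iff by meson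
    have "dist (r x') (r x) < \<epsilon>" if x': "x' \<in> {s..t}" "dist x' x < d" for x'
    proof -
      have "r x' - r x = (dq h z x' - dq h z x) - (dq h z x' - r x') + (dq h z x - r x)" by simp
      then have "norm (r x' - r x) \<le> norm (dq h z x' - dq h z x) + norm (dq h z x' - r x') + norm (dq h z x - r x)"
        by (metis add_right_mono norm_triangle_ineq norm_triangle_ineq4 order_trans)
      then show ?thesis
        using \<delta>(2)[OF h(1,2) x'(1)] \<delta>(2)[OF h(1,2) x] d(2)[OF x'] \<epsilon> by (simp add: dist_norm)
    qed
    then show "\<exists>d>0. \<forall>x'\<in>{s..t}. dist x' x < d \<longrightarrow> dist (r x') (r x) < \<epsilon>" using d(1) by blast
  qed
  assume \<tau>: "\<tau> \<in> {s..t}"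
  show "(z has_vector_derivative r \<tau>) (at \<tau> within {s..t})"
    unfolding has_vector_derivative_iff_quotient
  proof (rule tendstoI)
    fix \<epsilon> :: real assume \<epsilon>: "\<epsilon> > 0"
    then have e3: "\<epsilon> / 3 > 0" by simp
    obtain \<delta> where \<delta>: "\<delta> > 0" "\<And>h \<tau>. h \<in> H \<Longrightarrow> \<bar>h\<bar> < \<delta> \<Longrightarrow> \<tau> \<in> {s..t} \<Longrightarrow> norm (dq h z \<tau> - r \<tau>) \<le> \<epsilon> / 3"
      using conv[OF e3] by blast
    obtain d where d: "d > 0" "\<And>x. x \<in> {s..t} \<Longrightarrow> dist x \<tau> < d \<Longrightarrow> dist (r x) (r \<tau>) < \<epsilon> / 3"
      using cr \<tau> e3 unfolding continuous_on_iff by meson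
    have "dist (norm ((1 / (x - \<tau>)) *\<^sub>R (z x - z \<tau>) - r \<tau>)) 0 < \<epsilon>"
      if x: "x \<in> {s..t}" "x \<noteq> \<tau>" "dist x \<tau> < min d \<delta>" for x
    proof -
      let ?q = "(1 / (x - \<tau>)) *\<^sub>R (z x - z \<tau>)"
      have q: "?q = dq (x - \<tau>) z \<tau>" "?q = dq (\<tau> - x) z x"
      proof -
        show "?q = dq (x - \<tau>) z \<tau>" by (simp add: dq_def)
        have "?q = (- 1 / (x - \<tau>)) *\<^sub>R (z \<tau> - z x)" by (simp add: scaleR_diff_right)
        also have "- 1 / (x - \<tau>) = 1 / (\<tau> - x)" by (metis minus_diff_eq minus_divide_left minus_divide_right)
        finally show "?q = dq (\<tau> - x) z x" by (simp add: dq_def)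
      qed
      have xd: "\<bar>x - \<tau>\<bar> < \<delta>" "\<bar>\<tau> - x\<bar> < \<delta>" using x(3) by (auto simp: dist_real_def)
      have rx: "norm (r x - r \<tau>) < \<epsilon> / 3" using d(2)[OF x(1)] x(3) by (simp add: dist_norm)
      have "x - \<tau> \<in> H \<or> \<tau> - x \<in> H" using H x(2) by auto
      then have "norm (?q - r \<tau>) \<le> \<epsilon> / 3 \<or> norm (?q - r x) \<le> \<epsilon> / 3"
        using \<delta>(2)[OF _ xd(1) \<tau>] \<delta>(2)[OF _ xd(2) x(1)] q by metis
      then have "norm (?q - r \<tau>) < \<epsilon>"
        using rx norm_triangle_ineq[of "?q - r x" "r x - r \<tau>"] e3 by auto
      then show ?thesis by simp
    qed
    then show "\<forall>\<^sub>F x in at \<tau> within {s..t}. dist (norm ((1 / (x - \<tau>)) *\<^sub>R (z x - z \<tau>) - r \<tau>)) 0 < \<epsilon>"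
      unfolding eventually_at using d(1) \<delta>(1) by (intro exI[of _ "min d \<delta>"]) auto
  qed
qed

lemma dq_limit_of_derivative:
  fixes z :: "real \<Rightarrow> 'a::real_normed_vector"
  assumes D: "(z has_vector_derivative r) (at s)" and \<epsilon>: "\<epsilon> > 0"
  shows "\<exists>\<delta>>0. \<forall>h\<in>{..<0}. \<bar>h\<bar> < \<delta> \<longrightarrow> norm (dq h z s - r) \<le> \<epsilon>"
proof -
  have "((\<lambda>y. norm ((1 / (y - s)) *\<^sub>R (z y - z s) - r)) \<longlongrightarrow> 0) (at s within UNIV)"
    using D unfolding has_vector_derivative_iff_quotient .
  then have "\<forall>\<^sub>F y in at s. dist (norm ((1 / (y - s)) *\<^sub>R (z y - z s) - r)) 0 < \<epsilon>"
    using \<epsilon> by (rule tendstoD)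
  then obtain \<delta> where \<delta>: "\<delta> > 0" "\<And>y. y \<noteq> s \<Longrightarrow> dist y s < \<delta> \<Longrightarrow> norm ((1 / (y - s)) *\<^sub>R (z y - z s) - r) < \<epsilon>"
    unfolding eventually_at by auto
  have "norm (dq h z s - r) \<le> \<epsilon>" if "h < 0" "\<bar>h\<bar> < \<delta>" for h
    using \<delta>(2)[of "s + h"] that by (simp add: dq_def dist_real_def less_imp_le)
  then show ?thesis using \<delta>(1) by blast
qed

text \<open>Forward quotients start from the known derivative at time 0 but do not reach \<open>T\<close>.
  They are used on the first half of the interval, which yields a two-sided derivative at \<open>T/4\<close>;
  from there, backward quotients cover the rest.\<close>

theorem (in skew_evolution) second_order_regularity:
  assumes sol: "solution_on 0 T y z f f'" and T: "T > 0" and z0: "z 0 = 0"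
    and dense: "\<And>e. e > 0 \<Longrightarrow> \<exists>\<phi> \<psi>. G \<phi> \<psi> \<and> norm (\<phi> - f' 0) < e"
    and C: "\<And>\<tau> h k. \<tau> \<in> {0..T} \<Longrightarrow> h \<noteq> 0 \<Longrightarrow> k \<noteq> 0 \<Longrightarrow> \<tau> + h \<in> {0..T} \<Longrightarrow> \<tau> + k \<in> {0..T} \<Longrightarrow>
      norm (dq h f' \<tau> - dq k f' \<tau>) \<le> C * (\<bar>h\<bar> + \<bar>k\<bar>) + \<beta> * norm (dq h z \<tau> - dq k z \<tau>)"
    and nn: "0 \<le> C" "0 \<le> \<beta>"
  obtains r where "continuous_on {0..T} r" 
    "\<And>\<tau>. \<tau> \<in> {0..T} \<Longrightarrow> (z has_vector_derivative r \<tau>) (at \<tau> within {0..T})"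
proof -
  have cz: "continuous_on {0..T} z" using sol unfolding solution_on_def by blast
  have half: "0 \<le> T / 2" "T / 2 \<le> T" "T / 2 > 0" using T by auto
  obtain r1 where r1: "\<And>\<epsilon>. \<epsilon> > 0 \<Longrightarrow> \<exists>\<delta>>0. \<forall>h\<in>{0<..}. \<bar>h\<bar> < \<delta> \<longrightarrow> (\<forall>\<tau>\<in>{0..T/2}. norm (dq h z \<tau> - r1 \<tau>) \<le> \<epsilon>)"
  proof (rule dq_uniformly_convergent[OF sol order_refl half(1,2), of "{0<..}" "T/2" C \<beta> "f' 0"])
    show "({0::real<..} = {0<..} \<and> T/2 + T/2 \<le> T) \<or> ({0::real<..} = {..<0} \<and> T/2 \<le> 0)" by simp
    show "norm (dq h f' \<tau> - dq k f' \<tau>) \<le> C * (\<bar>h\<bar> + \<bar>k\<bar>) + \<beta> * norm (dq h z \<tau> - dq k z \<tau>)"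
      if "\<tau> \<in> {0..T/2}" "h \<in> {0<..}" "k \<in> {0<..}" "\<bar>h\<bar> \<le> T/2" "\<bar>k\<bar> \<le> T/2" for \<tau> h k
      using that by (intro C) auto
    show "\<exists>\<delta>>0. \<forall>h\<in>{0<..}. \<bar>h\<bar> < \<delta> \<longrightarrow> norm (dq h z 0 - f' 0) \<le> \<epsilon>" if \<epsilon>: "\<epsilon> > 0" for \<epsilon>
    proof -
      obtain \<delta> where "\<delta> > 0" "\<And>h. 0 < h \<Longrightarrow> h < \<delta> \<Longrightarrow> h \<le> T \<Longrightarrow> norm (dq h z 0 - f' 0) \<le> \<epsilon>"
        using initial_second_derivative[OF sol T z0 dense \<epsilon>] by blast
      then show ?thesis using T by (intro exI[of _ "min \<delta> T"]) auto
    qed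
  qed (use half nn in auto)
  note R1 = one_sided_uniform_imp_derivative[OF cz order_refl half(2) _ half(3), of "{0<..}" r1]
  have c1: "continuous_on {0..T/2} r1" and D1: "\<And>\<tau>. \<tau> \<in> {0..T/2} \<Longrightarrow> (z has_vector_derivative r1 \<tau>) (at \<tau> within {0..T/2})"
    by (rule R1; use r1 in simp)+
  have "(z has_vector_derivative r1 (T/4)) (at (T/4) within {0..T/2})" using T by (intro D1) auto
  then have D4: "(z has_vector_derivative r1 (T/4)) (at (T/4))" using T by (simp add: at_within_Icc_at)
  have q: "0 \<le> T/4" "T/4 \<le> T" "T/4 > 0" using T by auto
  obtain r2 where r2: "\<And>\<epsilon>. \<epsilon> > 0 \<Longrightarrow> \<exists>\<delta>>0. \<forall>h\<in>{..<0}. \<bar>h\<bar> < \<delta> \<longrightarrow> (\<forall>\<tau>\<in>{T/4..T}. norm (dq h z \<tau> - r2 \<tau>) \<le> \<epsilon>)"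
  proof (rule dq_uniformly_convergent[OF sol q(1,2) order_refl, of "{..<0}" "T/4" C \<beta> "r1 (T/4)"])
    show "({..<0::real} = {0<..} \<and> T + T/4 \<le> T) \<or> ({..<0::real} = {..<0} \<and> T/4 \<le> T/4)" by simp
    show "norm (dq h f' \<tau> - dq k f' \<tau>) \<le> C * (\<bar>h\<bar> + \<bar>k\<bar>) + \<beta> * norm (dq h z \<tau> - dq k z \<tau>)"
      if "\<tau> \<in> {T/4..T}" "h \<in> {..<0}" "k \<in> {..<0}" "\<bar>h\<bar> \<le> T/4" "\<bar>k\<bar> \<le> T/4" for \<tau> h k
      using that T by (intro C) auto
    show "\<exists>\<delta>>0. \<forall>h\<in>{..<0}. \<bar>h\<bar> < \<delta> \<longrightarrow> norm (dq h z (T/4) - r1 (T/4)) \<le> \<epsilon>" if "\<epsilon> > 0" for \<epsilon>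
      by (rule dq_limit_of_derivative[OF D4 that])
  qed (use q nn in auto)
  note R2 = one_sided_uniform_imp_derivative[OF cz q(1) order_refl _ q(3), of "{..<0}" r2]
  have c2: "continuous_on {T/4..T} r2" and D2: "\<And>\<tau>. \<tau> \<in> {T/4..T} \<Longrightarrow> (z has_vector_derivative r2 \<tau>) (at \<tau> within {T/4..T})"
    by (rule R2; use r2 in simp)+
  define r where "r \<tau> = (if \<tau> < T/2 then r1 \<tau> else r2 \<tau>)" for \<tau>
  have D1': "(z has_vector_derivative r1 \<tau>) (at \<tau> within {0..T})" if "\<tau> \<in> {0..<T/2}" for \<tau>
  proof -
    have "at \<tau> within {0..T} = at \<tau> within {0..T/2}"
      by (rule at_within_nhd[of _ "{..<T/2}"]) (use that in auto)
    then show ?thesis using D1[of \<tau>] that by simp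
  qed
  have D2': "(z has_vector_derivative r2 \<tau>) (at \<tau> within {0..T})" if "\<tau> \<in> {T/4<..T}" for \<tau>
  proof -
    have "at \<tau> within {0..T} = at \<tau> within {T/4..T}"
      by (rule at_within_nhd[of _ "{T/4<..}"]) (use that T in auto)
    then show ?thesis using D2[of \<tau>] that by simp
  qed
  have eq: "r1 \<tau> = r2 \<tau>" if "\<tau> \<in> {T/4<..<T/2}" for \<tau>
    using vector_derivative_unique_within_closed_interval[of 0 T \<tau> z "r1 \<tau>" "r2 \<tau>"] D1'[of \<tau>] D2'[of \<tau>] that T by auto
  have "continuous_on ({0..<T/2} \<union> {T/4<..T}) r"
  proof (rule continuous_on_Un_local_open)
    have U: "{0..<T/2} \<union> {T/4<..T} = {0..T}" using T by auto
    have "{0..<T/2} = {0..T} \<inter> {..<T/2}" "{T/4<..T} = {0..T} \<inter> {T/4<..}" using T by auto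
    then show "openin (top_of_set ({0..<T/2} \<union> {T/4<..T})) {0..<T/2}"
      "openin (top_of_set ({0..<T/2} \<union> {T/4<..T})) {T/4<..T}"
      unfolding U by (metis openin_open_Int open_lessThan, metis openin_open_Int open_greaterThan)
    show "continuous_on {0..<T/2} r"
      by (rule continuous_on_eq[OF continuous_on_subset[OF c1]]) (auto simp: r_def)
    show "continuous_on {T/4<..T} r"
      by (rule continuous_on_eq[OF continuous_on_subset[OF c2]]) (auto simp: r_def eq)
  qed
  moreover have "{0..<T/2} \<union> {T/4<..T} = {0..T}" using T by auto
  ultimately have cr: "continuous_on {0..T} r" by simp
  have "(z has_vector_derivative r \<tau>) (at \<tau> within {0..T})" if "\<tau> \<in> {0..T}" for \<tau>
    using D1'[of \<tau>] D2'[of \<tau>] that T by (auto simp: r_def)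
  with cr show ?thesis by (rule that)
qed

section \<open>Nemytskii operators\<close>

lemma abs_mult_scaled_abs: "\<bar>r :: real\<bar> * (k * \<bar>r\<bar>) = k * r\<^sup>2"
  by (simp add: power2_eq_square mult.left_commute)

lemma mvt_real:
  fixes f f' :: "real \<Rightarrow> real"
  assumes D: "\<And>x. (f has_real_derivative f' x) (at x)"
  obtains \<xi> where "\<bar>\<xi> - x\<bar> \<le> \<bar>y - x\<bar>" "f y - f x = (y - x) * f' \<xi>"
proof -
  consider "x < y" | "y < x" | "x = y" by linarith
  then show ?thesis
  proof cases
    case 1
    then obtain \<xi> where "x < \<xi>" "\<xi> < y" "f y - f x = (y - x) * f' \<xi>" using MVT2[of x y f f'] D by blast
    then show ?thesis using that[of \<xi>] by auto
  next
    case 2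
    then obtain \<xi> where "y < \<xi>" "\<xi> < x" "f x - f y = (x - y) * f' \<xi>" using MVT2[of y x f f'] D by blast
    then show ?thesis using that[of \<xi>] by (auto simp: algebra_simps)
  next
    case 3
    then show ?thesis using that[of x] by auto
  qed
qed

lemma comp_fn_measurable:
  assumes "continuous_on UNIV b" shows "(\<lambda>x. b (fn u x)) \<in> borel_measurable I01"
  using measurable_compose[OF fn_measurable borel_measurable_continuous_onI[OF assms]] .

text \<open>The superposition (Nemytskii) operator of \<open>b\<close>.\<close>

definition nem :: "(real \<Rightarrow> real) \<Rightarrow> l2 \<Rightarrow> l2" where
  "nem b u = toL2 (\<lambda>x. b (fn u x))"

text \<open>The properties of the coefficient that the estimates use; \<open>coefficient_regularity\<close>
  provides them.\<close>

locale coefficient =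
  fixes a a' a'' :: "real \<Rightarrow> real" and k1 k2 k3 :: real
  assumes a0: "a 0 = 0" and Da: "\<And>x. (a has_real_derivative a' x) (at x)"
    and Da': "\<And>x. (a' has_real_derivative a'' x) (at x)"
    and a'_bound: "\<And>x. \<bar>a' x\<bar> \<le> k1" and a''_bound: "\<And>x. \<bar>a'' x\<bar> \<le> k2"
    and a''_Lip: "\<And>x y. \<bar>a'' x - a'' y\<bar> \<le> k3 * \<bar>x - y\<bar>"
begin

lemma k_nonneg: "0 \<le> k1" "0 \<le> k2" "0 \<le> k3"
  using a'_bound[of 0] a''_bound[of 0] a''_Lip[of 1 0] by auto

lemma a_Lip: "\<bar>a y - a x\<bar> \<le> k1 * \<bar>y - x\<bar>"
proof -
  obtain \<xi> where "a y - a x = (y - x) * a' \<xi>" using mvt_real[OF Da] by metis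
  then show ?thesis using a'_bound[of \<xi>] by (simp add: abs_mult mult.commute mult_right_mono)
qed

lemma a'_Lip: "\<bar>a' y - a' x\<bar> \<le> k2 * \<bar>y - x\<bar>"
proof -
  obtain \<xi> where "a' y - a' x = (y - x) * a'' \<xi>" using mvt_real[OF Da'] by metis
  then show ?thesis using a''_bound[of \<xi>] by (simp add: abs_mult mult.commute mult_right_mono)
qed

lemma a_Taylor: "\<bar>a y - a x - a' x * (y - x)\<bar> \<le> k2 * (y - x)\<^sup>2"
proof -
  obtain \<xi> where \<xi>: "\<bar>\<xi> - x\<bar> \<le> \<bar>y - x\<bar>" "a y - a x = (y - x) * a' \<xi>" using mvt_real[OF Da] by metis
  have "\<bar>a' \<xi> - a' x\<bar> \<le> k2 * \<bar>y - x\<bar>"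
    using a'_Lip[of \<xi> x] mult_left_mono[OF \<xi>(1) k_nonneg(2)] by linarith
  then have "\<bar>y - x\<bar> * \<bar>a' \<xi> - a' x\<bar> \<le> \<bar>y - x\<bar> * (k2 * \<bar>y - x\<bar>)" by (intro mult_left_mono) auto
  moreover have "a y - a x - a' x * (y - x) = (y - x) * (a' \<xi> - a' x)" using \<xi>(2) by (simp add: algebra_simps)
  ultimately show ?thesis by (simp only: abs_mult abs_mult_scaled_abs)
qed

lemma a'_Taylor: "\<bar>a' y - a' x - a'' x * (y - x)\<bar> \<le> k3 * (y - x)\<^sup>2"
proof -
  obtain \<xi> where \<xi>: "\<bar>\<xi> - x\<bar> \<le> \<bar>y - x\<bar>" "a' y - a' x = (y - x) * a'' \<xi>" using mvt_real[OF Da'] by metis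
  have "\<bar>a'' \<xi> - a'' x\<bar> \<le> k3 * \<bar>y - x\<bar>"
    using a''_Lip[of \<xi> x] mult_left_mono[OF \<xi>(1) k_nonneg(3)] by linarith
  then have "\<bar>y - x\<bar> * \<bar>a'' \<xi> - a'' x\<bar> \<le> \<bar>y - x\<bar> * (k3 * \<bar>y - x\<bar>)" by (intro mult_left_mono) auto
  moreover have "a' y - a' x - a'' x * (y - x) = (y - x) * (a'' \<xi> - a'' x)" using \<xi>(2) by (simp add: algebra_simps)
  ultimately show ?thesis by (simp only: abs_mult abs_mult_scaled_abs)
qed

lemma cont_a: "continuous_on UNIV a" and cont_a': "continuous_on UNIV a'"
  using Da Da' by (auto intro!: continuous_at_imp_continuous_on DERIV_isCont)

lemma cont_a'': "continuous_on UNIV a''"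
proof -
  have "k3-lipschitz_on UNIV a''" using a''_Lip k_nonneg by (auto intro!: lipschitz_onI simp: dist_real_def)
  then show ?thesis by (rule lipschitz_on_continuous_on)
qed

lemma nem_carrier: "f \<in> space_carrier L2 \<Longrightarrow> (\<lambda>x. a (f x)) \<in> space_carrier L2"
  unfolding L2_carrier_iff
proof
  assume f: "f \<in> borel_measurable I01 \<and> integrable I01 (\<lambda>x. (f x)\<^sup>2)"
  show m: "(\<lambda>x. a (f x)) \<in> borel_measurable I01"
    using measurable_compose[OF _ borel_measurable_continuous_onI[OF cont_a]] f by blast
  show "integrable I01 (\<lambda>x. (a (f x))\<^sup>2)"
  proof (rule Bochner_Integration.integrable_bound[of _ "\<lambda>x. k1\<^sup>2 * (f x)\<^sup>2"])
    have "(a y)\<^sup>2 \<le> k1\<^sup>2 * y\<^sup>2" for y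
    proof -
      have "\<bar>a y\<bar>\<^sup>2 \<le> (k1 * \<bar>y\<bar>)\<^sup>2" using a_Lip[of y 0] a0 by (intro power_mono) auto
      then show ?thesis by (simp add: power_mult_distrib)
    qed
    then show "AE x in I01. norm ((a (f x))\<^sup>2) \<le> norm (k1\<^sup>2 * (f x)\<^sup>2)" by simp
  qed (use f m in auto)
qed

lemma fn_nem: "AE x in I01. fn (nem a u) x = a (fn u x)"
  unfolding nem_def by (rule fn_toL2[OF nem_carrier]) simp

lemma nem_toL2: 
  assumes "f \<in> space_carrier L2" shows "nem a (toL2 f) = toL2 (\<lambda>x. a (f x))"
  unfolding nem_def
proof (subst toL2_eq_iff)
  show "AE x in I01. a (fn (toL2 f) x) = a (f x)" using fn_toL2[OF assms] by (rule eventually_mono) simp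
qed (use nem_carrier assms in auto)

lemma nem_Lip: "norm (nem a u - nem a w) \<le> k1 * norm (u - w)"
proof (rule norm_l2_mono[OF _ k_nonneg(1)])
  show "AE x in I01. \<bar>fn (nem a u - nem a w) x\<bar> \<le> k1 * \<bar>fn (u - w) x\<bar>"
    using fn_diff[of "nem a u" "nem a w"] fn_diff[of u w] fn_nem[of u] fn_nem[of w]
    by eventually_elim (simp add: a_Lip)
qed

lemma nem_0: "nem a 0 = 0"
  unfolding l2_eq_iff using fn_nem[of 0] fn_zero by eventually_elim (simp add: a0)

lemma norm_nem: "norm (nem a u) \<le> k1 * norm u"
  using nem_Lip[of u 0] by (simp add: nem_0)

abbreviation dnem :: "l2 \<Rightarrow> l2 \<Rightarrow> l2" where
  "dnem u \<equiv> mul (\<lambda>x. a' (fn u x))"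

lemma dnem_meas: "(\<lambda>x. a' (fn u x)) \<in> borel_measurable I01" "AE x in I01. \<bar>a' (fn u x)\<bar> \<le> k1"
  by (auto simp: comp_fn_measurable[OF cont_a'] a'_bound)

lemmas fn_dnem = fn_mul[OF dnem_meas]
lemmas norm_dnem = norm_mul[OF dnem_meas k_nonneg(1)]
lemmas bounded_linear_dnem = bounded_linear_mul[OF dnem_meas k_nonneg(1)]

lemma dnem_diff: "dnem u (v - w) = dnem u v - dnem u w"
  using linear_diff[OF bounded_linear.linear[OF bounded_linear_dnem]] .

lemma dnem_scale: "dnem u (c *\<^sub>R v) = c *\<^sub>R dnem u v"
  using linear_scale[OF bounded_linear.linear[OF bounded_linear_dnem]] .

text \<open>The quadratic remainder is a product of two differences, one of which is estimated in the supremum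
  norm. For a mere $L^2$ estimate of \<open>u - w\<close> this would fail.\<close>

lemma nem_Taylor:
  assumes "ess_bounded k (u - w)"
  shows "norm (nem a u - nem a w - dnem w (u - w)) \<le> k2 * k * norm (u - w)"
proof (rule norm_l2_mono)
  show "AE x in I01. \<bar>fn (nem a u - nem a w - dnem w (u - w)) x\<bar> \<le> k2 * k * \<bar>fn (u - w) x\<bar>"
    using fn_diff[of "nem a u - nem a w" "dnem w (u - w)"] fn_diff[of "nem a u" "nem a w"] fn_diff[of u w]
      fn_nem[of u] fn_nem[of w] fn_dnem[of w "u - w"] assms[unfolded ess_bounded_def, THEN conjunct2]
  proof eventually_elim
    case (elim x)
    have "\<bar>fn (nem a u - nem a w - dnem w (u - w)) x\<bar> \<le> k2 * (fn (u - w) x)\<^sup>2"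
      using elim a_Taylor[of "fn u x" "fn w x"] by simp
    also have "\<dots> = k2 * (\<bar>fn (u - w) x\<bar> * \<bar>fn (u - w) x\<bar>)" by (simp add: power2_eq_square)
    also have "\<dots> \<le> k2 * (k * \<bar>fn (u - w) x\<bar>)"
      using elim by (intro mult_left_mono mult_right_mono k_nonneg) auto
    finally show ?case by (simp add: mult.assoc)
  qed
qed (use assms k_nonneg in \<open>auto simp: ess_bounded_def\<close>)

lemma dnem_Lip:
  assumes "ess_bounded k (u - w)"
  shows "norm (dnem u v - dnem w v) \<le> k2 * k * norm v"
proof (rule norm_l2_mono)
  show "AE x in I01. \<bar>fn (dnem u v - dnem w v) x\<bar> \<le> k2 * k * \<bar>fn v x\<bar>"
    using fn_diff[of "dnem u v" "dnem w v"] fn_diff[of u w] fn_dnem[of u v] fn_dnem[of w v]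
      assms[unfolded ess_bounded_def, THEN conjunct2]
  proof eventually_elim
    case (elim x)
    have "\<bar>fn (dnem u v - dnem w v) x\<bar> = \<bar>a' (fn u x) - a' (fn w x)\<bar> * \<bar>fn v x\<bar>"
      using elim by (simp add: left_diff_distrib flip: abs_mult)
    also have "\<dots> \<le> (k2 * \<bar>fn (u - w) x\<bar>) * \<bar>fn v x\<bar>"
      using elim a'_Lip[of "fn u x" "fn w x"] by (intro mult_right_mono) auto
    also have "\<dots> \<le> (k2 * k) * \<bar>fn v x\<bar>"
      using elim by (intro mult_right_mono mult_left_mono k_nonneg) auto
    finally show ?case .
  qed
qed (use assms k_nonneg in \<open>auto simp: ess_bounded_def\<close>)

text \<open>The second differential of the superposition operator at \<open>u\<close>, in the direction \<open>v\<close>.\<close>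

definition d2nem :: "l2 \<Rightarrow> l2 \<Rightarrow> l2" where
  "d2nem u v = mul (\<lambda>x. a'' (fn u x) * fn v x) v"

text \<open>Pointwise, with \<open>m\<close> the difference quotient of \<open>a'\<close> along \<open>u\<close> and \<open>d\<close> that of \<open>u\<close>,
  \<open>m v\<^sub>2 - a''(u) v\<^sup>2 = m (v\<^sub>2 - v) + (m - a''(u) d) v + a''(u) v (d - v)\<close>. The Lipschitz continuity of
  \<open>a''\<close> makes the middle term \<open>O(\<bar>h\<bar>)\<close>.\<close>

lemma dnem_dq:
  assumes h: "h \<noteq> 0" and Dq: "ess_bounded K ((1 / h) *\<^sub>R (u2 - u1))" and v: "ess_bounded K v"
  shows "norm ((1 / h) *\<^sub>R (dnem u2 v2 - dnem u1 v2) - d2nem u1 v)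
    \<le> k2 * K * norm (v2 - v) + k3 * \<bar>h\<bar> * K\<^sup>2 * norm v + k2 * K * norm ((1 / h) *\<^sub>R (u2 - u1) - v)"
proof (rule norm_l2_mono3)
  have K: "0 \<le> K" using v by (simp add: ess_bounded_def)
  have vb: "AE x in I01. \<bar>fn v x\<bar> \<le> K" using v by (simp add: ess_bounded_def)
  have m: "(\<lambda>x. a'' (fn u1 x) * fn v x) \<in> borel_measurable I01"
    using comp_fn_measurable[OF cont_a''] by measurable
  have mb: "AE x in I01. \<bar>a'' (fn u1 x) * fn v x\<bar> \<le> k2 * K"
    using vb by (rule eventually_mono) (auto simp: abs_mult intro!: mult_mono a''_bound k_nonneg)
  note fd = fn_mul[OF m mb, of v, folded d2nem_def]
  define w where "w = (1 / h) *\<^sub>R (u2 - u1)"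
  show "AE x in I01. \<bar>fn ((1 / h) *\<^sub>R (dnem u2 v2 - dnem u1 v2) - d2nem u1 v) x\<bar> \<le>
    k2 * K * \<bar>fn (v2 - v) x\<bar> + k3 * \<bar>h\<bar> * K\<^sup>2 * \<bar>fn v x\<bar> + k2 * K * \<bar>fn ((1 / h) *\<^sub>R (u2 - u1) - v) x\<bar>"
    using fn_diff[of "(1 / h) *\<^sub>R (dnem u2 v2 - dnem u1 v2)" "d2nem u1 v"] fn_scale[of "1/h" "dnem u2 v2 - dnem u1 v2"]
      fn_diff[of "dnem u2 v2" "dnem u1 v2"] fn_dnem[of u2 v2] fn_dnem[of u1 v2] fd fn_diff[of v2 v]
      fn_diff[of w v, unfolded w_def] fn_scale[of "1/h" "u2 - u1"] fn_diff[of u2 u1]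
      Dq[unfolded ess_bounded_def, THEN conjunct2] vb
  proof eventually_elim
    case (elim x)
    define U V2 V d where "U = fn u1 x" and "V2 = fn v2 x" and "V = fn v x" and "d = fn ((1 / h) *\<^sub>R (u2 - u1)) x"
    define m where "m = (a' (fn u2 x) - a' U) / h"
    have d: "fn u2 x - U = h * d" using elim h by (simp add: d_def U_def)
    have dK: "\<bar>d\<bar> \<le> K" using elim by (simp add: d_def)
    have VK: "\<bar>V\<bar> \<le> K" using elim by (simp add: V_def)
    have mK: "\<bar>m\<bar> \<le> k2 * K"
    proof -
      have "\<bar>a' (fn u2 x) - a' U\<bar> \<le> k2 * (\<bar>h\<bar> * \<bar>d\<bar>)" using a'_Lip[of "fn u2 x" U] d by (simp add: abs_mult)
      then have "\<bar>m\<bar> \<le> k2 * \<bar>d\<bar>" using h by (simp add: m_def field_simps)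
      also have "\<dots> \<le> k2 * K" using dK by (intro mult_left_mono k_nonneg)
      finally show ?thesis .
    qed
    have mT: "\<bar>m - a'' U * d\<bar> \<le> k3 * \<bar>h\<bar> * K\<^sup>2"
    proof -
      have "\<bar>a' (fn u2 x) - a' U - a'' U * (h * d)\<bar> \<le> k3 * (h * d)\<^sup>2" using a'_Taylor[of "fn u2 x" U] d by simp
      moreover have "a' (fn u2 x) - a' U - a'' U * (h * d) = h * (m - a'' U * d)" using h by (simp add: m_def field_simps)
      ultimately have "\<bar>h\<bar> * \<bar>m - a'' U * d\<bar> \<le> k3 * (h * d)\<^sup>2" by (simp add: abs_mult)
      also have "\<dots> = \<bar>h\<bar> * (k3 * \<bar>h\<bar> * d\<^sup>2)" by (simp add: power_mult_distrib power2_eq_square[of h])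
      finally have "\<bar>m - a'' U * d\<bar> \<le> k3 * \<bar>h\<bar> * d\<^sup>2" using h by simp
      also have "\<dots> \<le> k3 * \<bar>h\<bar> * K\<^sup>2"
        using dK K by (intro mult_left_mono mult_nonneg_nonneg k_nonneg) (auto simp: abs_le_square_iff[symmetric])
      finally show ?thesis .
    qed
    have "fn ((1 / h) *\<^sub>R (dnem u2 v2 - dnem u1 v2) - d2nem u1 v) x =
      1 / h * (a' (fn u2 x) * fn v2 x - a' (fn u1 x) * fn v2 x) - a'' (fn u1 x) * fn v x * fn v x"
      by (simp only: elim)
    also have "\<dots> = m * V2 - a'' U * V * V"
      by (simp add: m_def U_def V2_def V_def left_diff_distrib diff_divide_distrib)
    also have "\<dots> = m * (V2 - V) + (m - a'' U * d) * V + (a'' U * V) * (d - V)" by (simp add: algebra_simps)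
    also have "\<bar>\<dots>\<bar> \<le> \<bar>m\<bar> * \<bar>V2 - V\<bar> + \<bar>m - a'' U * d\<bar> * \<bar>V\<bar> + \<bar>a'' U * V\<bar> * \<bar>d - V\<bar>"
      unfolding abs_mult[symmetric] by linarith
    also have "\<dots> \<le> k2 * K * \<bar>V2 - V\<bar> + k3 * \<bar>h\<bar> * K\<^sup>2 * \<bar>V\<bar> + k2 * K * \<bar>d - V\<bar>"
      using mK mT VK a''_bound[of U] 
      by (intro add_mono mult_right_mono) (auto simp: abs_mult intro!: mult_mono k_nonneg)
    finally show ?case using elim by (simp add: U_def V2_def V_def d_def)
  qed
  show "0 \<le> k2 * K" "0 \<le> k3 * \<bar>h\<bar> * K\<^sup>2" "0 \<le> k2 * K" using K k_nonneg by auto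
qed

lemma nem_has_vector_derivative:
  assumes D: "(u has_vector_derivative v) (at t within S)"
    and \<kappa>: "\<And>s. s \<in> S \<Longrightarrow> ess_bounded (\<kappa> s) (u s - u t)" "(\<kappa> \<longlongrightarrow> 0) (at t within S)"
  shows "((\<lambda>s. nem a (u s)) has_vector_derivative dnem (u t) v) (at t within S)"
  unfolding has_vector_derivative_iff_quotient
proof (rule Lim_null_comparison)
  define q where "q s = (1 / (s - t)) *\<^sub>R (u s - u t)" for s
  have q0: "((\<lambda>s. norm (q s - v)) \<longlongrightarrow> 0) (at t within S)"
    using D unfolding has_vector_derivative_iff_quotient q_def .
  then have qv: "(q \<longlongrightarrow> v) (at t within S)" 
    by (simp add: LIM_zero_iff tendsto_norm_zero_iff)
  have "((\<lambda>s. k2 * \<kappa> s * norm (q s) + k1 * norm (q s - v)) \<longlongrightarrow> k2 * 0 * norm v + k1 * 0) (at t within S)"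
    by (intro tendsto_intros \<kappa> qv q0)
  then show "((\<lambda>s. k2 * \<kappa> s * norm (q s) + k1 * norm (q s - v)) \<longlongrightarrow> 0) (at t within S)" by simp
  have "norm (norm ((1 / (s - t)) *\<^sub>R (nem a (u s) - nem a (u t)) - dnem (u t) v)) \<le> k2 * \<kappa> s * norm (q s) + k1 * norm (q s - v)"
    if s: "s \<in> S" "s \<noteq> t" for s
  proof -
    have "(1 / (s - t)) *\<^sub>R (nem a (u s) - nem a (u t)) - dnem (u t) v
      = (1 / (s - t)) *\<^sub>R (nem a (u s) - nem a (u t) - dnem (u t) (u s - u t)) + dnem (u t) (q s - v)"
      by (simp add: dnem_diff dnem_scale q_def scaleR_diff_right)
    also have "norm \<dots> \<le> \<bar>1 / (s - t)\<bar> * norm (nem a (u s) - nem a (u t) - dnem (u t) (u s - u t)) + norm (dnem (u t) (q s - v))"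
      by (rule norm_triangle_le) simp
    also have "\<dots> \<le> \<bar>1 / (s - t)\<bar> * (k2 * \<kappa> s * norm (u s - u t)) + k1 * norm (q s - v)"
      by (intro add_mono mult_left_mono nem_Taylor[OF \<kappa>(1)[OF s(1)]] norm_dnem) auto
    also have "\<bar>1 / (s - t)\<bar> * (k2 * \<kappa> s * norm (u s - u t)) = k2 * \<kappa> s * norm (q s)"
      by (simp add: q_def)
    finally show ?thesis by simp
  qed
  then show "\<forall>\<^sub>F s in at t within S. norm (norm ((1 / (s - t)) *\<^sub>R (nem a (u s) - nem a (u t)) - dnem (u t) v)) \<le> k2 * \<kappa> s * norm (q s) + k1 * norm (q s - v)"
    by (auto simp: eventually_at_filter)
qed

lemma dnem_tendsto:
  assumes v: "(v \<longlongrightarrow> v t) (at t within S)"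
    and \<kappa>: "\<And>s. s \<in> S \<Longrightarrow> ess_bounded (\<kappa> s) (u s - u t)" "(\<kappa> \<longlongrightarrow> 0) (at t within S)"
  shows "((\<lambda>s. dnem (u s) (v s)) \<longlongrightarrow> dnem (u t) (v t)) (at t within S)"
proof (rule LIM_zero_cancel, rule Lim_null_comparison)
  have "((\<lambda>s. k2 * \<kappa> s * norm (v s) + k1 * norm (v s - v t)) \<longlongrightarrow> k2 * 0 * norm (v t) + k1 * norm (v t - v t)) (at t within S)"
    by (intro tendsto_intros \<kappa> v)
  then show "((\<lambda>s. k2 * \<kappa> s * norm (v s) + k1 * norm (v s - v t)) \<longlongrightarrow> 0) (at t within S)" by simp
  have "norm (dnem (u s) (v s) - dnem (u t) (v t)) \<le> k2 * \<kappa> s * norm (v s) + k1 * norm (v s - v t)" if "s \<in> S" for s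
  proof -
    have "dnem (u s) (v s) - dnem (u t) (v t) = (dnem (u s) (v s) - dnem (u t) (v s)) + dnem (u t) (v s - v t)"
      by (simp add: dnem_diff)
    also have "norm \<dots> \<le> k2 * \<kappa> s * norm (v s) + k1 * norm (v s - v t)"
      by (intro norm_triangle_mono dnem_Lip \<kappa> norm_dnem that)
    finally show ?thesis .
  qed
  then show "\<forall>\<^sub>F s in at t within S. norm (dnem (u s) (v s) - dnem (u t) (v t)) \<le> k2 * \<kappa> s * norm (v s) + k1 * norm (v s - v t)"
    by (auto simp: eventually_at_filter)
qed

end

section \<open>Curves of functions as curves in Hilbert spaces\<close>

text \<open>An isometric linear map of the functions in \<open>X\<close> into a normed space, well defined on
  classes. It translates continuity and differentiability of curves
  into the notions for vector valued functions.\<close>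

definition embeds :: "fun_space \<Rightarrow> ((real \<Rightarrow> real) \<Rightarrow> 'b::real_normed_vector) \<Rightarrow> bool" where
  "embeds X j \<longleftrightarrow>
    (\<forall>f\<in>space_carrier X. space_norm X f = norm (j f)) \<and>
    (\<forall>f\<in>space_carrier X. \<forall>g\<in>space_carrier X. (\<lambda>x. f x - g x) \<in> space_carrier X \<and> j (\<lambda>x. f x - g x) = j f - j g) \<and>
    (\<forall>f\<in>space_carrier X. \<forall>c. (\<lambda>x. c * f x) \<in> space_carrier X \<and> j (\<lambda>x. c * f x) = c *\<^sub>R j f)"

lemma embedsD:
  assumes "embeds X j" "f \<in> space_carrier X"
  shows "space_norm X f = norm (j f)"
    and "g \<in> space_carrier X \<Longrightarrow> (\<lambda>x. f x - g x) \<in> space_carrier X"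
    and "g \<in> space_carrier X \<Longrightarrow> j (\<lambda>x. f x - g x) = j f - j g"
    and "(\<lambda>x. c * f x) \<in> space_carrier X" "j (\<lambda>x. c * f x) = c *\<^sub>R j f"
  using assms unfolding embeds_def by blast+

lemma embeds_L2: "embeds L2 toL2"
  unfolding embeds_def by (auto simp: norm_toL2 toL2_diff L2_diff toL2_scale L2_scale)

text \<open>The chosen weak derivative agrees almost everywhere with a square integrable one.\<close>

lemma H1_carrierD:
  assumes "f \<in> space_carrier H1"
  shows "f \<in> space_carrier L2" "weak_deriv unit_ivl 1 f \<in> space_carrier L2"
    "has_weak_deriv unit_ivl 1 f (weak_deriv unit_ivl 1 f)" "H1rel (toL2 f) (toL2 (weak_deriv unit_ivl 1 f))"
proof -
  from assms obtain g where f: "f \<in> space_carrier L2" and g: "g \<in> space_carrier L2" "has_weak_deriv unit_ivl 1 f g"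
    unfolding H1_def by auto
  show f': "f \<in> space_carrier L2" by (rule f)
  show w: "has_weak_deriv unit_ivl 1 f (weak_deriv unit_ivl 1 f)"
    unfolding weak_deriv_def by (rule someI[where P = "has_weak_deriv unit_ivl 1 f", OF g(2)])
  have ae: "AE x in I01. g x = weak_deriv unit_ivl 1 f x" by (rule weak_deriv_unique[OF g(2) w])
  have [measurable]: "g \<in> borel_measurable I01" using g(1) by (simp add: L2_carrier_iff)
  have m[measurable]: "weak_deriv unit_ivl 1 f \<in> borel_measurable I01"
    by (rule borel_measurable_lebesgue_on_AE[OF _ ae]) auto
  have "integrable I01 (\<lambda>x. (g x)\<^sup>2) \<longleftrightarrow> integrable I01 (\<lambda>x. (weak_deriv unit_ivl 1 f x)\<^sup>2)"
  proof (rule integrable_cong_AE)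
    show "AE x in I01. (g x)\<^sup>2 = (weak_deriv unit_ivl 1 f x)\<^sup>2" using ae by (rule eventually_mono) simp
  qed measurable
  then show c: "weak_deriv unit_ivl 1 f \<in> space_carrier L2" using g(1) m by (simp add: L2_carrier_iff)
  show "H1rel (toL2 f) (toL2 (weak_deriv unit_ivl 1 f))" using H1rel_toL2_iff[OF f c] w by simp
qed

lemma H1rel_unique:
  assumes "H1rel u q" "H1rel u q'" shows "q = q'"
proof -
  have "has_weak_deriv unit_ivl 1 (fn u) (fn q)" "has_weak_deriv unit_ivl 1 (fn u) (fn q')"
    using assms H1rel_toL2_iff[of "fn u" "fn q"] H1rel_toL2_iff[of "fn u" "fn q'"] by simp_all
  then show ?thesis unfolding l2_eq_iff by (rule weak_deriv_unique)
qed

lemma H1_carrierI: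
  assumes "f \<in> space_carrier L2" "H1rel (toL2 f) q"
  shows "f \<in> space_carrier H1" "toL2 (weak_deriv unit_ivl 1 f) = q"
proof -
  have "has_weak_deriv unit_ivl 1 f (fn q)" using assms H1rel_toL2_iff[of f "fn q"] by simp
  then show c: "f \<in> space_carrier H1" using assms(1) fn_carrier[of q] unfolding H1_def by auto
  show "toL2 (weak_deriv unit_ivl 1 f) = q" by (rule H1rel_unique[OF H1_carrierD(4)[OF c] assms(2)])
qed

text \<open>The graph of the weak derivative: the $H^1$ norm is the norm of the product space.\<close>

definition toH1 :: "(real \<Rightarrow> real) \<Rightarrow> l2 \<times> l2" where
  "toH1 f = (toL2 f, toL2 (weak_deriv unit_ivl 1 f))"

lemma embeds_H1: "embeds H1 toH1"
  unfolding embeds_def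
proof (intro conjI ballI allI)
  fix f assume f: "f \<in> space_carrier H1"
  note F = H1_carrierD[OF f]
  show "space_norm H1 f = norm (toH1 f)"
    using F by (simp add: H1_def toH1_def norm_prod_def norm_toL2)
  have s: "(\<lambda>x. c * f x) \<in> space_carrier H1" "toL2 (weak_deriv unit_ivl 1 (\<lambda>x. c * f x)) = c *\<^sub>R toL2 (weak_deriv unit_ivl 1 f)" for c
    using H1_carrierI[OF L2_scale[OF F(1)], of c "c *\<^sub>R toL2 (weak_deriv unit_ivl 1 f)"] H1rel_scale[OF F(4)] F
    by (simp_all add: toL2_scale)
  show "(\<lambda>x. c * f x) \<in> space_carrier H1" for c by (rule s)
  show "toH1 (\<lambda>x. c * f x) = c *\<^sub>R toH1 f" for c using s F by (simp add: toH1_def toL2_scale)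
  fix g assume g: "g \<in> space_carrier H1"
  note G = H1_carrierD[OF g]
  have d: "(\<lambda>x. f x - g x) \<in> space_carrier H1"
    "toL2 (weak_deriv unit_ivl 1 (\<lambda>x. f x - g x)) = toL2 (weak_deriv unit_ivl 1 f) - toL2 (weak_deriv unit_ivl 1 g)"
    using H1_carrierI[OF L2_diff[OF F(1) G(1)], of "toL2 (weak_deriv unit_ivl 1 f) - toL2 (weak_deriv unit_ivl 1 g)"]
      H1rel_diff[OF F(4) G(4)] F G
    by (simp_all add: toL2_diff)
  show "(\<lambda>x. f x - g x) \<in> space_carrier H1" by (rule d)
  show "toH1 (\<lambda>x. f x - g x) = toH1 f - toH1 g" using d F G by (simp add: toH1_def toL2_diff)
qed

lemma continuous_curve_iff:
  assumes "embeds X j"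
  shows "continuous_curve X T f \<longleftrightarrow> (\<forall>t\<in>{0..T}. f t \<in> space_carrier X) \<and> continuous_on {0..T} (\<lambda>t. j (f t))"
proof -
  have "((\<lambda>s. space_norm X (\<lambda>x. f s x - f t x)) \<longlongrightarrow> 0) (at t within {0..T}) \<longleftrightarrow> ((\<lambda>s. j (f s)) \<longlongrightarrow> j (f t)) (at t within {0..T})"
    if c: "\<forall>t\<in>{0..T}. f t \<in> space_carrier X" and t: "t \<in> {0..T}" for t
  proof -
    have "space_norm X (\<lambda>x. f s x - f t x) = norm (j (f s) - j (f t))" if "s \<in> {0..T}" for s
    proof -
      have ft: "f s \<in> space_carrier X" "f t \<in> space_carrier X" using c t that by auto
      show ?thesis unfolding embedsD(1)[OF assms embedsD(2)[OF assms ft]] embedsD(3)[OF assms ft] ..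
    qed
    then have ev: "\<forall>\<^sub>F s in at t within {0..T}. space_norm X (\<lambda>x. f s x - f t x) = norm (j (f s) - j (f t))"
      by (auto simp: eventually_at_filter)
    show ?thesis unfolding tendsto_cong[OF ev] by (simp add: tendsto_norm_zero_iff LIM_zero_iff)
  qed
  then show ?thesis unfolding continuous_curve_def continuous_on_def by blast
qed

lemma has_time_deriv_iff:
  assumes "embeds X j"
  shows "has_time_deriv X T f f' \<longleftrightarrow> (\<forall>t\<in>{0..T}. f t \<in> space_carrier X \<and> f' t \<in> space_carrier X) \<and>
    (\<forall>t\<in>{0..T}. ((\<lambda>t. j (f t)) has_vector_derivative j (f' t)) (at t within {0..T}))"
proof -
  have "((\<lambda>s. space_norm X (\<lambda>x. (f s x - f t x) / (s - t) - f' t x)) \<longlongrightarrow> 0) (at t within {0..T}) \<longleftrightarrow>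
     ((\<lambda>t. j (f t)) has_vector_derivative j (f' t)) (at t within {0..T})"
    if c: "\<forall>t\<in>{0..T}. f t \<in> space_carrier X \<and> f' t \<in> space_carrier X" and t: "t \<in> {0..T}" for t
  proof -
    have "space_norm X (\<lambda>x. (f s x - f t x) / (s - t) - f' t x) = norm ((1 / (s - t)) *\<^sub>R (j (f s) - j (f t)) - j (f' t))" if "s \<in> {0..T}" for s
    proof -
      have ft: "f s \<in> space_carrier X" "f t \<in> space_carrier X" "f' t \<in> space_carrier X" using c t that by auto
      note 1 = embedsD(2,3)[OF assms ft(1,2)]
      note 2 = embedsD(4,5)[OF assms 1(1), of "1 / (s - t)"]
      note 3 = embedsD(2,3)[OF assms 2(1) ft(3)]
      have "(\<lambda>x. (f s x - f t x) / (s - t) - f' t x) = (\<lambda>x. 1 / (s - t) * (f s x - f t x) - f' t x)" by simp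
      then show ?thesis unfolding 1(2)[symmetric] 2(2)[symmetric] 3(2)[symmetric]
        using embedsD(1)[OF assms 3(1)] by simp
    qed
    then have ev: "\<forall>\<^sub>F s in at t within {0..T}. space_norm X (\<lambda>x. (f s x - f t x) / (s - t) - f' t x) = norm ((1 / (s - t)) *\<^sub>R (j (f s) - j (f t)) - j (f' t))"
      by (auto simp: eventually_at_filter)
    show ?thesis unfolding has_vector_derivative_iff_quotient tendsto_cong[OF ev] ..
  qed
  then show ?thesis unfolding has_time_deriv_def by blast
qed

text \<open>The chosen derivative is determined up to null sets because a derivative on a
  nontrivial interval is unique.\<close>

lemma time_deriv_eq:
  assumes X: "embeds X j" and T: "T > 0" and D: "has_time_deriv X T f g"
  shows "has_time_deriv X T f (time_deriv X T f)" "\<And>t. t \<in> {0..T} \<Longrightarrow> j (time_deriv X T f t) = j (g t)"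
proof -
  show 1: "has_time_deriv X T f (time_deriv X T f)" unfolding time_deriv_def
    by (rule someI[where P = "has_time_deriv X T f", OF D])
  fix t assume "t \<in> {0..T}"
  then show "j (time_deriv X T f t) = j (g t)"
    using vector_derivative_unique_within_closed_interval[of 0 T t "\<lambda>t. j (f t)"] T D 1
    unfolding has_time_deriv_iff[OF X] by auto
qed

lemma Ck_curves_0_iff: "f \<in> Ck_curves 0 T X \<longleftrightarrow> continuous_curve X T f"
  by (simp add: Ck_curves_def)

lemma Ck_curves_1_iff:
  "f \<in> Ck_curves 1 T X \<longleftrightarrow> continuous_curve X T f \<and> continuous_curve X T (time_deriv X T f) \<and>
    has_time_deriv X T f (time_deriv X T f)"
  by (auto simp: Ck_curves_def le_Suc_eq)

lemma Ck_curves_2_iff: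
  "f \<in> Ck_curves 2 T X \<longleftrightarrow> continuous_curve X T f \<and> continuous_curve X T (time_deriv X T f) \<and>
    continuous_curve X T (time_deriv X T (time_deriv X T f)) \<and>
    has_time_deriv X T f (time_deriv X T f) \<and> has_time_deriv X T (time_deriv X T f) (time_deriv X T (time_deriv X T f))"
  by (auto simp: Ck_curves_def le_Suc_eq less_Suc_eq numeral_2_eq_2)

lemma Ck_curves_1I:
  assumes X: "embeds X j" and T: "T > 0" and D: "has_time_deriv X T f g" and c: "continuous_on {0..T} (\<lambda>t. j (g t))"
  shows "f \<in> Ck_curves 1 T X" "\<And>t. t \<in> {0..T} \<Longrightarrow> j (time_deriv X T f t) = j (g t)"
    "\<And>t. t \<in> {0..T} \<Longrightarrow> time_deriv X T f t \<in> space_carrier X"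
proof -
  note td = time_deriv_eq[OF X T D]
  show eq: "\<And>t. t \<in> {0..T} \<Longrightarrow> j (time_deriv X T f t) = j (g t)" by (rule td)
  show car: "\<And>t. t \<in> {0..T} \<Longrightarrow> time_deriv X T f t \<in> space_carrier X" using td(1) by (auto simp: has_time_deriv_iff[OF X])
  have "continuous_on {0..T} (\<lambda>t. j (f t))"
    using D has_vector_derivative_continuous unfolding has_time_deriv_iff[OF X] continuous_on_eq_continuous_within by blast
  moreover have "continuous_on {0..T} (\<lambda>t. j (time_deriv X T f t))"
    using c by (rule continuous_on_eq) (simp add: eq)
  ultimately show "f \<in> Ck_curves 1 T X"
    unfolding Ck_curves_1_iff continuous_curve_iff[OF X] using td(1) car D
    by (auto simp: has_time_deriv_iff[OF X])
qed

lemma Ck_curves_2I: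
  assumes X: "embeds X j" and T: "T > 0" and f: "f \<in> Ck_curves 1 T X" 
    and D: "has_time_deriv X T (time_deriv X T f) h" and c: "continuous_on {0..T} (\<lambda>t. j (h t))"
  shows "f \<in> Ck_curves 2 T X" "\<And>t. t \<in> {0..T} \<Longrightarrow> j (time_deriv X T (time_deriv X T f) t) = j (h t)"
    "\<And>t. t \<in> {0..T} \<Longrightarrow> time_deriv X T (time_deriv X T f) t \<in> space_carrier X"
  using Ck_curves_1I[OF X T D c] f unfolding Ck_curves_1_iff Ck_curves_2_iff by auto

lemma SUP_pair_le:
  fixes T :: real
  assumes X: "embeds X j" and T: "T > 0"
    and b: "\<And>t. t \<in> {0..T} \<Longrightarrow> p t \<in> space_carrier X \<and> u t \<in> space_carrier X \<and> norm (j (p t)) \<le> A \<and> norm (j (u t)) \<le> B"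
  shows "(SUP t\<in>{0..T}. sqrt ((space_norm X (p t))\<^sup>2 + (space_norm X (u t))\<^sup>2)) \<le> A + B"
proof (rule cSUP_least)
  show "{0..T} \<noteq> {}" using T by simp
  fix t assume t: "t \<in> {0..T}"
  have "space_norm X (p t) = norm (j (p t))" "space_norm X (u t) = norm (j (u t))"
    using embedsD(1)[OF X] b[OF t] by auto
  then show "sqrt ((space_norm X (p t))\<^sup>2 + (space_norm X (u t))\<^sup>2) \<le> A + B"
    using sqrt_sum_squares_le_sum[of "norm (j (p t))" "norm (j (u t))"] b[OF t] by auto
qed

section \<open>Estimates for the wave system\<close>

lemma vector_diff_le:
  fixes y z :: "real \<Rightarrow> 'a::real_normed_vector"
  assumes D: "\<And>\<tau>. \<tau> \<in> {a..b} \<Longrightarrow> (y has_vector_derivative z \<tau>) (at \<tau> within {a..b})"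
    and B: "\<And>\<tau>. \<tau> \<in> {a..b} \<Longrightarrow> norm (z \<tau>) \<le> B"
    and st: "s \<in> {a..b}" "t \<in> {a..b}"
  shows "norm (y t - y s) \<le> B * \<bar>t - s\<bar>"
proof -
  have "norm (y t - y s) \<le> B * norm (t - s)"
  proof (rule differentiable_bound[where S = "{a..b}" and f' = "\<lambda>\<tau> h. h *\<^sub>R z \<tau>"])
    show "onorm (\<lambda>h. h *\<^sub>R z \<tau>) \<le> B" if "\<tau> \<in> {a..b}" for \<tau>
      using B[OF that] by (intro onorm_le) (simp add: mult.commute[of B] mult_left_mono)
  qed (use D st in \<open>auto simp: has_vector_derivative_def\<close>)
  then show ?thesis by simp
qed

lemma dq_norm_le:
  fixes y z :: "real \<Rightarrow> 'a::real_normed_vector"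
  assumes D: "\<And>\<tau>. \<tau> \<in> {a..b} \<Longrightarrow> (y has_vector_derivative z \<tau>) (at \<tau> within {a..b})"
    and B: "\<And>\<tau>. \<tau> \<in> {a..b} \<Longrightarrow> norm (z \<tau>) \<le> B"
    and sh: "s \<in> {a..b}" "s + h \<in> {a..b}" "h \<noteq> 0"
  shows "norm (dq h y s) \<le> B"
proof -
  have "norm (y (s + h) - y s) \<le> B * \<bar>s + h - s\<bar>" by (rule vector_diff_le[OF D B sh(1,2)])
  then have "norm (h *\<^sub>R dq h y s) \<le> B * \<bar>h\<bar>" using sh(3) by (simp add: dq_def)
  then show ?thesis using sh(3) by simp
qed

lemma dq_diff: "dq h (\<lambda>s. y s - w s) s = dq h y s - dq h w s"
  and dq_minus: "dq h (\<lambda>s. - y s) s = - dq h y s"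
  by (simp_all add: dq_def algebra_simps)

lemma dq_scaleR_const: "dq h (\<lambda>s. \<alpha> s *\<^sub>R v) s = dq h \<alpha> s *\<^sub>R v" for \<alpha> :: "real \<Rightarrow> real"
  by (simp add: dq_def algebra_simps)

lemma dq_Pair: "dq h (\<lambda>s. (y s, w s)) s = (dq h y s, dq h w s)"
  by (simp add: dq_def)

lemma dq_remainder_le:
  fixes y z :: "real \<Rightarrow> 'a::real_normed_vector"
  assumes D: "\<And>\<tau>. \<tau> \<in> {a..b} \<Longrightarrow> (y has_vector_derivative z \<tau>) (at \<tau> within {a..b})"
    and L: "\<And>\<tau> \<sigma>. \<tau> \<in> {a..b} \<Longrightarrow> \<sigma> \<in> {a..b} \<Longrightarrow> norm (z \<tau> - z \<sigma>) \<le> L * \<bar>\<tau> - \<sigma>\<bar>" and L0: "0 \<le> L"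
    and sh: "s \<in> {a..b}" "s + h \<in> {a..b}" "h \<noteq> 0"
  shows "norm (dq h y s - z s) \<le> L * \<bar>h\<bar>"
proof -
  let ?S = "closed_segment s (s + h)"
  have sub: "?S \<subseteq> {a..b}" using sh by (auto simp: closed_segment_eq_real_ivl split: if_splits)
  have "norm (y (s + h) - y s - ((s + h) - s) *\<^sub>R z s) \<le> norm ((s + h) - s) * (L * \<bar>h\<bar>)"
  proof (rule vector_differentiable_bound_linearization[where S = ?S])
    show "(y has_vector_derivative z x) (at x within ?S)" if "x \<in> ?S" for x
      using has_vector_derivative_within_subset[OF D sub] sub that by blast
    show "norm (z x - z s) \<le> L * \<bar>h\<bar>" if "x \<in> ?S" for x
    proof -
      have "\<bar>x - s\<bar> \<le> \<bar>h\<bar>" using that by (auto simp: closed_segment_eq_real_ivl split: if_splits)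
      then have "L * \<bar>x - s\<bar> \<le> L * \<bar>h\<bar>" using L0 by (rule mult_left_mono)
      moreover have "norm (z x - z s) \<le> L * \<bar>x - s\<bar>" using L sub that sh by blast
      ultimately show ?thesis by linarith
    qed
  qed auto
  then have "norm (h *\<^sub>R (dq h y s - z s)) \<le> \<bar>h\<bar> * (L * \<bar>h\<bar>)"
    using sh by (simp add: dq_def scaleR_diff_right)
  then show ?thesis using sh by simp
qed

lemma at_within_Icc_nontrivial:
  fixes a b t :: real
  assumes "a < b" "a \<le> t" "t \<le> b" shows "at t within {a..b} \<noteq> bot"
proof -
  have "t islimpt {a..b}"
    by (rule islimpt_closure_open[where s = "{a<..<b}"]) (use assms in auto)
  then show ?thesis by (simp add: trivial_limit_within)
qed

lemma norm_quotient_le: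
  assumes "norm w \<le> \<bar>h\<bar> * B" "h \<noteq> 0" shows "norm ((1 / h) *\<^sub>R w) \<le> B"
  using assms by (simp add: field_simps)

lemma norm_fst_bound: "norm (fst x) \<le> norm x" and norm_snd_bound: "norm (snd x) \<le> norm x"
  for x :: "'a::real_normed_vector \<times> 'b::real_normed_vector"
  using norm_fst_le[of "fst x" "snd x"] norm_snd_le[of "snd x" "fst x"] by simp_all

lemma norm_prod_le: "norm (x :: 'a::real_normed_vector \<times> 'b::real_normed_vector) \<le> norm (fst x) + norm (snd x)"
  by (simp add: norm_prod_def sqrt_sum_squares_le_sum)

text \<open>The operator \<open>(P, U) \<mapsto> (U\<^sub>x, P\<^sub>x)\<close> with zero boundary values for \<open>U\<close>. The derivatives change places,
  which is why the two inner products in the energy identity cancel.\<close>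

definition wave_rel :: "l2 \<times> l2 \<Rightarrow> l2 \<times> l2 \<Rightarrow> bool" where
  "wave_rel w w' \<longleftrightarrow> H1rel (fst w) (snd w') \<and> H10rel (snd w) (fst w')"

interpretation wave: skew_evolution wave_rel
proof
  show "inner u w = 0" if "wave_rel u w" for u w
    using that H1rel_H10rel_skew[of "fst u" "snd w" "snd u" "fst w"] by (simp add: wave_rel_def inner_prod_def)
qed (auto simp: wave_rel_def H1rel_diff H10rel_diff H1rel_scale H10rel_scale)

text \<open>A solution as a pair of curves in \<open>l2\<close>, with \<open>q\<close> and \<open>v\<close> the time derivatives of \<open>p\<close> and \<open>u\<close>; \<open>\<alpha> i\<close> and \<open>\<beta> i\<close> are the
  derivatives of order \<open>i\<close> of the two boundary functions. The space derivatives are eliminated by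
  the differential equations, and the boundary conditions are encoded in \<open>u_H1\<close> and \<open>u_trace\<close>.\<close>

locale wave_solution = coefficient +
  fixes T M :: real and \<alpha> \<beta> :: "nat \<Rightarrow> real \<Rightarrow> real" and p u q v :: "real \<Rightarrow> l2"
  assumes T: "T > 0"
    and \<alpha>_deriv: "\<And>i t. i < 4 \<Longrightarrow> t \<in> {0..T} \<Longrightarrow> (\<alpha> i has_real_derivative \<alpha> (Suc i) t) (at t within {0..T})"
    and \<beta>_deriv: "\<And>i t. i < 4 \<Longrightarrow> t \<in> {0..T} \<Longrightarrow> (\<beta> i has_real_derivative \<beta> (Suc i) t) (at t within {0..T})"
    and \<alpha>_bound: "\<And>i t. i \<le> 4 \<Longrightarrow> t \<in> {0..T} \<Longrightarrow> \<bar>\<alpha> i t\<bar> \<le> M"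
    and \<beta>_bound: "\<And>i t. i \<le> 4 \<Longrightarrow> t \<in> {0..T} \<Longrightarrow> \<bar>\<beta> i t\<bar> \<le> M"
    and \<alpha>\<beta>0: "\<alpha> 0 0 = 0" "\<beta> 0 0 = 0" "\<alpha> 1 0 = 0" "\<beta> 1 0 = 0"
    and p_deriv: "\<And>t. t \<in> {0..T} \<Longrightarrow> (p has_vector_derivative q t) (at t within {0..T})"
    and u_deriv: "\<And>t. t \<in> {0..T} \<Longrightarrow> (u has_vector_derivative v t) (at t within {0..T})"
    and q_cont: "continuous_on {0..T} q" and v_cont: "continuous_on {0..T} v"
    and p_H1: "\<And>t. t \<in> {0..T} \<Longrightarrow> H1rel (p t) (- (v t + nem a (u t)))"
    and u_H1: "\<And>t. t \<in> {0..T} \<Longrightarrow> u t = \<alpha> 0 t *\<^sub>R one_l2 + J (- q t)"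
    and u_trace: "\<And>t. t \<in> {0..T} \<Longrightarrow> inner (- q t) one_l2 = \<beta> 0 t - \<alpha> 0 t"
    and q0: "q 0 = 0" and v0: "v 0 = 0"
begin

definition lift :: "nat \<Rightarrow> real \<Rightarrow> l2" where
  "lift i t = \<alpha> i t *\<^sub>R one_l2 + (\<beta> i t - \<alpha> i t) *\<^sub>R J one_l2"

lemma M_nonneg: "0 \<le> M" using \<alpha>_bound[of 0 0] T by simp

lemma norm_J_one: "norm (J one_l2) \<le> 1"
  using norm_ess_bounded[OF ess_bounded_J, of one_l2] norm_one_l2 by simp

lemma \<alpha>_vderiv: "i < 4 \<Longrightarrow> t \<in> {0..T} \<Longrightarrow> (\<alpha> i has_vector_derivative \<alpha> (Suc i) t) (at t within {0..T})"
  using \<alpha>_deriv by (simp add: has_real_derivative_iff_has_vector_derivative)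
lemma \<beta>_vderiv: "i < 4 \<Longrightarrow> t \<in> {0..T} \<Longrightarrow> (\<beta> i has_vector_derivative \<beta> (Suc i) t) (at t within {0..T})"
  using \<beta>_deriv by (simp add: has_real_derivative_iff_has_vector_derivative)

lemma lift_deriv:
  assumes "i < 4" "t \<in> {0..T}"
  shows "(lift i has_vector_derivative lift (Suc i) t) (at t within {0..T})"
proof -
  have "((\<lambda>t. \<beta> i t - \<alpha> i t) has_real_derivative \<beta> (Suc i) t - \<alpha> (Suc i) t) (at t within {0..T})"
    by (intro DERIV_diff \<alpha>_deriv \<beta>_deriv assms)
  from has_vector_derivative_add[OF has_vector_derivative_scaleR[OF \<alpha>_deriv[OF assms] has_vector_derivative_const[of one_l2]]
      has_vector_derivative_scaleR[OF this has_vector_derivative_const[of "J one_l2"]]]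
  show ?thesis unfolding lift_def[abs_def] by simp
qed

lemma norm_lift:
  assumes "i \<le> 4" "t \<in> {0..T}" shows "norm (lift i t) \<le> 3 * M"
proof -
  have "norm (lift i t) \<le> \<bar>\<alpha> i t\<bar> * norm one_l2 + \<bar>\<beta> i t - \<alpha> i t\<bar> * norm (J one_l2)"
    unfolding lift_def by (rule norm_triangle_le) simp
  also have "\<dots> \<le> M * 1 + (M + M) * 1"
    using \<alpha>_bound[OF assms] \<beta>_bound[OF assms] norm_one_l2 norm_J_one M_nonneg by (intro add_mono mult_mono) auto
  finally show ?thesis by simp
qed

lemma lift_0: "lift 0 0 = 0" "lift 1 0 = 0"
  by (simp_all add: lift_def \<alpha>\<beta>0 \<alpha>\<beta>0[simplified])

lemma u_diff: 
  assumes "s \<in> {0..T}" "t \<in> {0..T}"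
  shows "u s - u t = (\<alpha> 0 s - \<alpha> 0 t) *\<^sub>R one_l2 + J (q t - q s)"
proof -
  have "J (- q s) - J (- q t) = J (q t - q s)"
    using linear_diff[OF bounded_linear.linear[OF bounded_linear_J], of "- q s" "- q t"] by simp
  then show ?thesis using u_H1[OF assms(1)] u_H1[OF assms(2)] by (simp add: algebra_simps)
qed

text \<open>The supremum of \<open>u\<close> is controlled by \<open>u\<^sub>x = - q\<close> and the left boundary value. This is
  what makes the superposition operator differentiable along \<open>u\<close>.\<close>

lemma u_diff_bounded:
  assumes "s \<in> {0..T}" "t \<in> {0..T}"
  shows "ess_bounded (\<bar>\<alpha> 0 s - \<alpha> 0 t\<bar> + norm (q s - q t)) (u s - u t)"
  unfolding u_diff[OF assms]
  using ess_bounded_add[OF ess_bounded_scale[OF ess_bounded_one, of "\<alpha> 0 s - \<alpha> 0 t"] ess_bounded_J[of "q t - q s"]]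
  by (simp add: norm_minus_commute)

lemma \<alpha>_cont: "i < 4 \<Longrightarrow> continuous_on {0..T} (\<alpha> i)" 
  using \<alpha>_deriv DERIV_continuous unfolding continuous_on_eq_continuous_within by blast

lemma u_diff_bound_tendsto:
  assumes "t \<in> {0..T}"
  shows "((\<lambda>s. \<bar>\<alpha> 0 s - \<alpha> 0 t\<bar> + norm (q s - q t)) \<longlongrightarrow> 0) (at t within {0..T})"
proof -
  have "((\<lambda>s. \<bar>\<alpha> 0 s - \<alpha> 0 t\<bar> + norm (q s - q t)) \<longlongrightarrow> \<bar>\<alpha> 0 t - \<alpha> 0 t\<bar> + norm (q t - q t)) (at t within {0..T})"
    using \<alpha>_cont[of 0] q_cont assms unfolding continuous_on_def by (intro tendsto_intros) auto
  then show ?thesis by simp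
qed

text \<open>The unknown with homogeneous boundary values, its time derivative, the source and the derivative
  of the source.\<close>

definition Y where "Y t = (p t, u t - lift 0 t)"
definition Z where "Z t = (q t, v t - lift 1 t)"
definition F where "F t = ((\<alpha> 0 t - \<beta> 0 t) *\<^sub>R one_l2, - nem a (u t) - lift 1 t)"
definition F' where "F' t = ((\<alpha> 1 t - \<beta> 1 t) *\<^sub>R one_l2, - dnem (u t) (v t) - lift 2 t)"

lemma nem_u_deriv:
  assumes t: "t \<in> {0..T}"
  shows "((\<lambda>s. nem a (u s)) has_vector_derivative dnem (u t) (v t)) (at t within {0..T})"
  by (rule nem_has_vector_derivative[OF u_deriv[OF t] u_diff_bounded u_diff_bound_tendsto[OF t]]) (use t in auto)

lemma dnem_continuous: "continuous_on {0..T} (\<lambda>t. dnem (u t) (v t))"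
  unfolding continuous_on_def
proof
  fix t assume t: "t \<in> {0..T}"
  show "((\<lambda>t. dnem (u t) (v t)) \<longlongrightarrow> dnem (u t) (v t)) (at t within {0..T})"
    by (rule dnem_tendsto[OF _ u_diff_bounded u_diff_bound_tendsto[OF t]])
      (use t v_cont in \<open>auto simp: continuous_on_def\<close>)
qed

lemma solution: "wave.solution_on 0 T Y Z F F'"
  unfolding wave.solution_on_def
proof (intro conjI ballI)
  fix t assume t: "t \<in> {0..T}"
  show "(Y has_vector_derivative Z t) (at t within {0..T})"
    unfolding Y_def[abs_def] Z_def using lift_deriv[of 0 t] t
    by (intro has_vector_derivative_Pair has_vector_derivative_diff p_deriv u_deriv) auto
  note nd = nem_u_deriv[OF t]
  have "((\<lambda>t. \<alpha> 0 t - \<beta> 0 t) has_real_derivative \<alpha> 1 t - \<beta> 1 t) (at t within {0..T})"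
    using \<alpha>_deriv[of 0 t] \<beta>_deriv[of 0 t] t by (intro DERIV_diff) auto
  from has_vector_derivative_scaleR[OF this has_vector_derivative_const[of one_l2]]
  have 1: "((\<lambda>t. (\<alpha> 0 t - \<beta> 0 t) *\<^sub>R one_l2) has_vector_derivative (\<alpha> 1 t - \<beta> 1 t) *\<^sub>R one_l2) (at t within {0..T})" by simp
  have 2: "(lift 1 has_vector_derivative lift 2 t) (at t within {0..T})" using lift_deriv[of 1 t] t by (simp add: numeral_2_eq_2)
  show "(F has_vector_derivative F' t) (at t within {0..T})"
    unfolding F_def[abs_def] F'_def
    by (intro has_vector_derivative_Pair 1 has_vector_derivative_diff has_vector_derivative_minus nd 2)
  have "H10rel (u t - lift 0 t) (- q t - (\<beta> 0 t - \<alpha> 0 t) *\<^sub>R one_l2)"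
    unfolding lift_def by (rule H10rel_lift[OF u_H1[OF t] u_trace[OF t]])
  moreover have "(\<alpha> 0 t - \<beta> 0 t) *\<^sub>R one_l2 - q t = - q t - (\<beta> 0 t - \<alpha> 0 t) *\<^sub>R one_l2" by (simp add: algebra_simps)
  moreover have e: "- nem a (u t) - lift 1 t - (v t - lift 1 t) = - (v t + nem a (u t))" by simp
  ultimately show "wave_rel (Y t) (F t - Z t)"
    unfolding wave_rel_def Y_def F_def Z_def fst_conv snd_conv diff_Pair e using p_H1[OF t] by metis
next
  have lc: "continuous_on {0..T} (lift i)" if "i < 4" for i
    using lift_deriv[OF that] has_vector_derivative_continuous unfolding continuous_on_eq_continuous_within by blast
  show "continuous_on {0..T} Z"
    unfolding Z_def[abs_def] by (intro continuous_intros q_cont v_cont lc) simp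
  have \<beta>c: "continuous_on {0..T} (\<beta> i)" if "i < 4" for i
    using \<beta>_deriv[OF that] DERIV_continuous unfolding continuous_on_eq_continuous_within by blast
  show "continuous_on {0..T} F'"
    unfolding F'_def[abs_def] by (intro continuous_intros dnem_continuous lc \<alpha>_cont \<beta>c) simp_all
qed

lemma Z_0: "Z 0 = 0" by (simp add: Z_def q0 v0 lift_0[simplified] zero_prod_def)

text \<open>\<open>K1\<close> bounds the first time derivatives of the lifted unknown and \<open>V\<close> bounds \<open>v\<close>; \<open>K2\<close> bounds the difference
  quotients of the first derivatives. They depend only on the bounds for the data and on \<open>T\<close>.\<close>

definition "K1 = exp (k1 * T) * ((5 * M + 3 * k1 * M) * T)"
definition "V = K1 + 3 * M"
definition "\<beta>2 = k1 + k2 * V"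
definition "\<alpha>2 = 5 * M + 3 * k1 * M + k2 * M * V"
definition "K2 = exp (\<beta>2 * T) * (exp (k1 * T) * (5 * M + 3 * k1 * M) + \<alpha>2 * T)"

lemma const_nonneg: "0 \<le> K1" "0 \<le> V" "0 \<le> \<beta>2" "0 \<le> \<alpha>2" "0 \<le> K2"
proof -
  show "0 \<le> K1" unfolding K1_def using M_nonneg k_nonneg T by (intro mult_nonneg_nonneg add_nonneg_nonneg) auto
  then show V: "0 \<le> V" unfolding V_def using M_nonneg by simp
  show "0 \<le> \<beta>2" unfolding \<beta>2_def using k_nonneg V by simp
  show "0 \<le> \<alpha>2" unfolding \<alpha>2_def using k_nonneg V M_nonneg by simp
  then show "0 \<le> K2" unfolding K2_def using M_nonneg k_nonneg T by (intro mult_nonneg_nonneg add_nonneg_nonneg) auto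
qed

lemma snd_Z_bound: "norm (v t) \<le> norm (Z t) + 3 * M" if "t \<in> {0..T}"
proof -
  have "v t = snd (Z t) + lift 1 t" by (simp add: Z_def)
  then show ?thesis using norm_triangle_ineq[of "snd (Z t)" "lift 1 t"] norm_lift[of 1 t] that norm_snd_bound[of "Z t"] by simp
qed

text \<open>The factor \<open>t\<close>, which comes from \<open>Z 0 = 0\<close>, bounds the difference quotient of \<open>Z\<close> at the initial time
  in the next estimate.\<close>

lemma Z_bound_t:
  assumes t: "t \<in> {0..T}"
  shows "norm (Z t) \<le> exp (k1 * T) * ((5 * M + 3 * k1 * M) * t)"
proof -
  have "wave.solution_on 0 t Y Z F F'" by (rule wave.solution_on_subset[OF solution]) (use t in auto)
  then have "norm (Z t) \<le> exp (k1 * (t - 0)) * (norm (Z 0) + (5 * M + 3 * k1 * M) * (t - 0))"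
  proof (rule wave.derivative_estimate)
    fix s assume "s \<in> {0..t}"
    then have s: "s \<in> {0..T}" using t by auto
    have "norm (F' s) \<le> norm ((\<alpha> 1 s - \<beta> 1 s) *\<^sub>R one_l2) + norm (- dnem (u s) (v s) - lift 2 s)"
      using norm_prod_le[of "F' s"] by (simp add: F'_def)
    also have "norm ((\<alpha> 1 s - \<beta> 1 s) *\<^sub>R one_l2) \<le> (M + M) * 1"
      using \<alpha>_bound[of 1 s] \<beta>_bound[of 1 s] s norm_one_l2 M_nonneg unfolding norm_scaleR by (intro mult_mono) auto
    also have "norm (- dnem (u s) (v s) - lift 2 s) \<le> norm (dnem (u s) (v s)) + norm (lift 2 s)"
      using norm_triangle_ineq4[of "- dnem (u s) (v s)" "lift 2 s"] by simp
    also have "norm (dnem (u s) (v s)) \<le> k1 * (norm (Z s) + 3 * M)"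
      using norm_dnem[of "u s" "v s"] mult_left_mono[OF snd_Z_bound[OF s] k_nonneg(1)] by linarith
    also have "norm (lift 2 s) \<le> 3 * M" using norm_lift[of 2 s] s by simp
    finally show "norm (F' s) \<le> (5 * M + 3 * k1 * M) + k1 * norm (Z s)" by (simp add: algebra_simps)
  qed (use t M_nonneg k_nonneg in auto)
  also have "\<dots> \<le> exp (k1 * T) * ((5 * M + 3 * k1 * M) * t)"
    using t M_nonneg k_nonneg unfolding Z_0 by (simp add: mult_left_mono mult_right_mono)
  finally show ?thesis .
qed

lemma Z_bound: "t \<in> {0..T} \<Longrightarrow> norm (Z t) \<le> K1"
  unfolding K1_def using M_nonneg k_nonneg T
  by (intro order_trans[OF Z_bound_t]) (auto intro!: mult_left_mono)

lemma v_bound: "t \<in> {0..T} \<Longrightarrow> norm (v t) \<le> V"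
  using snd_Z_bound Z_bound unfolding V_def by fastforce

lemma dq_\<alpha>_bound:
  assumes "i < 4" "s \<in> {0..T}" "s + h \<in> {0..T}" "h \<noteq> 0"
  shows "\<bar>dq h (\<alpha> i) s\<bar> \<le> M" "\<bar>dq h (\<beta> i) s\<bar> \<le> M" "norm (dq h (lift i) s) \<le> 3 * M"
  using dq_norm_le[OF \<alpha>_vderiv[OF assms(1)] _ assms(2-4), of M] \<alpha>_bound[of "Suc i"] assms(1)
    dq_norm_le[OF \<beta>_vderiv[OF assms(1)] _ assms(2-4), of M] \<beta>_bound[of "Suc i"]
    dq_norm_le[OF lift_deriv[OF assms(1)] _ assms(2-4), of "3 * M"] norm_lift[of "Suc i"] by auto

lemma dq_u_bounded:
  assumes "s \<in> {0..T}" "s + h \<in> {0..T}" "h \<noteq> 0"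
  shows "ess_bounded (M + norm (dq h Z s)) (dq h u s)"
proof -
  have "ess_bounded (\<bar>1 / h\<bar> * (\<bar>\<alpha> 0 (s + h) - \<alpha> 0 s\<bar> + norm (q (s + h) - q s))) (dq h u s)"
    unfolding dq_def by (rule ess_bounded_scale[OF u_diff_bounded[OF assms(2,1)]])
  moreover have "\<bar>1 / h\<bar> * (\<bar>\<alpha> 0 (s + h) - \<alpha> 0 s\<bar> + norm (q (s + h) - q s)) = \<bar>dq h (\<alpha> 0) s\<bar> + norm (dq h q s)"
    by (simp add: dq_def abs_mult distrib_left)
  moreover have "norm (dq h q s) \<le> norm (dq h Z s)"
    using norm_fst_bound[of "dq h Z s"] unfolding Z_def[abs_def] dq_Pair by simp
  ultimately show ?thesis using dq_\<alpha>_bound(1)[of 0 s h] assms by (auto elim!: ess_bounded_mono)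
qed

lemma dq_v_eq: "dq h v s = snd (dq h Z s) + dq h (lift 1) s"
  unfolding Z_def[abs_def] dq_Pair by (simp add: dq_diff)

lemma dq_F': "dq h F' s = ((dq h (\<alpha> 1) s - dq h (\<beta> 1) s) *\<^sub>R one_l2,
   - (dnem (u s) (dq h v s) + (1 / h) *\<^sub>R (dnem (u (s + h)) (v (s + h)) - dnem (u s) (v (s + h)))) - dq h (lift 2) s)"
proof -
  have "dq h (\<lambda>s. dnem (u s) (v s)) s = dnem (u s) (dq h v s) + (1 / h) *\<^sub>R (dnem (u (s + h)) (v (s + h)) - dnem (u s) (v (s + h)))"
    by (simp add: dq_def dnem_scale dnem_diff flip: scaleR_add_right)
  then show ?thesis
    unfolding F'_def[abs_def] dq_Pair dq_scaleR_const dq_diff dq_minus by simp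
qed

text \<open>The difference quotient of \<open>a'(u) v\<close> splits into \<open>a'(u)\<close> times the quotient of \<open>v\<close> and the quotient
  of \<open>a'(u)\<close> times \<open>v\<close>. In the second product the first factor is bounded in the supremum norm by
  \<open>k2 (M + \<parallel>dq h Z s\<parallel>)\<close> and \<open>v\<close> is bounded in $L^2$ by \<open>V\<close>, so that the estimate is linear in \<open>\<parallel>dq h Z s\<parallel>\<close>.\<close>

lemma dq_Z_bound:
  assumes h: "h > 0" and t: "t \<in> {0..T - h}"
  shows "norm (dq h Z t) \<le> K2"
proof -
  have hT: "h \<le> T" using t by auto
  have "wave.solution_on 0 t (dq h Y) (dq h Z) (dq h F) (dq h F')"
    by (rule wave.solution_on_dq[OF solution]) (use h t in auto)
  then have "norm (dq h Z t) \<le> exp (\<beta>2 * (t - 0)) * (norm (dq h Z 0) + \<alpha>2 * (t - 0))"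
  proof (rule wave.derivative_estimate)
    fix s assume s0: "s \<in> {0..t}"
    then have s: "s \<in> {0..T}" "s + h \<in> {0..T}" "h \<noteq> 0" using t h by auto
    have "norm (dq h F' s) \<le> norm ((dq h (\<alpha> 1) s - dq h (\<beta> 1) s) *\<^sub>R one_l2) + 
      norm (- (dnem (u s) (dq h v s) + (1 / h) *\<^sub>R (dnem (u (s + h)) (v (s + h)) - dnem (u s) (v (s + h)))) - dq h (lift 2) s)"
      using norm_prod_le[of "dq h F' s"] by (simp add: dq_F')
    also have "norm ((dq h (\<alpha> 1) s - dq h (\<beta> 1) s) *\<^sub>R one_l2) \<le> (M + M) * 1"
      using dq_\<alpha>_bound(1,2)[of 1 s h] s norm_one_l2 M_nonneg unfolding norm_scaleR by (intro mult_mono) auto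
    also have "norm (- (dnem (u s) (dq h v s) + (1 / h) *\<^sub>R (dnem (u (s + h)) (v (s + h)) - dnem (u s) (v (s + h)))) - dq h (lift 2) s)
       \<le> (norm (dnem (u s) (dq h v s)) + norm ((1 / h) *\<^sub>R (dnem (u (s + h)) (v (s + h)) - dnem (u s) (v (s + h))))) + norm (dq h (lift 2) s)"
      by (rule order_trans[OF norm_triangle_ineq4]) (simp only: norm_minus_cancel, intro add_right_mono norm_triangle_ineq)
    also have "norm (dnem (u s) (dq h v s)) \<le> k1 * (norm (dq h Z s) + 3 * M)"
    proof -
      have "norm (dq h v s) \<le> norm (dq h Z s) + 3 * M"
        unfolding dq_v_eq using dq_\<alpha>_bound(3)[of 1 s h] s norm_snd_bound[of "dq h Z s"]
          norm_triangle_ineq[of "snd (dq h Z s)" "dq h (lift 1) s"] by simp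
      then show ?thesis using norm_dnem[of "u s" "dq h v s"] mult_left_mono[OF _ k_nonneg(1)] by (meson order_trans)
    qed
    also have "norm ((1 / h) *\<^sub>R (dnem (u (s + h)) (v (s + h)) - dnem (u s) (v (s + h)))) \<le> k2 * (M + norm (dq h Z s)) * V"
    proof -
      have b: "ess_bounded (\<bar>h\<bar> * (M + norm (dq h Z s))) (u (s + h) - u s)"
        using ess_bounded_scale[OF dq_u_bounded[OF s], of h] s(3) by (simp add: dq_def)
      have "norm (dnem (u (s + h)) (v (s + h)) - dnem (u s) (v (s + h))) \<le> k2 * (\<bar>h\<bar> * (M + norm (dq h Z s))) * norm (v (s + h))"
        by (rule dnem_Lip[OF b])
      also have "\<dots> \<le> k2 * (\<bar>h\<bar> * (M + norm (dq h Z s))) * V"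
        using v_bound[OF s(2)] k_nonneg M_nonneg by (intro mult_left_mono mult_nonneg_nonneg) auto
      also have "\<dots> = \<bar>h\<bar> * (k2 * (M + norm (dq h Z s)) * V)" by simp
      finally show ?thesis using s(3) by (rule norm_quotient_le)
    qed
    also have "norm (dq h (lift 2) s) \<le> 3 * M" using dq_\<alpha>_bound(3)[of 2 s h] s by simp
    finally show "norm (dq h F' s) \<le> \<alpha>2 + \<beta>2 * norm (dq h Z s)"
      by (simp add: \<alpha>2_def \<beta>2_def algebra_simps)
  qed (use t const_nonneg in auto)
  also have "\<dots> \<le> K2"
    unfolding K2_def
  proof (rule mult_mono)
    show "exp (\<beta>2 * (t - 0)) \<le> exp (\<beta>2 * T)" using t h const_nonneg by (simp add: mult_left_mono)
    have "norm (dq h Z 0) = (1 / h) * norm (Z h)" using h by (simp add: dq_def Z_0)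
    also have "\<dots> \<le> (1 / h) * (exp (k1 * T) * ((5 * M + 3 * k1 * M) * h))"
      using Z_bound_t[of h] h hT by (intro mult_left_mono) auto
    also have "\<dots> = exp (k1 * T) * (5 * M + 3 * k1 * M)" using h by simp
    finally show "norm (dq h Z 0) + \<alpha>2 * (t - 0) \<le> exp (k1 * T) * (5 * M + 3 * k1 * M) + \<alpha>2 * T"
      using t h const_nonneg by (intro add_mono mult_left_mono) auto
  qed (use t const_nonneg in auto)
  finally show ?thesis .
qed

lemma dq_Z_bound':
  assumes "s \<in> {0..T}" "s + h \<in> {0..T}" "h \<noteq> 0"
  shows "norm (dq h Z s) \<le> K2"
proof (cases "h > 0")
  case True then show ?thesis using assms by (intro dq_Z_bound) auto
next
  case False
  have "dq h Z s = dq (- h) Z (s + h)" by (simp add: dq_def algebra_simps)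
  then show ?thesis using dq_Z_bound[of "- h" "s + h"] False assms by auto
qed

lemma Z_Lip: "s \<in> {0..T} \<Longrightarrow> t \<in> {0..T} \<Longrightarrow> norm (Z s - Z t) \<le> K2 * \<bar>s - t\<bar>"
proof (cases "s = t")
  case False
  assume "s \<in> {0..T}" "t \<in> {0..T}"
  then have "norm (dq (s - t) Z t) \<le> K2" using False by (intro dq_Z_bound') auto
  then have "norm ((s - t) *\<^sub>R dq (s - t) Z t) \<le> \<bar>s - t\<bar> * K2" by (simp add: mult_left_mono)
  moreover have "(s - t) *\<^sub>R dq (s - t) Z t = Z s - Z t" using False by (simp add: dq_def)
  ultimately show ?thesis by (simp add: mult.commute)
qed simp

lemma lift_Lip: "i < 4 \<Longrightarrow> s \<in> {0..T} \<Longrightarrow> t \<in> {0..T} \<Longrightarrow> norm (lift i s - lift i t) \<le> 3 * M * \<bar>s - t\<bar>"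
  using vector_diff_le[OF lift_deriv, of i "3 * M" t s] norm_lift[of "Suc i"] by simp

definition "W = K2 + 3 * M"

lemma W_nonneg: "0 \<le> W" using const_nonneg M_nonneg by (simp add: W_def)

lemma v_Lip: 
  assumes "s \<in> {0..T}" "t \<in> {0..T}" shows "norm (v s - v t) \<le> W * \<bar>s - t\<bar>"
proof -
  have "v s - v t = snd (Z s - Z t) + (lift 1 s - lift 1 t)" by (simp add: Z_def)
  then have "norm (v s - v t) \<le> norm (Z s - Z t) + norm (lift 1 s - lift 1 t)"
    using norm_triangle_ineq[of "snd (Z s - Z t)" "lift 1 s - lift 1 t"] norm_snd_bound[of "Z s - Z t"] by simp
  then show ?thesis using Z_Lip[OF assms] lift_Lip[of 1, OF _ assms] by (simp add: W_def algebra_simps)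
qed

definition "K = M + K2"

lemma dq_u_K: "s \<in> {0..T} \<Longrightarrow> s + h \<in> {0..T} \<Longrightarrow> h \<noteq> 0 \<Longrightarrow> ess_bounded K (dq h u s)"
  using ess_bounded_mono[OF dq_u_bounded] dq_Z_bound' unfolding K_def by simp

text \<open>Inherited from the difference quotients of \<open>u\<close>, whose bound is uniform in the step.\<close>

lemma v_K: 
  assumes s: "s \<in> {0..T}" shows "ess_bounded K (v s)"
proof (rule ess_bounded_limit)
  show "((\<lambda>y. (1 / (y - s)) *\<^sub>R (u y - u s)) \<longlongrightarrow> v s) (at s within {0..T})"
    using u_deriv[OF s] unfolding has_vector_derivative_iff_quotient by (simp add: tendsto_norm_zero_iff LIM_zero_iff)
  have "ess_bounded K ((1 / (y - s)) *\<^sub>R (u y - u s))" if "y \<in> {0..T}" "y \<noteq> s" for y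
    using dq_u_K[of s "y - s"] that s by (simp add: dq_def)
  then show "\<forall>\<^sub>F y in at s within {0..T}. ess_bounded K ((1 / (y - s)) *\<^sub>R (u y - u s))"
    by (auto simp: eventually_at_filter)
  show "at s within {0..T} \<noteq> bot" using T s by (simp add: at_within_Icc_nontrivial)
qed

definition "C3 = 2 * M + 3 * k1 * M + 3 * M + (2 * k2 * K * W + k3 * K\<^sup>2 * V)"

lemma C3_nonneg: "0 \<le> C3"
  unfolding C3_def using M_nonneg k_nonneg const_nonneg W_nonneg by (simp add: K_def)

lemma K_nonneg: "0 \<le> K" using const_nonneg M_nonneg by (simp add: K_def)

lemma remainder_bound:
  assumes s: "s \<in> {0..T}" "s + h \<in> {0..T}" "h \<noteq> 0"
  shows "norm ((1 / h) *\<^sub>R (dnem (u (s + h)) (v (s + h)) - dnem (u s) (v (s + h))) - d2nem (u s) (v s))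
     \<le> (2 * k2 * K * W + k3 * K\<^sup>2 * V) * \<bar>h\<bar>"
proof -
  have "norm ((1 / h) *\<^sub>R (dnem (u (s + h)) (v (s + h)) - dnem (u s) (v (s + h))) - d2nem (u s) (v s))
     \<le> k2 * K * norm (v (s + h) - v s) + k3 * \<bar>h\<bar> * K\<^sup>2 * norm (v s) + k2 * K * norm ((1 / h) *\<^sub>R (u (s + h) - u s) - v s)"
    by (rule dnem_dq[OF s(3) dq_u_K[OF s, unfolded dq_def] v_K[OF s(1)]])
  also have "\<dots> \<le> k2 * K * (W * \<bar>h\<bar>) + k3 * \<bar>h\<bar> * K\<^sup>2 * V + k2 * K * (W * \<bar>h\<bar>)"
  proof (intro add_mono mult_left_mono)
    show "norm (v (s + h) - v s) \<le> W * \<bar>h\<bar>" using v_Lip[OF s(2,1)] by simp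
    show "norm (v s) \<le> V" using v_bound[OF s(1)] .
    show "norm ((1 / h) *\<^sub>R (u (s + h) - u s) - v s) \<le> W * \<bar>h\<bar>"
      using dq_remainder_le[OF u_deriv v_Lip W_nonneg s] by (simp add: dq_def)
  qed (use k_nonneg K_nonneg in auto)
  finally show ?thesis by (simp add: algebra_simps)
qed

text \<open>The quotients of the lift converge at rate \<open>\<bar>h\<bar>\<close> because the boundary functions have one
  more bounded derivative; the quadratic term does so by \<open>dnem_dq\<close>, now that \<open>v\<close> is bounded and
  Lipschitz continuous in time. What remains is \<open>a'(u)\<close> applied to the difference of the quotients of \<open>Z\<close>.\<close>

lemma dq_F'_Cauchy:
  assumes s: "s \<in> {0..T}" "h \<noteq> 0" "k \<noteq> 0" "s + h \<in> {0..T}" "s + k \<in> {0..T}"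
  shows "norm (dq h F' s - dq k F' s) \<le> C3 * (\<bar>h\<bar> + \<bar>k\<bar>) + k1 * norm (dq h Z s - dq k Z s)"
proof -
  define R where "R h = (1 / h) *\<^sub>R (dnem (u (s + h)) (v (s + h)) - dnem (u s) (v (s + h))) - d2nem (u s) (v s)" for h
  have lin: "norm (dq h y s - dq k y s) \<le> L * (\<bar>h\<bar> + \<bar>k\<bar>)"
    if "norm (dq h y s - w) \<le> L * \<bar>h\<bar>" "norm (dq k y s - w) \<le> L * \<bar>k\<bar>" for y w and L
    using norm_triangle_ineq4[of "dq h y s - w" "dq k y s - w"] that by (simp add: distrib_left)
  have la: "norm (dq h (\<lambda>s. (\<alpha> 1 s - \<beta> 1 s) *\<^sub>R one_l2) s - dq k (\<lambda>s. (\<alpha> 1 s - \<beta> 1 s) *\<^sub>R one_l2) s) \<le> 2 * M * (\<bar>h\<bar> + \<bar>k\<bar>)"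
  proof -
    have D: "((\<lambda>s. (\<alpha> i s - \<beta> i s) *\<^sub>R one_l2) has_vector_derivative (\<alpha> (Suc i) t - \<beta> (Suc i) t) *\<^sub>R one_l2) (at t within {0..T})"
      if "i < 4" "t \<in> {0..T}" for i t
      using has_vector_derivative_scaleR[OF DERIV_diff[OF \<alpha>_deriv[OF that] \<beta>_deriv[OF that]] has_vector_derivative_const[of one_l2]] by simp
    have B: "norm ((\<alpha> i t - \<beta> i t) *\<^sub>R one_l2) \<le> 2 * M" if "i \<le> 4" "t \<in> {0..T}" for i t
    proof -
      have "\<bar>\<alpha> i t - \<beta> i t\<bar> * norm one_l2 \<le> (2 * M) * 1"
        using \<alpha>_bound[OF that] \<beta>_bound[OF that] norm_one_l2 M_nonneg by (intro mult_mono) auto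
      then show ?thesis by simp
    qed
    have L: "norm ((\<alpha> 2 \<tau> - \<beta> 2 \<tau>) *\<^sub>R one_l2 - (\<alpha> 2 \<sigma> - \<beta> 2 \<sigma>) *\<^sub>R one_l2) \<le> 2 * M * \<bar>\<tau> - \<sigma>\<bar>" if "\<tau> \<in> {0..T}" "\<sigma> \<in> {0..T}" for \<tau> \<sigma>
      by (rule vector_diff_le[OF D[of 2] B that(2,1)]) auto
    have D1: "((\<lambda>s. (\<alpha> 1 s - \<beta> 1 s) *\<^sub>R one_l2) has_vector_derivative (\<alpha> 2 t - \<beta> 2 t) *\<^sub>R one_l2) (at t within {0..T})"
      if "t \<in> {0..T}" for t using D[of 1 t] that by (simp add: numeral_2_eq_2)
    show ?thesis
      by (rule lin; rule dq_remainder_le[OF D1 L]) (use s M_nonneg in auto)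
  qed
  have ll: "norm (dq h (lift i) s - dq k (lift i) s) \<le> 3 * M * (\<bar>h\<bar> + \<bar>k\<bar>)" if "Suc i < 4" for i
    by (rule lin; rule dq_remainder_le[OF lift_deriv lift_Lip]) (use s M_nonneg that in auto)
  have eq1: "fst (dq h F' s - dq k F' s) = dq h (\<lambda>s. (\<alpha> 1 s - \<beta> 1 s) *\<^sub>R one_l2) s - dq k (\<lambda>s. (\<alpha> 1 s - \<beta> 1 s) *\<^sub>R one_l2) s"
    by (simp add: dq_F' dq_scaleR_const dq_diff)
  have eq2: "snd (dq h F' s - dq k F' s) = - dnem (u s) (snd (dq h Z s - dq k Z s)) - dnem (u s) (dq h (lift 1) s - dq k (lift 1) s)
     - (R h - R k) - (dq h (lift 2) s - dq k (lift 2) s)"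
  proof -
    have "dnem (u s) (dq h v s) - dnem (u s) (dq k v s) = dnem (u s) (snd (dq h Z s - dq k Z s) + (dq h (lift 1) s - dq k (lift 1) s))"
      unfolding dnem_diff[symmetric] dq_v_eq by (simp add: algebra_simps)
    also have "\<dots> = dnem (u s) (snd (dq h Z s - dq k Z s)) + dnem (u s) (dq h (lift 1) s - dq k (lift 1) s)"
      by (rule linear_add[OF bounded_linear.linear[OF bounded_linear_dnem]])
    finally have e: "dnem (u s) (dq h v s) = dnem (u s) (dq k v s) + (dnem (u s) (snd (dq h Z s - dq k Z s)) + dnem (u s) (dq h (lift 1) s - dq k (lift 1) s))"
      by (simp add: algebra_simps)
    have Rh: "(1 / h) *\<^sub>R (dnem (u (s + h)) (v (s + h)) - dnem (u s) (v (s + h))) = R h + d2nem (u s) (v s)" for h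
      by (simp add: R_def)
    show ?thesis unfolding dq_F' snd_diff snd_conv Rh e by simp
  qed
  have "norm (dq h F' s - dq k F' s) \<le> norm (fst (dq h F' s - dq k F' s)) + norm (snd (dq h F' s - dq k F' s))"
    by (rule norm_prod_le)
  also have "norm (fst (dq h F' s - dq k F' s)) \<le> 2 * M * (\<bar>h\<bar> + \<bar>k\<bar>)" unfolding eq1 by (rule la)
  also have "norm (snd (dq h F' s - dq k F' s)) \<le> norm (dnem (u s) (snd (dq h Z s - dq k Z s))) + norm (dnem (u s) (dq h (lift 1) s - dq k (lift 1) s))
     + (norm (R h) + norm (R k)) + norm (dq h (lift 2) s - dq k (lift 2) s)"
  proof -
    have "norm (- x - y - (r - r') - z) \<le> norm x + norm y + (norm r + norm r') + norm z" for x y r r' z :: l2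
      using norm_triangle_ineq4[of "- x - y - (r - r')" z] norm_triangle_ineq4[of "- x - y" "r - r'"]
        norm_triangle_ineq4[of r r'] norm_triangle_ineq4[of "- x" y] by simp
    then show ?thesis unfolding eq2 .
  qed
  also have "norm (dnem (u s) (snd (dq h Z s - dq k Z s))) \<le> k1 * norm (dq h Z s - dq k Z s)"
    using norm_dnem[of "u s" "snd (dq h Z s - dq k Z s)"] mult_left_mono[OF norm_snd_bound[of "dq h Z s - dq k Z s"] k_nonneg(1)] by linarith
  also have "norm (dnem (u s) (dq h (lift 1) s - dq k (lift 1) s)) \<le> k1 * (3 * M * (\<bar>h\<bar> + \<bar>k\<bar>))"
    using norm_dnem[of "u s" "dq h (lift 1) s - dq k (lift 1) s"] mult_left_mono[OF ll[of 1] k_nonneg(1)] by linarith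
  also have "norm (R h) \<le> (2 * k2 * K * W + k3 * K\<^sup>2 * V) * \<bar>h\<bar>" unfolding R_def by (rule remainder_bound) (use s in auto)
  also have "norm (R k) \<le> (2 * k2 * K * W + k3 * K\<^sup>2 * V) * \<bar>k\<bar>" unfolding R_def by (rule remainder_bound) (use s in auto)
  also have "norm (dq h (lift 2) s - dq k (lift 2) s) \<le> 3 * M * (\<bar>h\<bar> + \<bar>k\<bar>)" by (rule ll) simp
  finally show ?thesis by (simp add: C3_def algebra_simps)
qed

text \<open>At time 0 the source derivative is minus the second derivative of the lift, an affine
  function of \<open>x\<close> with boundary values \<open>- \<alpha> 2 0\<close> and \<open>- \<beta> 2 0\<close>, in general nonzero.\<close>

lemma dense_at_F'0:
  assumes e: "e > 0" shows "\<exists>\<phi> \<psi>. wave_rel \<phi> \<psi> \<and> norm (\<phi> - F' 0) < e"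
proof -
  have F0: "F' 0 = (0, - lift 2 0)"
    using linear_0[OF bounded_linear.linear[OF bounded_linear_dnem]] by (simp add: F'_def \<alpha>\<beta>0[simplified] v0)
  obtain \<phi> w where \<phi>: "H10rel \<phi> w" "norm (\<phi> - ((- \<alpha> 2 0) *\<^sub>R one_l2 + (\<alpha> 2 0 - \<beta> 2 0) *\<^sub>R J one_l2)) < e"
    using affine_approx_H10[OF e] by blast
  have "(- \<alpha> 2 0) *\<^sub>R one_l2 + (\<alpha> 2 0 - \<beta> 2 0) *\<^sub>R J one_l2 = - lift 2 0"
    by (simp add: lift_def algebra_simps)
  then have n: "norm (\<phi> + lift 2 0) < e" using \<phi>(2) by (simp only: diff_minus_eq_add)
  have "H1rel 0 0" unfolding H1rel_def
    using linear_0[OF bounded_linear.linear[OF bounded_linear_J]] by (intro exI[of _ 0]) simp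
  then have "wave_rel (0, \<phi>) (w, 0)" using \<phi>(1) by (simp add: wave_rel_def)
  moreover have "norm ((0, \<phi>) - F' 0) < e" using n by (simp add: F0 norm_prod_def)
  ultimately show ?thesis by blast
qed

theorem second_derivatives:
  obtains r \<rho> where "continuous_on {0..T} r" "continuous_on {0..T} \<rho>"
    "\<And>t. t \<in> {0..T} \<Longrightarrow> (q has_vector_derivative r t) (at t within {0..T})"
    "\<And>t. t \<in> {0..T} \<Longrightarrow> (v has_vector_derivative \<rho> t) (at t within {0..T})"
    "\<And>t. t \<in> {0..T} \<Longrightarrow> norm (r t) \<le> K2" "\<And>t. t \<in> {0..T} \<Longrightarrow> norm (\<rho> t) \<le> K2 + 3 * M"
proof -
  obtain R where R: "continuous_on {0..T} R" "\<And>t. t \<in> {0..T} \<Longrightarrow> (Z has_vector_derivative R t) (at t within {0..T})"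
    using wave.second_order_regularity[OF solution T Z_0 dense_at_F'0 dq_F'_Cauchy C3_nonneg k_nonneg(1)] by blast
  have RB: "norm (R t) \<le> K2" if t: "t \<in> {0..T}" for t
  proof -
    have lim: "((\<lambda>y. (1 / (y - t)) *\<^sub>R (Z y - Z t)) \<longlongrightarrow> R t) (at t within {0..T})"
      using R(2)[OF t] unfolding has_vector_derivative_iff_quotient by (simp add: tendsto_norm_zero_iff LIM_zero_iff)
    have "norm ((1 / (y - t)) *\<^sub>R (Z y - Z t)) \<le> K2" if "y \<in> {0..T}" "y \<noteq> t" for y
      using dq_Z_bound'[of t "y - t"] that t by (simp add: dq_def)
    then have "\<forall>\<^sub>F y in at t within {0..T}. norm ((1 / (y - t)) *\<^sub>R (Z y - Z t)) \<le> K2"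
      by (auto simp: eventually_at_filter)
    moreover have "at t within {0..T} \<noteq> bot" using T t by (simp add: at_within_Icc_nontrivial)
    ultimately show ?thesis by (intro tendsto_upperbound[OF tendsto_norm[OF lim]])
  qed
  have lc: "continuous_on {0..T} (lift 2)"
    using lift_deriv[of 2] has_vector_derivative_continuous unfolding continuous_on_eq_continuous_within by fastforce
  have fs: "((\<lambda>t. fst (Z t)) has_vector_derivative fst (R t)) (at t within {0..T})"
    "((\<lambda>t. snd (Z t)) has_vector_derivative snd (R t)) (at t within {0..T})" if "t \<in> {0..T}" for t
    using bounded_linear.has_vector_derivative[OF bounded_linear_fst R(2)[OF that]]
      bounded_linear.has_vector_derivative[OF bounded_linear_snd R(2)[OF that]] by auto
  show ?thesis
  proof
    show "continuous_on {0..T} (\<lambda>t. fst (R t))" "continuous_on {0..T} (\<lambda>t. snd (R t) + lift 2 t)"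
      by (intro continuous_intros R lc)+
    fix t assume t: "t \<in> {0..T}"
    show "(q has_vector_derivative fst (R t)) (at t within {0..T})" using fs(1)[OF t] by (simp add: Z_def)
    have l: "(lift 1 has_vector_derivative lift 2 t) (at t within {0..T})" using lift_deriv[of 1 t] t by (simp add: numeral_2_eq_2)
    have "((\<lambda>t. snd (Z t) + lift 1 t) has_vector_derivative snd (R t) + lift 2 t) (at t within {0..T})"
      by (rule has_vector_derivative_add[OF fs(2)[OF t] l])
    then show "(v has_vector_derivative snd (R t) + lift 2 t) (at t within {0..T})" by (simp add: Z_def)
    show "norm (fst (R t)) \<le> K2" using norm_fst_bound[of "R t"] RB[OF t] by simp
    show "norm (snd (R t) + lift 2 t) \<le> K2 + 3 * M"
      using norm_triangle_ineq[of "snd (R t)" "lift 2 t"] norm_snd_bound[of "R t"] RB[OF t] norm_lift[of 2 t] t by simp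
  qed
qed

lemma q_bound: "t \<in> {0..T} \<Longrightarrow> norm (q t) \<le> K1"
  using Z_bound[of t] norm_fst_bound[of "Z t"] by (simp add: Z_def)

end

section \<open>Classical solutions\<close>

text \<open>The weak derivative is closed: \<open>H1rel u q\<close> says that \<open>u - J q\<close> is a multiple of \<open>one_l2\<close>, which is a linear
  condition given by bounded operators.\<close>

lemma H1rel_derivative:
  assumes T: "T > 0" and t: "t \<in> {0..T}"
    and P: "(P has_vector_derivative Q) (at t within {0..T})" and PX: "(PX has_vector_derivative QX) (at t within {0..T})"
    and H: "\<And>s. s \<in> {0..T} \<Longrightarrow> H1rel (P s) (PX s)"
  shows "H1rel Q QX"
proof -
  define D where "D s = P s - J (PX s)" for s
  have DD: "(D has_vector_derivative Q - J QX) (at t within {0..T})"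
    unfolding D_def[abs_def]
    by (intro has_vector_derivative_diff P bounded_linear.has_vector_derivative[OF bounded_linear_J] PX)
  have "bounded_linear (\<lambda>w. inner w one_l2 *\<^sub>R one_l2)"
    by (intro bounded_linear_scaleR_const bounded_linear_inner_left)
  then have ED: "((\<lambda>s. inner (D s) one_l2 *\<^sub>R one_l2) has_vector_derivative inner (Q - J QX) one_l2 *\<^sub>R one_l2) (at t within {0..T})"
    using DD by (rule bounded_linear.has_vector_derivative)
  have eq: "D s = inner (D s) one_l2 *\<^sub>R one_l2" if s: "s \<in> {0..T}" for s
  proof -
    obtain C where "P s = C *\<^sub>R one_l2 + J (PX s)" using H[OF s] unfolding H1rel_def by blast
    then show ?thesis by (simp add: D_def inner_one_one)
  qed
  have "(D has_vector_derivative inner (Q - J QX) one_l2 *\<^sub>R one_l2) (at t within {0..T})"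
    by (rule has_vector_derivative_transform[OF t _ ED]) (rule eq)
  then have "Q - J QX = inner (Q - J QX) one_l2 *\<^sub>R one_l2"
    using vector_derivative_unique_within_closed_interval[of 0 T t D] DD T t by simp
  then have "Q = inner (Q - J QX) one_l2 *\<^sub>R one_l2 + J QX" by (simp add: algebra_simps)
  then show ?thesis unfolding H1rel_def by blast
qed

lemma Ck_ivl_bound:
  assumes g: "g \<in> Ck_ivl k T" and i: "i \<le> k" and t: "t \<in> {0..T}"
  shows "\<bar>(ivl_deriv T ^^ i) g t\<bar> \<le> Ck_ivl_norm k T g"
proof -
  have bdd: "bdd_above ((\<lambda>t. \<bar>(ivl_deriv T ^^ j) g t\<bar>) ` {0..T})" if "j \<le> k" for j
  proof -
    have "continuous_on {0..T} (\<lambda>t. \<bar>(ivl_deriv T ^^ j) g t\<bar>)"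
      using g that unfolding Ck_ivl_def by (intro continuous_intros) auto
    then have "compact ((\<lambda>t. \<bar>(ivl_deriv T ^^ j) g t\<bar>) ` {0..T})" by (intro compact_continuous_image) auto
    then show ?thesis by (intro bounded_imp_bdd_above compact_imp_bounded)
  qed
  have nn: "0 \<le> (SUP t\<in>{0..T}. \<bar>(ivl_deriv T ^^ j) g t\<bar>)" if "j \<le> k" for j
    by (rule cSUP_upper2[OF bdd[OF that] t]) simp
  have "\<bar>(ivl_deriv T ^^ i) g t\<bar> \<le> (SUP t\<in>{0..T}. \<bar>(ivl_deriv T ^^ i) g t\<bar>)"
    by (rule cSUP_upper[OF t bdd[OF i]])
  also have "\<dots> \<le> (\<Sum>i\<le>k. SUP t\<in>{0..T}. \<bar>(ivl_deriv T ^^ i) g t\<bar>)"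
    by (rule member_le_sum) (use nn i in auto)
  finally show ?thesis unfolding Ck_ivl_norm_def .
qed

lemma continuous_zero_at_left_end:
  fixes f :: "real \<Rightarrow> 'a::real_normed_vector"
  assumes "continuous_on {0..T} f" "T > 0" "\<And>t. t \<in> {0<..T} \<Longrightarrow> f t = 0" "t \<in> {0..T}"
  shows "f t = 0"
  by (rule continuous_constant_on_closure[where S = "{0<..T}" and f = f]) (use assms in auto)

text \<open>The differential equations hold for positive times and extend to time 0 by
  continuity in $L^2$. There the initial data are constant, so their weak derivatives vanish
  and the equations give zero initial time derivatives.\<close>

lemma classical_solution_as_l2_curves:
  assumes T: "T > 0" and A1: "assumption_A1 a\<^sub>0 a\<^sub>1 a\<^sub>2 a\<^sub>3 a" and A2: "assumption_A2 c p\<^sub>0 u\<^sub>0" 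
    and A3: "assumption_A3 T g\<^sub>0 g\<^sub>1"
    and M0: "Ck_ivl_norm 4 T g\<^sub>0 \<le> M" and M1: "Ck_ivl_norm 4 T g\<^sub>1 \<le> M"
    and sol: "classical_solution T a g\<^sub>0 g\<^sub>1 p\<^sub>0 u\<^sub>0 p u"
  shows "wave_solution a (deriv a) (deriv (deriv a)) a\<^sub>1 a\<^sub>2 a\<^sub>3 T M
      (\<lambda>i. (ivl_deriv T ^^ i) g\<^sub>0) (\<lambda>i. (ivl_deriv T ^^ i) g\<^sub>1)
      (\<lambda>t. toL2 (p t)) (\<lambda>t. toL2 (u t)) (\<lambda>t. toL2 (time_deriv L2 T p t)) (\<lambda>t. toL2 (time_deriv L2 T u t))"
    and "\<And>t. t \<in> {0..T} \<Longrightarrow> H1rel (toL2 (u t)) (- toL2 (time_deriv L2 T p t))"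
    and "toL2 (p 0) = c *\<^sub>R one_l2" "toL2 (u 0) = 0"
proof -
  let ?P = "\<lambda>t. toL2 (p t)" and ?U = "\<lambda>t. toL2 (u t)" and ?Q = "\<lambda>t. toL2 (time_deriv L2 T p t)" and ?V = "\<lambda>t. toL2 (time_deriv L2 T u t)"
  let ?px = "\<lambda>t. toL2 (weak_deriv unit_ivl 1 (p t))" and ?ux = "\<lambda>t. toL2 (weak_deriv unit_ivl 1 (u t))"
  note reg = coefficient_regularity[OF A1]
  have a_pos: "0 < a\<^sub>0" and a0: "a 0 = 0" using A1 unfolding assumption_A1_def by auto
  interpret coefficient a "deriv a" "deriv (deriv a)" a\<^sub>1 a\<^sub>2 a\<^sub>3
  proof
    show "\<bar>deriv a x\<bar> \<le> a\<^sub>1" for x using reg(3,4)[of x] a_pos by linarith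
  qed (use reg a0 in auto)
  have pC: "p \<in> Ck_curves 1 T L2" "p \<in> Ck_curves 0 T H1" and uC: "u \<in> Ck_curves 1 T L2" "u \<in> Ck_curves 0 T H1"
    using sol unfolding classical_solution_def by auto
  note L2s = Ck_curves_1_iff continuous_curve_iff[OF embeds_L2] has_time_deriv_iff[OF embeds_L2]
  note H1s = Ck_curves_0_iff continuous_curve_iff[OF embeds_H1]
  have car: "p t \<in> space_carrier L2" "u t \<in> space_carrier L2" "time_deriv L2 T p t \<in> space_carrier L2" 
    "time_deriv L2 T u t \<in> space_carrier L2" if "t \<in> {0..T}" for t
    using pC(1) uC(1) that unfolding L2s by auto
  have car1: "p t \<in> space_carrier H1" "u t \<in> space_carrier H1" if "t \<in> {0..T}" for t
    using pC(2) uC(2) that unfolding H1s by auto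
  have wc: "weak_deriv unit_ivl 1 (p t) \<in> space_carrier L2" "weak_deriv unit_ivl 1 (u t) \<in> space_carrier L2"
    and wr: "H1rel (?P t) (?px t)" "H1rel (?U t) (?ux t)" if "t \<in> {0..T}" for t
    using H1_carrierD[OF car1(1)[OF that]] H1_carrierD[OF car1(2)[OF that]] by auto
  have cQ: "continuous_on {0..T} ?Q" and cV: "continuous_on {0..T} ?V" and cU: "continuous_on {0..T} ?U"
    using pC(1) uC(1) unfolding L2s by auto
  have cx: "continuous_on {0..T} ?px" "continuous_on {0..T} ?ux"
    using pC(2) uC(2) continuous_on_snd[of "{0..T}" "\<lambda>t. toH1 (p t)"] continuous_on_snd[of "{0..T}" "\<lambda>t. toH1 (u t)"]
    unfolding H1s by (auto simp: toH1_def)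
  have "lipschitz_on a\<^sub>1 UNIV (nem a)"
    using nem_Lip k_nonneg by (auto intro!: lipschitz_onI simp: dist_norm)
  then have "continuous_on UNIV (nem a)" by (rule lipschitz_on_continuous_on)
  then have cN: "continuous_on {0..T} (\<lambda>t. nem a (?U t))" by (rule continuous_on_compose2[OF _ cU]) auto
  have z1: "?Q t + ?ux t = 0" if t: "t \<in> {0..T}" for t
  proof (rule continuous_zero_at_left_end[OF _ T _ t])
    show "continuous_on {0..T} (\<lambda>t. ?Q t + ?ux t)" by (intro continuous_intros cQ cx)
    fix s assume s: "s \<in> {0<..T}"
    then have s': "s \<in> {0..T}" by auto
    have "AE x in I01. time_deriv L2 T p s x + weak_deriv unit_ivl 1 (u s) x = 0"
      using sol s unfolding classical_solution_def by blast
    then have "toL2 (\<lambda>x. time_deriv L2 T p s x + weak_deriv unit_ivl 1 (u s) x) = toL2 (\<lambda>x. 0)"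
      using car[OF s'] wc[OF s'] by (subst toL2_eq_iff) (auto intro: L2_add)
    then show "?Q s + ?ux s = 0" using car[OF s'] wc[OF s'] by (simp add: toL2_add toL2_zero)
  qed
  have z2: "?V t + ?px t + nem a (?U t) = 0" if t: "t \<in> {0..T}" for t
  proof (rule continuous_zero_at_left_end[OF _ T _ t])
    show "continuous_on {0..T} (\<lambda>t. ?V t + ?px t + nem a (?U t))" by (intro continuous_intros cV cx cN)
    fix s assume s: "s \<in> {0<..T}"
    then have s': "s \<in> {0..T}" by auto
    have "AE x in I01. time_deriv L2 T u s x + weak_deriv unit_ivl 1 (p s) x + a (u s x) = 0"
      using sol s unfolding classical_solution_def by blast
    then have "toL2 (\<lambda>x. time_deriv L2 T u s x + weak_deriv unit_ivl 1 (p s) x + a (u s x)) = toL2 (\<lambda>x. 0)"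
      using car[OF s'] wc[OF s'] nem_carrier by (subst toL2_eq_iff) (auto intro!: L2_add)
    then show "?V s + ?px s + nem a (?U s) = 0"
      using car[OF s'] wc[OF s'] nem_carrier[OF car(2)[OF s']]
      by (simp add: toL2_add toL2_zero L2_add nem_toL2)
  qed
  have T0: "(0::real) \<in> {0..T}" using T by simp
  have "AE x in I01. x \<in> unit_ivl" by (rule AE_I2) simp
  moreover have "AE x in I01. p 0 x = p\<^sub>0 x" "AE x in I01. u 0 x = u\<^sub>0 x"
    using sol unfolding classical_solution_def by auto
  ultimately have ini: "AE x in I01. p 0 x = c" "AE x in I01. u 0 x = 0"
    using A2 unfolding assumption_A2_def by (auto elim: eventually_elim2)
  have "toL2 (p 0) = toL2 (\<lambda>x. c * 1)" using ini car[OF T0] by (subst toL2_eq_iff) auto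
  then show p0: "toL2 (p 0) = c *\<^sub>R one_l2" by (simp only: one_l2_def toL2_scale[OF L2_const])
  have "toL2 (u 0) = toL2 (\<lambda>x. 0)" using ini car[OF T0] by (subst toL2_eq_iff) (auto simp: L2_zero)
  then show u0: "toL2 (u 0) = 0" by (simp add: toL2_zero)
  have J0: "J 0 = 0" using linear_0[OF bounded_linear.linear[OF bounded_linear_J]] .
  have "H1rel (?P 0) 0" unfolding p0 H1rel_def J0 by auto
  then have px0: "?px 0 = 0" using H1rel_unique[OF wr(1)[OF T0]] by blast
  have "H1rel (?U 0) 0" unfolding u0 H1rel_def J0 by (auto intro: exI[of _ 0])
  then have ux0: "?ux 0 = 0" using H1rel_unique[OF wr(2)[OF T0]] by blast
  have Q0: "?Q 0 = 0" using z1[OF T0] ux0 by simp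
  have V0: "?V 0 = 0" using z2[OF T0] px0 u0 nem_0 by simp
  have uxQ: "?ux t = - ?Q t" if "t \<in> {0..T}" for t using z1[OF that] by (simp add: eq_neg_iff_add_eq_0 add.commute)
  have pxV: "?px t = - (?V t + nem a (?U t))" if "t \<in> {0..T}" for t
    using z2[OF that] by (simp add: eq_neg_iff_add_eq_0 algebra_simps)
  show "H1rel (?U t) (- ?Q t)" if "t \<in> {0..T}" for t using wr(2)[OF that] uxQ[OF that] by simp
  have g: "g\<^sub>0 \<in> Ck_ivl 4 T" "g\<^sub>1 \<in> Ck_ivl 4 T" "g\<^sub>0 0 = 0" "g\<^sub>1 0 = 0" "ivl_deriv T g\<^sub>0 0 = 0" "ivl_deriv T g\<^sub>1 0 = 0"
    using A3 unfolding assumption_A3_def by auto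
  have tr: "?U t = g\<^sub>0 t *\<^sub>R one_l2 + J (- ?Q t) \<and> inner (- ?Q t) one_l2 = g\<^sub>1 t - g\<^sub>0 t" if t: "t \<in> {0..T}" for t
  proof (cases "t = 0")
    case True
    then show ?thesis using u0 Q0 g J0 by simp
  next
    case False
    then have "has_trace (u t) 0 (g\<^sub>0 t)" "has_trace (u t) 1 (g\<^sub>1 t)"
      using sol t unfolding classical_solution_def by auto
    from H1rel_trace[OF car(2)[OF t] wc(2)[OF t] wr(2)[OF t] this] show ?thesis unfolding uxQ[OF t] by simp
  qed
  show "wave_solution a (deriv a) (deriv (deriv a)) a\<^sub>1 a\<^sub>2 a\<^sub>3 T M
      (\<lambda>i. (ivl_deriv T ^^ i) g\<^sub>0) (\<lambda>i. (ivl_deriv T ^^ i) g\<^sub>1) ?P ?U ?Q ?V"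
  proof (intro_locales, unfold_locales)
    show "((ivl_deriv T ^^ i) g\<^sub>0 has_real_derivative (ivl_deriv T ^^ Suc i) g\<^sub>0 t) (at t within {0..T})"
      "((ivl_deriv T ^^ i) g\<^sub>1 has_real_derivative (ivl_deriv T ^^ Suc i) g\<^sub>1 t) (at t within {0..T})"
      if "i < 4" "t \<in> {0..T}" for i t using g that unfolding Ck_ivl_def by auto
    show "\<bar>(ivl_deriv T ^^ i) g\<^sub>0 t\<bar> \<le> M" "\<bar>(ivl_deriv T ^^ i) g\<^sub>1 t\<bar> \<le> M" if "i \<le> 4" "t \<in> {0..T}" for i t
      using Ck_ivl_bound[OF g(1) that] Ck_ivl_bound[OF g(2) that] M0 M1 by auto
    show "(?P has_vector_derivative ?Q t) (at t within {0..T})" "(?U has_vector_derivative ?V t) (at t within {0..T})"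
      if "t \<in> {0..T}" for t using pC(1) uC(1) that unfolding L2s by auto
    show "H1rel (?P t) (- (?V t + nem a (?U t)))" if "t \<in> {0..T}" for t
      using wr(1)[OF that] pxV[OF that] by simp
    show "?U t = (ivl_deriv T ^^ 0) g\<^sub>0 t *\<^sub>R one_l2 + J (- ?Q t)"
      "inner (- ?Q t) one_l2 = (ivl_deriv T ^^ 0) g\<^sub>1 t - (ivl_deriv T ^^ 0) g\<^sub>0 t" if "t \<in> {0..T}" for t
      using tr[OF that] by auto
  qed (use T g cQ cV Q0 V0 in auto)
qed

theorem theorem3p2:
  fixes T a\<^sub>0 a\<^sub>1 a\<^sub>2 a\<^sub>3 M\<^sub>c M\<^sub>0 M\<^sub>1 :: real
  assumes "T > 0"
  shows "\<exists>C''. \<forall>a c g\<^sub>0 g\<^sub>1 p\<^sub>0 u\<^sub>0 p u.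
    assumption_A1 a\<^sub>0 a\<^sub>1 a\<^sub>2 a\<^sub>3 a \<longrightarrow>
    assumption_A2 c p\<^sub>0 u\<^sub>0 \<longrightarrow>
    assumption_A3 T g\<^sub>0 g\<^sub>1 \<longrightarrow>
    \<bar>c\<bar> \<le> M\<^sub>c \<longrightarrow> Ck_ivl_norm 4 T g\<^sub>0 \<le> M\<^sub>0 \<longrightarrow> Ck_ivl_norm 4 T g\<^sub>1 \<le> M\<^sub>1 \<longrightarrow>
    classical_solution T a g\<^sub>0 g\<^sub>1 p\<^sub>0 u\<^sub>0 p u \<longrightarrow>
      p \<in> Ck_curves 1 T H1 \<inter> Ck_curves 2 T L2 \<and>
      u \<in> Ck_curves 1 T H1 \<inter> Ck_curves 2 T L2 \<and>
      Ck_norm_pair 1 T H1 p u + Ck_norm_pair 2 T L2 p u \<le> C''"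
proof -
  define M where "M = max M\<^sub>0 M\<^sub>1"
  \<comment> \<open>Bounds for \<open>p'\<close>, for \<open>u'\<close>, and for the second time derivative of the lifted unknown.\<close>
  define \<kappa>1 \<kappa>v \<kappa>2 where "\<kappa>1 = wave_solution.K1 a\<^sub>1 T M" and "\<kappa>v = wave_solution.V a\<^sub>1 T M" 
    and "\<kappa>2 = wave_solution.K2 a\<^sub>1 a\<^sub>2 T M"
  \<comment> \<open>The names list the function and its derivatives. The bounds for \<open>p\<close> and \<open>u\<close> integrate the time derivative; those with \<open>x\<close> use \<open>p\<^sub>x = - (u' + a u)\<close>, and \<open>u\<^sub>x = - p'\<close> needs no bound of its own.\<close>
  define bp bu bpx bptt butt bpxt where "bp = M\<^sub>c + T * \<kappa>1" and "bu = T * \<kappa>v" and "bpx = \<kappa>v + a\<^sub>1 * bu"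
    and "bptt = \<kappa>2" and "butt = \<kappa>2 + 3 * M" and "bpxt = butt + a\<^sub>1 * \<kappa>v"
  define C where "C = ((bp + bpx) + (bu + \<kappa>1)) + ((\<kappa>1 + bpxt) + (\<kappa>v + bptt)) + ((bp + bu) + (\<kappa>1 + \<kappa>v) + (bptt + butt))"
  show ?thesis
  proof (intro exI[of _ C] allI impI)
    fix a c g\<^sub>0 g\<^sub>1 p\<^sub>0 u\<^sub>0 p u
    assume A1: "assumption_A1 a\<^sub>0 a\<^sub>1 a\<^sub>2 a\<^sub>3 a" and A2: "assumption_A2 c p\<^sub>0 u\<^sub>0" and A3: "assumption_A3 T g\<^sub>0 g\<^sub>1"
      and c: "\<bar>c\<bar> \<le> M\<^sub>c" and M0: "Ck_ivl_norm 4 T g\<^sub>0 \<le> M\<^sub>0" and M1: "Ck_ivl_norm 4 T g\<^sub>1 \<le> M\<^sub>1"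
      and sol: "classical_solution T a g\<^sub>0 g\<^sub>1 p\<^sub>0 u\<^sub>0 p u"
    define P U Q V where "P t = toL2 (p t)" and "U t = toL2 (u t)" and "Q t = toL2 (time_deriv L2 T p t)"
      and "V t = toL2 (time_deriv L2 T u t)" for t
    have M01: "Ck_ivl_norm 4 T g\<^sub>0 \<le> M" "Ck_ivl_norm 4 T g\<^sub>1 \<le> M" using M0 M1 by (auto simp: M_def)
    note W = classical_solution_as_l2_curves[OF assms A1 A2 A3 M01 sol, folded P_def U_def Q_def V_def]
    interpret W: wave_solution a "deriv a" "deriv (deriv a)" a\<^sub>1 a\<^sub>2 a\<^sub>3 T M
      "\<lambda>i. (ivl_deriv T ^^ i) g\<^sub>0" "\<lambda>i. (ivl_deriv T ^^ i) g\<^sub>1" P U Q V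
      using W(1) unfolding P_def[abs_def] U_def[abs_def] Q_def[abs_def] V_def[abs_def] .
    obtain r \<rho> where r: "continuous_on {0..T} r" "continuous_on {0..T} \<rho>"
      "\<And>t. t \<in> {0..T} \<Longrightarrow> (Q has_vector_derivative r t) (at t within {0..T})"
      "\<And>t. t \<in> {0..T} \<Longrightarrow> (V has_vector_derivative \<rho> t) (at t within {0..T})"
      "\<And>t. t \<in> {0..T} \<Longrightarrow> norm (r t) \<le> \<kappa>2" "\<And>t. t \<in> {0..T} \<Longrightarrow> norm (\<rho> t) \<le> \<kappa>2 + 3 * M"
      using W.second_derivatives unfolding \<kappa>2_def by blast
    have pC: "p \<in> Ck_curves 1 T L2" "p \<in> Ck_curves 0 T H1" and uC: "u \<in> Ck_curves 1 T L2" "u \<in> Ck_curves 0 T H1"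
      using sol unfolding classical_solution_def by auto
    have D1: "has_time_deriv L2 T p (time_deriv L2 T p)" "has_time_deriv L2 T u (time_deriv L2 T u)"
      using pC(1) uC(1) unfolding Ck_curves_1_iff by auto
    have car: "p t \<in> space_carrier L2" "u t \<in> space_carrier L2" "time_deriv L2 T p t \<in> space_carrier L2" 
      "time_deriv L2 T u t \<in> space_carrier L2" if "t \<in> {0..T}" for t
      using D1 that unfolding has_time_deriv_iff[OF embeds_L2] by auto
    have D2: "has_time_deriv L2 T (time_deriv L2 T p) (\<lambda>t. fn (r t))" "has_time_deriv L2 T (time_deriv L2 T u) (\<lambda>t. fn (\<rho> t))"
      unfolding has_time_deriv_iff[OF embeds_L2] using car r(3,4)
      by (auto simp: Q_def[abs_def] V_def[abs_def])
    note p2 = Ck_curves_2I[OF embeds_L2 assms pC(1) D2(1)] and u2 = Ck_curves_2I[OF embeds_L2 assms uC(1) D2(2)]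
    have car1: "p t \<in> space_carrier H1" "u t \<in> space_carrier H1" if "t \<in> {0..T}" for t
      using pC(2) uC(2) that unfolding Ck_curves_0_iff continuous_curve_iff[OF embeds_H1] by auto
    have uH: "H1rel (U t) (- Q t)" if "t \<in> {0..T}" for t by (rule W(2)[OF that])
    have px: "toL2 (weak_deriv unit_ivl 1 (p t)) = - (V t + nem a (U t))"
      and ux: "toL2 (weak_deriv unit_ivl 1 (u t)) = - Q t" if "t \<in> {0..T}" for t
      using H1rel_unique[OF H1_carrierD(4)[OF car1(1)[OF that]]] H1rel_unique[OF H1_carrierD(4)[OF car1(2)[OF that]]]
        W.p_H1[OF that] uH[OF that] by (auto simp: P_def U_def)
    have DX: "((\<lambda>t. - (V t + nem a (U t))) has_vector_derivative - (\<rho> t + W.dnem (U t) (V t))) (at t within {0..T})"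
      "((\<lambda>t. - Q t) has_vector_derivative - r t) (at t within {0..T})" if "t \<in> {0..T}" for t
      by (intro has_vector_derivative_minus has_vector_derivative_add r(3,4) W.nem_u_deriv that)+
    have qH: "H1rel (Q t) (- (\<rho> t + W.dnem (U t) (V t)))" "H1rel (V t) (- r t)" if "t \<in> {0..T}" for t
      using H1rel_derivative[OF assms that W.p_deriv[OF that] DX(1)[OF that] W.p_H1]
        H1rel_derivative[OF assms that W.u_deriv[OF that] DX(2)[OF that] uH] by auto
    have qC: "time_deriv L2 T p t \<in> space_carrier H1" "toL2 (weak_deriv unit_ivl 1 (time_deriv L2 T p t)) = - (\<rho> t + W.dnem (U t) (V t))"
      and vC: "time_deriv L2 T u t \<in> space_carrier H1" "toL2 (weak_deriv unit_ivl 1 (time_deriv L2 T u t)) = - r t" if "t \<in> {0..T}" for t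
      using H1_carrierI[OF car(3)[OF that]] H1_carrierI[OF car(4)[OF that]] qH[OF that] by (auto simp: Q_def V_def)
    have jH: "toH1 (p t) = (P t, - (V t + nem a (U t)))" "toH1 (u t) = (U t, - Q t)"
      "toH1 (time_deriv L2 T p t) = (Q t, - (\<rho> t + W.dnem (U t) (V t)))" "toH1 (time_deriv L2 T u t) = (V t, - r t)" if "t \<in> {0..T}" for t
      using px[OF that] ux[OF that] qC[OF that] vC[OF that] by (auto simp: toH1_def P_def U_def Q_def V_def)
    have DHp: "((\<lambda>t. toH1 (p t)) has_vector_derivative toH1 (time_deriv L2 T p t)) (at t within {0..T})"
      and DHu: "((\<lambda>t. toH1 (u t)) has_vector_derivative toH1 (time_deriv L2 T u t)) (at t within {0..T})"
      if t: "t \<in> {0..T}" for t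
    proof -
      have "((\<lambda>t. (P t, - (V t + nem a (U t)))) has_vector_derivative (Q t, - (\<rho> t + W.dnem (U t) (V t)))) (at t within {0..T})"
        by (intro has_vector_derivative_Pair W.p_deriv DX t)
      then show "((\<lambda>t. toH1 (p t)) has_vector_derivative toH1 (time_deriv L2 T p t)) (at t within {0..T})"
        unfolding jH(3)[OF t] by (rule has_vector_derivative_transform[OF t, rotated]) (simp add: jH)
      have "((\<lambda>t. (U t, - Q t)) has_vector_derivative (V t, - r t)) (at t within {0..T})"
        by (intro has_vector_derivative_Pair W.u_deriv DX t)
      then show "((\<lambda>t. toH1 (u t)) has_vector_derivative toH1 (time_deriv L2 T u t)) (at t within {0..T})"
        unfolding jH(4)[OF t] by (rule has_vector_derivative_transform[OF t, rotated]) (simp add: jH)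
    qed
    have DH: "has_time_deriv H1 T p (time_deriv L2 T p)" "has_time_deriv H1 T u (time_deriv L2 T u)"
      unfolding has_time_deriv_iff[OF embeds_H1] using car1 qC vC DHp DHu by blast+
    have cH: "continuous_on {0..T} (\<lambda>t. toH1 (time_deriv L2 T p t))" "continuous_on {0..T} (\<lambda>t. toH1 (time_deriv L2 T u t))"
    proof -
      have "continuous_on {0..T} (\<lambda>t. (Q t, - (\<rho> t + W.dnem (U t) (V t))))"
        by (intro continuous_intros W.q_cont r(2) W.dnem_continuous)
      then show "continuous_on {0..T} (\<lambda>t. toH1 (time_deriv L2 T p t))"
        by (simp add: jH cong: continuous_on_cong_simp)
      have "continuous_on {0..T} (\<lambda>t. (V t, - r t))" by (intro continuous_intros W.v_cont r(1))
      then show "continuous_on {0..T} (\<lambda>t. toH1 (time_deriv L2 T u t))"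
        by (simp add: jH cong: continuous_on_cong_simp)
    qed
    note pH = Ck_curves_1I[OF embeds_H1 assms DH(1), OF cH(1)] and uH1 = Ck_curves_1I[OF embeds_H1 assms DH(2), OF cH(2)]
    have a1: "0 \<le> a\<^sub>1" using W.k_nonneg by simp
    have bQ: "norm (Q t) \<le> \<kappa>1" and bV: "norm (V t) \<le> \<kappa>v" if "t \<in> {0..T}" for t
      using W.q_bound[OF that] W.v_bound[OF that] by (auto simp: \<kappa>1_def \<kappa>v_def)
    have T0: "(0::real) \<in> {0..T}" using assms by simp
    have bP: "norm (P t) \<le> bp" if t: "t \<in> {0..T}" for t
    proof -
      have "norm (P t - P 0) \<le> \<kappa>1 * \<bar>t - 0\<bar>" by (rule vector_diff_le[OF W.p_deriv bQ T0 t])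
      also have "\<dots> \<le> \<kappa>1 * T" using t order_trans[OF norm_ge_zero bQ[OF T0]] by (intro mult_left_mono) auto
      also have "norm (P 0) \<le> M\<^sub>c * 1" unfolding W(3) norm_scaleR using c norm_one_l2 by (intro mult_mono) auto
      ultimately show ?thesis using norm_triangle_ineq[of "P t - P 0" "P 0"] by (simp add: bp_def mult.commute)
    qed
    have bU: "norm (U t) \<le> bu" if t: "t \<in> {0..T}" for t
    proof -
      have "norm (U t - U 0) \<le> \<kappa>v * \<bar>t - 0\<bar>" by (rule vector_diff_le[OF W.u_deriv bV T0 t])
      also have "\<dots> \<le> \<kappa>v * T" using t order_trans[OF norm_ge_zero bV[OF T0]] by (intro mult_left_mono) auto
      finally show ?thesis using W(4) by (simp add: bu_def mult.commute)
    qed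
    have bPX: "norm (V t + nem a (U t)) \<le> bpx" if t: "t \<in> {0..T}" for t
      using norm_triangle_ineq[of "V t" "nem a (U t)"] bV[OF t] W.norm_nem[of "U t"] mult_left_mono[OF bU[OF t] a1]
      by (simp add: bpx_def)
    have bPXT: "norm (\<rho> t + W.dnem (U t) (V t)) \<le> bpxt" if t: "t \<in> {0..T}" for t
      using norm_triangle_ineq[of "\<rho> t" "W.dnem (U t) (V t)"] r(6)[OF t] W.norm_dnem[of "U t" "V t"] mult_left_mono[OF bV[OF t] a1]
      by (simp add: bpxt_def butt_def)
    have pair: "norm (x, - y) \<le> A + B" if "norm x \<le> A" "norm y \<le> B" for x y :: l2 and A B
      using norm_prod_le[of "(x, - y)"] that by simp
    have bH: "norm (toH1 (p t)) \<le> bp + bpx" "norm (toH1 (u t)) \<le> bu + \<kappa>1"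
      "norm (toH1 (time_deriv L2 T p t)) \<le> \<kappa>1 + bpxt" "norm (toH1 (time_deriv L2 T u t)) \<le> \<kappa>v + bptt" if t: "t \<in> {0..T}" for t
      unfolding jH[OF t] by (rule pair[OF bP[OF t] bPX[OF t]] pair[OF bU[OF t] bQ[OF t]] pair[OF bQ[OF t] bPXT[OF t]]
          pair[OF bV[OF t] r(5)[OF t, folded bptt_def]])+
    have "Ck_norm_pair 1 T H1 p u \<le> ((bp + bpx) + (bu + \<kappa>1)) + ((\<kappa>1 + bpxt) + (\<kappa>v + bptt))"
    proof -
      have "(SUP t\<in>{0..T}. sqrt ((space_norm H1 (p t))\<^sup>2 + (space_norm H1 (u t))\<^sup>2)) \<le> (bp + bpx) + (bu + \<kappa>1)"
        by (rule SUP_pair_le[OF embeds_H1 assms]) (use car1 bH in simp)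
      moreover have "(SUP t\<in>{0..T}. sqrt ((space_norm H1 (time_deriv H1 T p t))\<^sup>2 + (space_norm H1 (time_deriv H1 T u t))\<^sup>2)) \<le> (\<kappa>1 + bpxt) + (\<kappa>v + bptt)"
        by (rule SUP_pair_le[OF embeds_H1 assms]) (use pH uH1 bH in simp)
      ultimately show ?thesis by (simp add: Ck_norm_pair_def)
    qed
    moreover have "Ck_norm_pair 2 T L2 p u \<le> (bp + bu) + (\<kappa>1 + \<kappa>v) + (bptt + butt)"
    proof -
      have "(SUP t\<in>{0..T}. sqrt ((space_norm L2 (p t))\<^sup>2 + (space_norm L2 (u t))\<^sup>2)) \<le> bp + bu"
        by (rule SUP_pair_le[OF embeds_L2 assms]) (use car bP bU in \<open>auto simp: P_def U_def\<close>)
      moreover have "(SUP t\<in>{0..T}. sqrt ((space_norm L2 (time_deriv L2 T p t))\<^sup>2 + (space_norm L2 (time_deriv L2 T u t))\<^sup>2)) \<le> \<kappa>1 + \<kappa>v"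
        by (rule SUP_pair_le[OF embeds_L2 assms]) (use car bQ bV in \<open>auto simp: Q_def V_def\<close>)
      moreover have "(SUP t\<in>{0..T}. sqrt ((space_norm L2 (time_deriv L2 T (time_deriv L2 T p) t))\<^sup>2 + (space_norm L2 (time_deriv L2 T (time_deriv L2 T u) t))\<^sup>2)) \<le> bptt + butt"
        by (rule SUP_pair_le[OF embeds_L2 assms]) (use p2 u2 r in \<open>auto simp: bptt_def butt_def\<close>)
      ultimately show ?thesis by (simp add: Ck_norm_pair_def numeral_2_eq_2)
    qed
    ultimately show "p \<in> Ck_curves 1 T H1 \<inter> Ck_curves 2 T L2 \<and> u \<in> Ck_curves 1 T H1 \<inter> Ck_curves 2 T L2 \<and>
      Ck_norm_pair 1 T H1 p u + Ck_norm_pair 2 T L2 p u \<le> C"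
      using p2(1) u2(1) pH(1) uH1(1) r(1,2) by (simp add: C_def)
  qed
qed

end
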